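(* For every integer $t\ge0$ satisfying $t+2\le d$ and $t+1\le n$, with $X^{(t)}$, $y=\varphi(g^{-1})$ and the iterates $(u^\ell,v^{\ell+1})$ constructed in the context: (i) jointly with the initialization and external seeds, $$(X^{(t)},y,v^0,\mathcal E_{\rm link},\mathcal E_{\rm alg})\overset{(d)}{=}(X,y,v^0,\mathcal E_{\rm link},\mathcal E_{\rm alg}),$$ where on the right-hand side $X$ has i.i.d. $N(0,1/d)$ entries and $y=\varphi(X\theta^\star)$ follows the single-index model; in particular, $v^0$ and $\mathcal E_{\rm alg}$ are independent of $(X^{(t)},y)$; (ii) the AMP recursion driven by $(X^{(t)},y)$ and started at $v^0$ agrees pathwise with the constructed iterates through the iterate $v^{t+1}$. Moreover, for every deterministic $T$ satisfying $T+2\le d$ and $T+1\le n$, the single matrix $X^{(T)}$ realizes this pathwise coupling simultaneously through $v^{T+1}$ (so conclusions at times $t\le T$ may be intersected on one probability space).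
   Context: Single-index model and AMP. $n,d\ge1$, $\delta=n/d$; $\theta^\star\in\mathbb R^d$ deterministic with $\|\theta^\star\|=\sqrt d$; $X\in\mathbb R^{n\times d}$ with i.i.d. $N(0,1/d)$ entries; $y=\varphi(X\theta^\star)$ with $\varphi$ applied entrywise and possibly using external randomness $\mathcal E_{\rm link}$. For scalar nonlinearities $f_t,h_t$ acting entrywise (primes denote derivatives in the first argument) and an initialization $v^0\in\mathbb R^d$ independent of $(X,y)$, AMP is $u^0=Xf_0(v^0)$ and, for $t\ge0$, $$v^{t+1}=X^\top h_t(u^t,y)-\hat c_tf_t(v^t),\qquad u^{t+1}=Xf_{t+1}(v^{t+1})-\hat b_{t+1}h_t(u^t,y),$$ $\hat c_t=\frac1d\sum_{i=1}^nh_t'(u_i^t,y_i)$, $\hat b_{t}=\frac1d\sum_{j=1}^df_{t}'(v_j^{t})$. Random parameters. $f_k(v)=\mathsf f_k(v;\xi_k)$, $h_k(u,y)=\mathsf h_k(u,y;\vartheta_k)$, where $\mathsf f_k,\mathsf h_k$ are deterministic maps and $\xi_k\in\mathbb R^{p_k^f}$, $\vartheta_k\in\mathbb R^{p_k^h}$ are random parameter vectors in deterministic sets. There is a universal integer $C_{\rm par}\ge1$ with $\sum_{k=0}^{t+1}(p_k^f+p_k^h)\le C_{\rm par}(t+2)$; for $0\le j\le3$ and parameters of norm at most $n^6$, $|\partial_v^j\mathsf f_k(v;\xi)-\partial_v^j\mathsf f_k(v;\tilde\xi)|\le n^{C_{\rm par}}(1+|v|^{C_{\rm par}})\|\xi-\tilde\xi\|$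 and $|\partial_u^j\mathsf h_k(u,y;\vartheta)-\partial_u^j\mathsf h_k(u,y;\tilde\vartheta)|\le n^{C_{\rm par}}(1+|u|^{C_{\rm par}}+|y|^{C_{\rm par}})\|\vartheta-\tilde\vartheta\|$; and $\mathbb P(\max_i|y_i|>n^{C_{\rm par}})\le n^{-20}$. Probability space. Let $g^{-1},g^0,g^1,\dots\sim N(0,I_n)$, $s^0,s^1,\dots\sim N(0,I_d)$, $W\in\mathbb R^{n\times d}$ with i.i.d. $N(0,1/d)$ entries, $v^0$, and the external seeds $(\mathcal E_{\rm link},\mathcal E_{\rm alg})$ (link randomness and auxiliary algorithmic seed) be such that $v^0$, all $g^\ell$, all $s^\ell$, $W$ are mutually independent and independent of the seeds. $y=\varphi(g^{-1})$ is measurable with respect to $(g^{-1},\mathcal E_{\rm link})$. Predictability: with $\mathcal E=\sigma(\mathcal E_{\rm link},\mathcal E_{\rm alg})$, $\xi_0$ is measurable w.r.t. $(v^0,\mathcal E_{\rm alg})$, and for $\ell\ge0$, $\vartheta_\ell$ is measurable w.r.t. $(\mathcal E,v^0,\{g^j\}_{j=-1}^{\ell},\{s^j\}_{j=0}^{\ell-1})$ and $\xi_{\ell+1}$ w.r.t. $(\mathcal E,v^0,\{g^j\}_{j=-1}^{\ell},\{s^j\}_{j=0}^{\ell})$. Construction. $q^{-1}=\theta^\star/\sqrt d$, $w^{-1}=0$, $z^0=f_0(v^0)$. For $\ell\ge0$ let $q^\ell$ be the normalization of the component of $z^\ell=f_\ell(v^\ell)$ orthogonal to $q^{-1},\dots,q^{\ell-1}$,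 and $r^\ell$ the normalization of the component of $w^\ell=h_\ell(u^\ell,y)$ orthogonal to $r^0,\dots,r^{\ell-1}$ (if such a component is zero, the basis is completed by a fixed measurable orthonormal rule). $P^\perp_{R_j}$ is the orthogonal projection onto the complement of $\mathrm{span}\{r^0,\dots,r^j\}$ (identity if $j<0$) and $P^\perp_{Q_j}$ onto the complement of $\mathrm{span}\{q^{-1},\dots,q^j\}$. Then, in the order $u^\ell\to w^\ell\to r^\ell\to v^{\ell+1}\to z^{\ell+1}\to q^{\ell+1}$, $$u^\ell=\sum_{j=-1}^{\ell}P^\perp_{R_{j-1}}g^j\frac{q^{j\top}z^\ell}{\sqrt d}+\sum_{j=0}^{\ell-1}r^j\frac{(P^\perp_{Q_j}s^j)^\top z^\ell}{\sqrt d}-\hat b_\ell w^{\ell-1},$$ $$v^{\ell+1}=\sum_{j=-1}^{\ell}q^j\frac{(P^\perp_{R_{j-1}}g^j)^\top w^\ell}{\sqrt d}+\sum_{j=0}^{\ell}P^\perp_{Q_j}s^j\frac{r^{j\top}w^\ell}{\sqrt d}-\hat c_\ell z^\ell,$$ and $$X^{(t)}=\sum_{\ell=-1}^tP^\perp_{R_{\ell-1}}\frac{g^\ell q^{\ell\top}}{\sqrt d}+\sum_{\ell=0}^t\frac{r^\ell s^{\ell\top}}{\sqrt d}P^\perp_{Q_\ell}+P^\perp_{R_t}WP^\perp_{Q_t}.$$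
   Formalization: Independence of E_alg (jointly with v^0) from (X^(t), y) is stated only when E_link and E_alg are independent; it fails otherwise, e.g. E_alg = E_link with additive noise. Independence of v^0 alone is unconditional. *)

theory Defs
  imports "HOL-Probability.Probability"
begin

text \<open>
  Throughout, \<open>n = CARD('n)\<close> and \<open>d = CARD('d)\<close>.  Sequences that start at index \<open>-1\<close>
  (\<open>g\<close>, \<open>q\<close>, \<open>w\<close>) are indexed by \<open>int\<close>, those that start at \<open>0\<close> by \<open>nat\<close>.
\<close>

section \<open>Projections and orthonormal completion\<close>

text \<open>The matrix of the orthogonal projection onto the complement of \<open>span S\<close>.\<close>

definition perp_proj :: "(real^'k) set \<Rightarrow> real^'k^'k" where
  "perp_proj S = matrix (\<lambda>x. THE p. p \<in> orthogonal_comp (span S) \<and> x - p \<in> span S)"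

definition perp_R :: "(nat \<Rightarrow> real^'n) \<Rightarrow> int \<Rightarrow> real^'n^'n" where
  "perp_R r j = perp_proj (r ` {i. int i \<le> j})"

definition perp_Q :: "(int \<Rightarrow> real^'d) \<Rightarrow> int \<Rightarrow> real^'d^'d" where
  "perp_Q q j = perp_proj (q ` {-1..j})"

text \<open>
  A fixed measurable rule that prolongs an orthonormal family indexed by \<open>J\<close> by one more unit
  vector.  Nothing is required when the family already has as many members as the dimension.
\<close>

definition completion_rule :: "'i set \<Rightarrow> (('i \<Rightarrow> real^'k) \<Rightarrow> real^'k) \<Rightarrow> bool" where
  "completion_rule J \<kappa> \<longleftrightarrow>
     \<kappa> \<in> borel_measurable (Pi\<^sub>M J (\<lambda>_. borel)) \<and>
     (card J < CARD('k) \<longrightarrow>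
       (\<forall>b\<in>extensional J.
          (\<forall>i\<in>J. norm (b i) = 1) \<and> (\<forall>i\<in>J. \<forall>j\<in>J. i \<noteq> j \<longrightarrow> orthogonal (b i) (b j)) \<longrightarrow>
          norm (\<kappa> b) = 1 \<and> (\<forall>i\<in>J. orthogonal (b i) (\<kappa> b))))"

definition next_direction ::
  "(('i \<Rightarrow> real^'k) \<Rightarrow> real^'k) \<Rightarrow> 'i set \<Rightarrow> ('i \<Rightarrow> real^'k) \<Rightarrow> real^'k \<Rightarrow> real^'k" where
  "next_direction \<kappa> J b x =
     (let p = perp_proj (b ` J) *v x in if p = 0 then \<kappa> (restrict b J) else sgn p)"

section \<open>The model and the AMP recursion\<close>

definition entrywise :: "(real \<Rightarrow> real) \<Rightarrow> real^'k \<Rightarrow> real^'k" where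
  "entrywise f v = (\<chi> i. f (v $ i))"

definition entrywise2 :: "(real \<Rightarrow> 'e \<Rightarrow> real) \<Rightarrow> real^'k \<Rightarrow> ('k \<Rightarrow> 'e) \<Rightarrow> real^'k" where
  "entrywise2 h u y = (\<chi> i. h (u $ i) (y i))"

definition hat_b :: "(real \<Rightarrow> real) \<Rightarrow> real^'d \<Rightarrow> real" where
  "hat_b f v = (\<Sum>j\<in>UNIV. deriv f (v $ j)) / real CARD('d)"

text \<open>The sum runs over the \<open>n\<close> entries of \<open>u\<close>, but is normalised by \<open>d\<close>, the first argument.\<close>

definition hat_c :: "nat \<Rightarrow> (real \<Rightarrow> real \<Rightarrow> real) \<Rightarrow> real^'n \<Rightarrow> real^'n \<Rightarrow> real" where
  "hat_c d h u y = (\<Sum>i\<in>UNIV. deriv (\<lambda>x. h x (y $ i)) (u $ i)) / real d"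

text \<open>\<open>amp f h X y v\<^sub>0 t\<close> is the pair of the iterates \<open>u\<close> and \<open>v\<close> at time \<open>t\<close>.\<close>

primrec amp ::
  "(nat \<Rightarrow> real \<Rightarrow> real) \<Rightarrow> (nat \<Rightarrow> real \<Rightarrow> real \<Rightarrow> real) \<Rightarrow>
   real^'d^'n \<Rightarrow> real^'n \<Rightarrow> real^'d \<Rightarrow> nat \<Rightarrow> (real^'n) \<times> (real^'d)" where
  "amp f h X y v0 0 = (X *v entrywise (f 0) v0, v0)"
| "amp f h X y v0 (Suc t) =
     (let (u, v) = amp f h X y v0 t;
          w = entrywise2 (h t) u (($) y);
          v' = transpose X *v w - hat_c CARD('d) (h t) u y *\<^sub>R entrywise (f t) v;
          u' = X *v entrywise (f (Suc t)) v' - hat_b (f (Suc t)) v' *\<^sub>R w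
      in (u', v'))"

text \<open>Agreement with given iterates through \<open>v\<close> at time \<open>t + 1\<close>.\<close>

definition amp_agrees_through ::
  "(nat \<Rightarrow> real \<Rightarrow> real) \<Rightarrow> (nat \<Rightarrow> real \<Rightarrow> real \<Rightarrow> real) \<Rightarrow>
   real^'d^'n \<Rightarrow> real^'n \<Rightarrow> real^'d \<Rightarrow> (nat \<Rightarrow> real^'n) \<Rightarrow> (nat \<Rightarrow> real^'d) \<Rightarrow> nat \<Rightarrow> bool" where
  "amp_agrees_through f h X y v0 u v t \<longleftrightarrow>
     (\<forall>l\<le>t. fst (amp f h X y v0 l) = u l) \<and>
     (\<forall>l\<le>t + 1. snd (amp f h X y v0 l) = v l)"

definition iid_normal :: "'o measure \<Rightarrow> real \<Rightarrow> 'i set \<Rightarrow> ('i \<Rightarrow> 'o \<Rightarrow> real) \<Rightarrow> bool" where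
  "iid_normal M \<sigma> I Z \<longleftrightarrow>
     prob_space.indep_vars M (\<lambda>_. borel) Z I \<and>
     (\<forall>i\<in>I. distributed M lborel (Z i) (normal_density 0 \<sigma>))"

text \<open>
  Independence of two random variables of different types (\<open>indep_var\<close> of the library requires
  a common type; for equal types this is the same notion).
\<close>

definition indep_rv ::
  "'o measure \<Rightarrow> 'x measure \<Rightarrow> ('o \<Rightarrow> 'x) \<Rightarrow> 'y measure \<Rightarrow> ('o \<Rightarrow> 'y) \<Rightarrow> bool" where
  "indep_rv M S X T Y \<longleftrightarrow>
     X \<in> measurable M S \<and> Y \<in> measurable M T \<and>
     prob_space.indep_set M (sets (vimage_algebra (space M) X S))
       (sets (vimage_algebra (space M) Y T))"

definition gaussian_design :: "'o measure \<Rightarrow> ('o \<Rightarrow> real^'d^'n) \<Rightarrow> bool" where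
  "gaussian_design M X \<longleftrightarrow>
     iid_normal M (1 / sqrt (real CARD('d))) UNIV (\<lambda>(i, j) \<omega>. X \<omega> $ i $ j)"

text \<open>
  The link randomness has one component per entry of \<open>y\<close>, of arbitrary joint law, with values in
  an arbitrary measurable space \<open>L\<close>; thus \<open>y\<^sub>i\<close> is \<open>\<phi>\<close> at the \<open>i\<close>-th linear observation and
  the \<open>i\<close>-th component.
\<close>

abbreviation link_space :: "'l measure \<Rightarrow> ('n::finite \<Rightarrow> 'l) measure" where
  "link_space L \<equiv> Pi\<^sub>M UNIV (\<lambda>_. L)"

section \<open>The coupling\<close>

text \<open>
  The construction along one realisation: \<open>g\<close>, \<open>s\<close>, \<open>y\<close>, \<open>v0\<close> are the driving vectors,
  \<open>f\<close>, \<open>h\<close> the nonlinearities with their parameters already plugged in, \<open>\<kappa>R\<close>, \<open>\<kappa>Q\<close>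
  the completion rules.  The equations determine \<open>u, v, w, z, r, q\<close> recursively.
\<close>

definition coupled_iterates ::
  "real^'d \<Rightarrow> (nat \<Rightarrow> (nat \<Rightarrow> real^'n) \<Rightarrow> real^'n) \<Rightarrow> (nat \<Rightarrow> (int \<Rightarrow> real^'d) \<Rightarrow> real^'d) \<Rightarrow>
   (nat \<Rightarrow> real \<Rightarrow> real) \<Rightarrow> (nat \<Rightarrow> real \<Rightarrow> real \<Rightarrow> real) \<Rightarrow>
   (int \<Rightarrow> real^'n) \<Rightarrow> (nat \<Rightarrow> real^'d) \<Rightarrow> real^'n \<Rightarrow> real^'d \<Rightarrow>
   (nat \<Rightarrow> real^'n) \<Rightarrow> (nat \<Rightarrow> real^'d) \<Rightarrow> (int \<Rightarrow> real^'n) \<Rightarrow> (nat \<Rightarrow> real^'d) \<Rightarrow>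
   (nat \<Rightarrow> real^'n) \<Rightarrow> (int \<Rightarrow> real^'d) \<Rightarrow> bool" where
  "coupled_iterates \<theta> \<kappa>R \<kappa>Q f h g s y v0 u v w z r q \<longleftrightarrow>
     q (-1) = (1 / sqrt (real CARD('d))) *\<^sub>R \<theta> \<and>
     w (-1) = 0 \<and>
     v 0 = v0 \<and>
     (\<forall>l. z l = entrywise (f l) (v l)) \<and>
     (\<forall>l. q (int l) = next_direction (\<kappa>Q l) {-1..<int l} q (z l)) \<and>
     (\<forall>l. u l =
        (\<Sum>j = -1..int l. ((q j \<bullet> z l) / sqrt (real CARD('d))) *\<^sub>R (perp_R r (j - 1) *v g j))
      + (\<Sum>j<l. (((perp_Q q (int j) *v s j) \<bullet> z l) / sqrt (real CARD('d))) *\<^sub>R r j)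
      - hat_b (f l) (v l) *\<^sub>R w (int l - 1)) \<and>
     (\<forall>l. w (int l) = entrywise2 (h l) (u l) (($) y)) \<and>
     (\<forall>l. r l = next_direction (\<kappa>R l) {..<l} r (w (int l))) \<and>
     (\<forall>l. v (Suc l) =
        (\<Sum>j = -1..int l.
           (((perp_R r (j - 1) *v g j) \<bullet> w (int l)) / sqrt (real CARD('d))) *\<^sub>R q j)
      + (\<Sum>j\<le>l. ((r j \<bullet> w (int l)) / sqrt (real CARD('d))) *\<^sub>R (perp_Q q (int j) *v s j))
      - hat_c CARD('d) (h l) (u l) y *\<^sub>R z l)"

definition outer :: "real^'n \<Rightarrow> real^'d \<Rightarrow> real^'d^'n" where
  "outer a b = (\<chi> i j. a $ i * b $ j)"

definition coupled_matrix ::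
  "(int \<Rightarrow> real^'n) \<Rightarrow> (nat \<Rightarrow> real^'d) \<Rightarrow> real^'d^'n \<Rightarrow>
   (nat \<Rightarrow> real^'n) \<Rightarrow> (int \<Rightarrow> real^'d) \<Rightarrow> nat \<Rightarrow> real^'d^'n" where
  "coupled_matrix g s W r q t =
     (\<Sum>l = -1..int t. (1 / sqrt (real CARD('d))) *\<^sub>R (perp_R r (l - 1) ** outer (g l) (q l)))
   + (\<Sum>l\<le>t. (1 / sqrt (real CARD('d))) *\<^sub>R (outer (r l) (s l) ** perp_Q q (int l)))
   + perp_R r (int t) ** W ** perp_Q q (int t)"

section \<open>The sources of randomness and the information they generate\<close>

datatype source = Src_init | Src_g int | Src_s nat | Src_W | Src_seeds | Src_alg

text \<open>
  \<open>Src_seeds\<close> is the pair of the two external seeds, \<open>Src_alg\<close> the algorithmic one alone; the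
  two seeds may depend on each other.
\<close>

fun source_events ::
  "'o measure \<Rightarrow> 'l measure \<Rightarrow> 'a measure \<Rightarrow> ('o \<Rightarrow> real^'d) \<Rightarrow> (int \<Rightarrow> 'o \<Rightarrow> real^'n) \<Rightarrow>
   (nat \<Rightarrow> 'o \<Rightarrow> real^'d) \<Rightarrow> ('o \<Rightarrow> real^'d^'n) \<Rightarrow> ('o \<Rightarrow> 'n \<Rightarrow> 'l) \<Rightarrow> ('o \<Rightarrow> 'a) \<Rightarrow>
   source \<Rightarrow> 'o set set" where
  "source_events M L A v0 g s W el ea Src_init = sets (vimage_algebra (space M) v0 borel)"
| "source_events M L A v0 g s W el ea (Src_g j) = sets (vimage_algebra (space M) (g j) borel)"
| "source_events M L A v0 g s W el ea (Src_s j) = sets (vimage_algebra (space M) (s j) borel)"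
| "source_events M L A v0 g s W el ea Src_W = sets (vimage_algebra (space M) W borel)"
| "source_events M L A v0 g s W el ea Src_seeds =
     sets (vimage_algebra (space M) (\<lambda>\<omega>. (el \<omega>, ea \<omega>)) (link_space L \<Otimes>\<^sub>M A))"
| "source_events M L A v0 g s W el ea Src_alg = sets (vimage_algebra (space M) ea A)"

definition information :: "'o measure \<Rightarrow> (source \<Rightarrow> 'o set set) \<Rightarrow> source set \<Rightarrow> 'o measure" where
  "information M E I = sigma (space M) (\<Union>i\<in>I. E i)"

section \<open>Parametrised nonlinearities\<close>

text \<open>Vectors of \<open>\<real>\<^sup>p\<close> are functions on \<open>{..<p}\<close>, since \<open>p\<close> varies with the time index.\<close>

abbreviation param_space :: "nat \<Rightarrow> (nat \<Rightarrow> real) measure" where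
  "param_space p \<equiv> Pi\<^sub>M {..<p} (\<lambda>_. borel)"

text \<open>
  Existence of the first derivative is required for every parameter, because it enters the
  recursion; existence of the derivatives up to order three and their Lipschitz dependence on the
  parameter only for parameters of norm at most \<open>B\<close>.
\<close>

definition regular_in_param ::
  "nat \<Rightarrow> (nat \<Rightarrow> real) set \<Rightarrow> real \<Rightarrow> (real \<Rightarrow> real) \<Rightarrow> (real \<Rightarrow> (nat \<Rightarrow> real) \<Rightarrow> real) \<Rightarrow> bool" where
  "regular_in_param p \<Xi> B K F \<longleftrightarrow>
     (\<forall>\<xi>\<in>\<Xi>. \<forall>x. (\<lambda>x. F x \<xi>) differentiable (at x)) \<and>
     (\<forall>\<xi>\<in>\<Xi>. L2_set \<xi> {..<p} \<le> B \<longrightarrow>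
        (\<forall>j<3. \<forall>x. (deriv ^^ j) (\<lambda>x. F x \<xi>) differentiable (at x))) \<and>
     (\<forall>\<xi>\<in>\<Xi>. \<forall>\<xi>'\<in>\<Xi>. L2_set \<xi> {..<p} \<le> B \<longrightarrow> L2_set \<xi>' {..<p} \<le> B \<longrightarrow>
        (\<forall>j\<le>3. \<forall>x. \<bar>(deriv ^^ j) (\<lambda>x. F x \<xi>) x - (deriv ^^ j) (\<lambda>x. F x \<xi>') x\<bar>
                      \<le> K x * L2_set (\<lambda>i. \<xi> i - \<xi>' i) {..<p}))"

end

theory Submission
  imports Defs
begin

text \<open>
  Pathwise, the families \<open>q\<close> and \<open>r\<close> are orthonormal as long as the dimensions leave room for
  them, \<open>z\<^sup>l\<close> lies in the span of \<open>q\<^sup>-\<^sup>1, \<dots>, q\<^sup>l\<close> and \<open>w\<^sup>l\<close> in the span of \<open>r\<^sup>0, \<dots>, r\<^sup>l\<close>.  Hence all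
  later terms of the coupled matrix vanish on these vectors, and multiplying by it yields exactly
  the defining formulas of the iterates.

  For the law, start from \<open>W\<close> and reveal one direction at a time, in the order
  \<open>g\<^sup>-\<^sup>1, g\<^sup>0, s\<^sup>0, g\<^sup>1, s\<^sup>1, \<dots>\<close>.  Given the past, \<open>q\<^sup>l\<close> is a fixed unit vector, and replacing the
  component \<open>W q\<^sup>l\<close> of the Gaussian matrix \<open>W\<close> by the fresh vector \<open>g\<^sup>l / \<surd>d\<close> does not change its
  law; similarly for \<open>W\<^sup>T r\<^sup>l\<close> and \<open>s\<^sup>l / \<surd>d\<close>.  So the law of the matrix jointly with the
  initialisation and the seeds never changes, and it is a product law at the start.  The response
  is a function of the matrix and the link seed, because the coupled matrix maps \<open>\<theta>\<close> to \<open>g\<^sup>-\<^sup>1\<close>.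
\<close>

section \<open>Orthonormal families and projections\<close>

text \<open>Conditioning on the past is never expressed through conditional laws. The past is a
  sub-sigma-algebra that enters a joint law through the identity map, and replacing a component is
  Fubini with the outcome frozen. This works because \<open>W\<close> itself is never revealed: at
  every stage it still sits, independent of the past, between two projections that depend on the
  past alone. Two consecutive stages therefore differ by one overwriting of the action of this same
  \<open>W\<close> on one direction. That such an overwriting preserves the law comes from an
  orthogonal transformation of the pair (fresh vector, matrix), of which only the second component
  is kept. The order of the replacements is forced: \<open>q l\<close> is determined before
  \<open>g l\<close> is revealed, whereas \<open>r l\<close> depends on \<open>g l\<close> but not
  on \<open>s l\<close>. The two dimension bounds differ by one because the family \<open>q\<close>
  contains the additional vector \<open>q (-1)\<close>, the direction of the signal.\<close>

definition orthonormal_on :: "'i set \<Rightarrow> ('i \<Rightarrow> 'a::real_inner) \<Rightarrow> bool" where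
  "orthonormal_on J b \<longleftrightarrow> (\<forall>i\<in>J. \<forall>j\<in>J. b i \<bullet> b j = (if i = j then 1 else 0))"

lemma orthonormal_on_subset: "orthonormal_on J b \<Longrightarrow> I \<subseteq> J \<Longrightarrow> orthonormal_on I b"
  unfolding orthonormal_on_def by blast

lemma orthonormal_on_insert:
  assumes "orthonormal_on J b" "norm (b j) = 1" "\<And>i. i \<in> J \<Longrightarrow> b i \<bullet> b j = 0"
  shows "orthonormal_on (insert j J) b"
proof -
  have "b j \<bullet> b j = 1"
    using assms(2) by (simp add: norm_eq_1)
  then show ?thesis
    using assms(1,3) unfolding orthonormal_on_def
    by (metis inner_commute insert_iff zero_neq_one)
qed

lemma inner_orthonormal_sum:
  assumes J: "finite J" and b: "orthonormal_on J b" and i: "i \<in> J"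
  shows "b i \<bullet> (\<Sum>j\<in>J. a j *\<^sub>R b j) = a i"
proof -
  have "b i \<bullet> (\<Sum>j\<in>J. a j *\<^sub>R b j) = (\<Sum>j\<in>J. a j * (b i \<bullet> b j))"
    by (simp add: inner_sum_right)
  also have "\<dots> = (\<Sum>j\<in>J. if j = i then a j else 0)"
    using b i unfolding orthonormal_on_def by (intro sum.cong) auto
  finally show ?thesis
    using J i by simp
qed

section \<open>Algebra of rank-one matrices\<close>

lemma outer_mult_vec: "outer a b *v x = (b \<bullet> x) *\<^sub>R a"
  by (simp add: outer_def vec_eq_iff matrix_vector_mult_def inner_vec_def sum_distrib_left
      mult.assoc mult.commute mult.left_commute)

lemma transpose_outer: "transpose (outer a b) = outer b a"
  by (simp add: outer_def transpose_def vec_eq_iff mult.commute)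

lemma mult_outer: "P ** outer a b = outer (P *v a) b"
  by (simp add: outer_def vec_eq_iff matrix_matrix_mult_def matrix_vector_mult_def
      sum_distrib_right mult.assoc)

lemma outer_mult: "outer a b ** Q = outer a (transpose Q *v b)"
  by (simp add: outer_def vec_eq_iff matrix_matrix_mult_def matrix_vector_mult_def transpose_def
      sum_distrib_left algebra_simps)

lemma inner_symmetric_matrix:
  fixes P :: "real^'k^'k"
  assumes "transpose P = P"
  shows "(P *v a) \<bullet> b = a \<bullet> (P *v b)"
  using dot_lmul_matrix[of a P b] vector_transpose_matrix[of a P] assms by simp

lemma linear_transpose: "linear (transpose :: real^'m^'n \<Rightarrow> real^'n^'m)"
  by (auto intro!: linearI simp: transpose_def vec_eq_iff)

lemma linear_matrix_vector: "linear (\<lambda>A :: real^'m^'n. A *v x)"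
  by (auto intro!: linearI simp: matrix_vector_mult_add_rdistrib scaleR_matrix_vector_assoc)

lemma matrix_diff_ldistrib: "P ** (X - Y) = P ** X - P ** (Y :: real^'m^'k)"
  and matrix_diff_rdistrib: "(P - Q) ** X = P ** X - Q ** (X :: real^'m^'k)"
  and matrix_add_rdistrib: "(P + Q) ** X = P ** X + Q ** (X :: real^'m^'k)"
  by (simp_all add: matrix_matrix_mult_def vec_eq_iff sum_subtractf sum.distrib algebra_simps)

lemma outer_inner: "outer a b \<bullet> X = a \<bullet> (X *v b)"
  by (simp add: inner_vec_def outer_def matrix_vector_mult_def sum_distrib_left mult_ac)

lemma linear_outer1: "linear (\<lambda>a. outer a b)"
  and linear_outer2: "linear (\<lambda>b. outer a b)"
  by (auto intro!: linearI simp: outer_def vec_eq_iff algebra_simps)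

lemma linear_transpose_mult: "linear (\<lambda>X :: real^'m^'k. transpose X *v r)"
  using linear_compose[OF linear_transpose linear_matrix_vector] by (simp add: comp_def)

text \<open>The Fourier residual satisfies the definite description behind \<open>perp_proj\<close>,
  and two vectors satisfying it differ by a vector that is orthogonal to itself. Linearity of the
  residual is checked as well because \<open>matrix\<close> reproduces linear maps only.\<close>

lemma perp_proj_apply:
  assumes J: "finite J" and b: "orthonormal_on J b"
  shows "perp_proj (b ` J) *v x = x - (\<Sum>j\<in>J. (b j \<bullet> x) *\<^sub>R b j)"
proof -
  let ?P = "\<lambda>x. x - (\<Sum>j\<in>J. (b j \<bullet> x) *\<^sub>R b j)"
  have "(THE p. p \<in> orthogonal_comp (span (b ` J)) \<and> x - p \<in> span (b ` J)) = ?P x" for x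
  proof (rule the_equality)
    have "orthogonal y (?P x)" if "y \<in> span (b ` J)" for y
      using that
    proof (induction rule: span_induct)
      case base
      show ?case
        unfolding subspace_def by (auto simp: orthogonal_clauses)
    next
      case (step y)
      then show ?case
        using inner_orthonormal_sum[OF J b] by (auto simp: orthogonal_def inner_diff_right)
    qed
    then show P: "?P x \<in> orthogonal_comp (span (b ` J)) \<and> x - ?P x \<in> span (b ` J)"
      by (simp add: orthogonal_comp_def span_sum span_scale span_base)
    fix p assume p: "p \<in> orthogonal_comp (span (b ` J)) \<and> x - p \<in> span (b ` J)"
    have "?P x - p \<in> span (b ` J)"
      using span_diff[of "x - p" "b ` J" "x - ?P x"] p P by (simp add: algebra_simps)
    moreover have "?P x - p \<in> orthogonal_comp (span (b ` J))"
      using p P subspace_diff[OF subspace_orthogonal_comp] by blast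
    ultimately have "orthogonal (?P x - p) (?P x - p)"
      unfolding orthogonal_comp_def by blast
    then show "p = ?P x"
      by (simp add: orthogonal_self)
  qed
  moreover have "linear ?P"
    by (intro linearI)
      (auto simp: inner_add_right scaleR_add_left sum.distrib algebra_simps scaleR_sum_right)
  ultimately show ?thesis
    unfolding perp_proj_def by (simp add: matrix_works linear_matrix_vector_mul_eq)
qed

text \<open>This form is polynomial in the basis vectors, which later makes the projections
  measurable functions of them.\<close>

lemma perp_proj_eq:
  assumes "finite J" "orthonormal_on J b"
  shows "perp_proj (b ` J) = mat 1 - (\<Sum>j\<in>J. outer (b j) (b j))"
  unfolding matrix_eq
  by (simp add: perp_proj_apply[OF assms] matrix_vector_mult_diff_rdistrib
      linear_sum[OF linear_matrix_vector] outer_mult_vec)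

lemma transpose_perp_proj:
  assumes "finite J" "orthonormal_on J b"
  shows "transpose (perp_proj (b ` J)) = perp_proj (b ` J)"
  by (simp add: perp_proj_eq[OF assms] linear_diff[OF linear_transpose]
      linear_sum[OF linear_transpose] transpose_outer)

text \<open>Both branches give the same three facts. The bound on \<open>card J\<close> is what
  makes the completion rule promise a unit vector orthogonal to the family. The expansion survives a
  vanishing residual: then \<open>x\<close> is already in the span and the completed vector enters
  with coefficient 0.\<close>

lemma next_direction:
  fixes b :: "'i \<Rightarrow> real^'k" and x :: "real^'k"
  assumes J: "finite J" "card J < CARD('k)" and b: "orthonormal_on J b"
    and \<kappa>: "completion_rule J \<kappa>"
  defines "e \<equiv> next_direction \<kappa> J b x"
  shows next_direction_norm: "norm e = 1"
    and next_direction_orthogonal: "\<And>i. i \<in> J \<Longrightarrow> b i \<bullet> e = 0"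
    and next_direction_expand: "x = (\<Sum>j\<in>J. (b j \<bullet> x) *\<^sub>R b j) + (e \<bullet> x) *\<^sub>R e"
proof -
  let ?p = "x - (\<Sum>j\<in>J. (b j \<bullet> x) *\<^sub>R b j)"
  have e: "e = (if ?p = 0 then \<kappa> (restrict b J) else sgn ?p)"
    by (simp add: e_def next_direction_def perp_proj_apply[OF J(1) b])
  have bp: "b i \<bullet> ?p = 0" if "i \<in> J" for i
    using inner_orthonormal_sum[OF J(1) b that] by (simp add: inner_diff_right)
  have \<kappa>: "norm (\<kappa> (restrict b J)) = 1 \<and> (\<forall>i\<in>J. orthogonal (restrict b J i) (\<kappa> (restrict b J)))"
  proof -
    have "norm (restrict b J i) = 1" if "i \<in> J" for i
      using b that by (simp add: orthonormal_on_def norm_eq_1)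
    moreover have "orthogonal (restrict b J i) (restrict b J j)" if "i \<in> J" "j \<in> J" "i \<noteq> j" for i j
      using b that by (simp add: orthonormal_on_def orthogonal_def)
    ultimately show ?thesis
      using \<kappa> J(2) unfolding completion_rule_def by blast
  qed
  show "norm e = 1"
    using \<kappa> by (simp add: e norm_sgn)
  show be: "b i \<bullet> e = 0" if "i \<in> J" for i
    using that \<kappa> bp by (auto simp: e orthogonal_def sgn_div_norm)
  show "x = (\<Sum>j\<in>J. (b j \<bullet> x) *\<^sub>R b j) + (e \<bullet> x) *\<^sub>R e"
  proof -
    have "e \<bullet> x = e \<bullet> ?p"
      using be by (simp add: inner_diff_right inner_sum_right inner_commute[of e])
    moreover have "(sgn p \<bullet> p) *\<^sub>R sgn p = p" for p :: "real^'k"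
      by (cases "p = 0") (simp_all add: sgn_div_norm dot_square_norm power2_eq_square field_simps)
    then have "(e \<bullet> ?p) *\<^sub>R e = ?p"
      by (simp add: e)
    ultimately show ?thesis
      by simp
  qed
qed

section \<open>The coupling along one realisation\<close>

text \<open>The recursion runs over all indices, but once a family fills its space the completion
  rule promises nothing. The horizon \<open>T\<close> marks how far orthonormality can be relied
  upon.\<close>

locale coupled_path =
  fixes \<theta> :: "real^'d" and \<kappa>R :: "nat \<Rightarrow> (nat \<Rightarrow> real^'n) \<Rightarrow> real^'n"
    and \<kappa>Q :: "nat \<Rightarrow> (int \<Rightarrow> real^'d) \<Rightarrow> real^'d"
    and f :: "nat \<Rightarrow> real \<Rightarrow> real" and h :: "nat \<Rightarrow> real \<Rightarrow> real \<Rightarrow> real"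
    and g :: "int \<Rightarrow> real^'n" and s :: "nat \<Rightarrow> real^'d"
    and y :: "real^'n" and v0 :: "real^'d"
    and u :: "nat \<Rightarrow> real^'n" and v :: "nat \<Rightarrow> real^'d" and w :: "int \<Rightarrow> real^'n"
    and z :: "nat \<Rightarrow> real^'d" and r :: "nat \<Rightarrow> real^'n" and q :: "int \<Rightarrow> real^'d"
    and T :: nat
  assumes coupled: "coupled_iterates \<theta> \<kappa>R \<kappa>Q f h g s y v0 u v w z r q"
    and norm_theta: "norm \<theta> = sqrt (real CARD('d))"
    and ruleR: "\<And>l. completion_rule {..<l} (\<kappa>R l)"
    and ruleQ: "\<And>l. completion_rule {-1..<int l} (\<kappa>Q l)"
    and T_d: "T + 2 \<le> CARD('d)" and T_n: "T + 1 \<le> CARD('n)"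
begin

lemma q_init: "q (-1) = (1 / sqrt (real CARD('d))) *\<^sub>R \<theta>"
  and v_init: "v 0 = v0"
  and w_init: "w (-1) = 0"
  and z_eq: "z l = entrywise (f l) (v l)"
  and q_eq: "q (int l) = next_direction (\<kappa>Q l) {-1..<int l} q (z l)"
  and w_eq: "w (int l) = entrywise2 (h l) (u l) (($) y)"
  and r_eq: "r l = next_direction (\<kappa>R l) {..<l} r (w (int l))"
  and u_eq: "u l =
        (\<Sum>j = -1..int l. ((q j \<bullet> z l) / sqrt (real CARD('d))) *\<^sub>R (perp_R r (j - 1) *v g j))
      + (\<Sum>j<l. (((perp_Q q (int j) *v s j) \<bullet> z l) / sqrt (real CARD('d))) *\<^sub>R r j)
      - hat_b (f l) (v l) *\<^sub>R w (int l - 1)"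
  and v_Suc: "v (Suc l) =
        (\<Sum>j = -1..int l.
           (((perp_R r (j - 1) *v g j) \<bullet> w (int l)) / sqrt (real CARD('d))) *\<^sub>R q j)
      + (\<Sum>j\<le>l. ((r j \<bullet> w (int l)) / sqrt (real CARD('d))) *\<^sub>R (perp_Q q (int j) *v s j))
      - hat_c CARD('d) (h l) (u l) y *\<^sub>R z l"
  using coupled unfolding coupled_iterates_def by metis+

lemma orthonormal_r_less: "l \<le> T + 1 \<Longrightarrow> orthonormal_on {..<l} r"
proof (induction l)
  case 0
  show ?case by (simp add: orthonormal_on_def)
next
  case (Suc l)
  then have "orthonormal_on {..<l} r" "card {..<l} < CARD('n)"
    using T_n by auto
  note e = next_direction[OF _ this(2,1) ruleR, where x = "w (int l)", folded r_eq]
  show ?case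
    unfolding lessThan_Suc using Suc e by (intro orthonormal_on_insert) auto
qed

lemma orthonormal_r: "orthonormal_on {..T} r"
  using orthonormal_r_less[of "T + 1"] by (simp add: lessThan_Suc_atMost)

lemma atLeastLessThan_int_Suc: "{-1..<int (Suc l)} = insert (int l) {-1..<int l}"
  by auto

text \<open>The base case is where the normalisation of \<open>\<theta>\<close> enters: it makes
  \<open>q (-1)\<close> a unit vector. The step from \<open>l\<close> extends a family of
  \<open>l + 1\<close> vectors, one more than for \<open>r\<close>, hence the bound
  \<open>T + 2\<close> on the dimension.\<close>

lemma orthonormal_q_less: "l \<le> T + 1 \<Longrightarrow> orthonormal_on {-1..<int l} q"
proof (induction l)
  case 0
  have "{-1..<int 0} = {-1}" by auto
  then show ?case
    using norm_theta by (simp add: orthonormal_on_def q_init power2_norm_eq_inner[symmetric] field_simps)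
next
  case (Suc l)
  then have "orthonormal_on {-1..<int l} q" "card {-1..<int l} < CARD('d)"
    using T_d by auto
  note e = next_direction[OF _ this(2,1) ruleQ, where x = "z l", folded q_eq]
  show ?case
    unfolding atLeastLessThan_int_Suc using Suc e by (intro orthonormal_on_insert) auto
qed

lemma orthonormal_q: "orthonormal_on {-1..int T} q"
proof -
  have "{-1..<int (T + 1)} = {-1..int T}" by auto
  then show ?thesis
    using orthonormal_q_less[of "T + 1"] by simp
qed

lemma w_expand:
  assumes "l \<le> T"
  shows "w (int l) = (\<Sum>j\<le>l. (r j \<bullet> w (int l)) *\<^sub>R r j)"
proof -
  have "card {..<l} < CARD('n)"
    using T_n assms by simp
  from next_direction_expand[OF _ this orthonormal_r_less ruleR, where x = "w (int l)", folded r_eq]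
  show ?thesis
    using assms by (simp flip: lessThan_Suc_atMost)
qed

lemma z_expand:
  assumes "l \<le> T"
  shows "z l = (\<Sum>j = -1..int l. (q j \<bullet> z l) *\<^sub>R q j)"
proof -
  have "card {-1..<int l} < CARD('d)"
    using T_d assms by simp
  from next_direction_expand[OF _ this orthonormal_q_less ruleQ, where x = "z l", folded q_eq]
  have "z l = (\<Sum>j = -1..<int l. (q j \<bullet> z l) *\<^sub>R q j) + (q (int l) \<bullet> z l) *\<^sub>R q (int l)"
    using assms by simp
  also have "\<dots> = (\<Sum>j\<in>insert (int l) {-1..<int l}. (q j \<bullet> z l) *\<^sub>R q j)"
    by (simp add: add.commute)
  also have "insert (int l) {-1..<int l} = {-1..int l}"
    by auto
  finally show ?thesis .
qed

lemma perp_R_eq: "j \<le> int T \<Longrightarrow> perp_R r j = mat 1 - (\<Sum>i | int i \<le> j. outer (r i) (r i))"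
  and transpose_perp_R: "j \<le> int T \<Longrightarrow> transpose (perp_R r j) = perp_R r j"
  and perp_R_apply: "j \<le> int T \<Longrightarrow> perp_R r j *v x = x - (\<Sum>i | int i \<le> j. (r i \<bullet> x) *\<^sub>R r i)"
proof -
  assume "j \<le> int T"
  then have "finite {i. int i \<le> j}" "orthonormal_on {i. int i \<le> j} r"
    by (auto intro: orthonormal_on_subset[OF orthonormal_r] finite_subset[of _ "{..T}"])
  note * = perp_proj_eq[OF this] transpose_perp_proj[OF this] perp_proj_apply[OF this]
  show "perp_R r j = mat 1 - (\<Sum>i | int i \<le> j. outer (r i) (r i))"
    "transpose (perp_R r j) = perp_R r j"
    "perp_R r j *v x = x - (\<Sum>i | int i \<le> j. (r i \<bullet> x) *\<^sub>R r i)"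
    unfolding perp_R_def by (fact *)+
qed

lemma perp_Q_eq: "j \<le> int T \<Longrightarrow> perp_Q q j = mat 1 - (\<Sum>i = -1..j. outer (q i) (q i))"
  and transpose_perp_Q: "j \<le> int T \<Longrightarrow> transpose (perp_Q q j) = perp_Q q j"
  and perp_Q_apply: "j \<le> int T \<Longrightarrow> perp_Q q j *v x = x - (\<Sum>i = -1..j. (q i \<bullet> x) *\<^sub>R q i)"
proof -
  assume "j \<le> int T"
  then have "finite {-1..j}" "orthonormal_on {-1..j} q"
    by (auto intro: orthonormal_on_subset[OF orthonormal_q])
  note * = perp_proj_eq[OF this] transpose_perp_proj[OF this] perp_proj_apply[OF this]
  show "perp_Q q j = mat 1 - (\<Sum>i = -1..j. outer (q i) (q i))"
    "transpose (perp_Q q j) = perp_Q q j"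
    "perp_Q q j *v x = x - (\<Sum>i = -1..j. (q i \<bullet> x) *\<^sub>R q i)"
    unfolding perp_Q_def by (fact *)+
qed

text \<open>Triangularity of the Gram-Schmidt process: a direction produced after time
  \<open>l\<close> is orthogonal to \<open>w l\<close>. This and its analogue for \<open>z\<close>
  remove from a matrix with a large horizon everything that was not yet there at time
  \<open>l\<close>, so one matrix serves all earlier times.\<close>

lemma r_inner_w: "l \<le> T \<Longrightarrow> j \<le> T \<Longrightarrow> l < j \<Longrightarrow> r j \<bullet> w (int l) = 0"
  using orthonormal_r
  by (subst w_expand) (auto simp: inner_sum_right orthonormal_on_def intro!: sum.neutral)

lemma q_inner_z: "l \<le> T \<Longrightarrow> j \<le> int T \<Longrightarrow> int l < j \<Longrightarrow> q j \<bullet> z l = 0"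
  using orthonormal_q
  by (subst z_expand) (auto simp: inner_sum_right orthonormal_on_def intro!: sum.neutral)

lemma perp_R_w:
  assumes "l \<le> T" "j \<le> int T" "int l \<le> j"
  shows "perp_R r j *v w (int l) = 0"
proof -
  have "(\<Sum>i | int i \<le> j. (r i \<bullet> w (int l)) *\<^sub>R r i) = (\<Sum>i\<le>l. (r i \<bullet> w (int l)) *\<^sub>R r i)"
    using assms by (intro sum.mono_neutral_right) (auto intro: finite_subset[of _ "{..T}"] r_inner_w)
  then show ?thesis
    using perp_R_apply[OF assms(2)] w_expand[OF assms(1)] by simp
qed

lemma perp_Q_z:
  assumes "l \<le> T" "j \<le> int T" "int l \<le> j"
  shows "perp_Q q j *v z l = 0"
proof -
  have "(\<Sum>i = -1..j. (q i \<bullet> z l) *\<^sub>R q i) = (\<Sum>i = -1..int l. (q i \<bullet> z l) *\<^sub>R q i)"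
    using assms by (intro sum.mono_neutral_right) (auto intro: q_inner_z)
  then show ?thesis
    using perp_Q_apply[OF assms(2)] z_expand[OF assms(1)] by simp
qed

lemma coupled_matrix_eq:
  "coupled_matrix g s W r q T =
     (\<Sum>l = -1..int T. (1 / sqrt (real CARD('d))) *\<^sub>R outer (perp_R r (l - 1) *v g l) (q l))
   + (\<Sum>l\<le>T. (1 / sqrt (real CARD('d))) *\<^sub>R outer (r l) (perp_Q q (int l) *v s l))
   + perp_R r (int T) ** W ** perp_Q q (int T)"
  by (simp add: coupled_matrix_def mult_outer outer_mult transpose_perp_Q)

lemma coupled_matrix_mult:
  "coupled_matrix g s W r q T *v x =
     (\<Sum>l = -1..int T. ((q l \<bullet> x) / sqrt (real CARD('d))) *\<^sub>R (perp_R r (l - 1) *v g l))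
   + (\<Sum>l\<le>T. (((perp_Q q (int l) *v s l) \<bullet> x) / sqrt (real CARD('d))) *\<^sub>R r l)
   + perp_R r (int T) *v (W *v (perp_Q q (int T) *v x))"
  unfolding coupled_matrix_eq
  by (simp add: linear_sum[OF linear_matrix_vector] linear_scale[OF linear_matrix_vector]
      matrix_vector_mult_add_rdistrib outer_mult_vec matrix_vector_mul_assoc[symmetric])

lemma transpose_coupled_matrix_mult:
  "transpose (coupled_matrix g s W r q T) *v x =
     (\<Sum>l = -1..int T. (((perp_R r (l - 1) *v g l) \<bullet> x) / sqrt (real CARD('d))) *\<^sub>R q l)
   + (\<Sum>l\<le>T. ((r l \<bullet> x) / sqrt (real CARD('d))) *\<^sub>R (perp_Q q (int l) *v s l))
   + perp_Q q (int T) *v (transpose W *v (perp_R r (int T) *v x))"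
  unfolding coupled_matrix_eq
  by (simp add: linear_sum[OF linear_transpose] linear_scale[OF linear_transpose]
      linear_add[OF linear_transpose] matrix_transpose_mul transpose_outer transpose_perp_R
      transpose_perp_Q linear_sum[OF linear_matrix_vector] linear_scale[OF linear_matrix_vector]
      matrix_vector_mult_add_rdistrib outer_mult_vec matrix_vector_mul_assoc[symmetric])

text \<open>Directions \<open>q j\<close> with \<open>j > l\<close> are orthogonal to
  \<open>z l\<close>, while for \<open>s j\<close> the projection, moved to the other side by
  symmetry, already annihilates \<open>z l\<close> when \<open>j = l\<close>. So the
  \<open>g\<close> terms stop at \<open>l\<close> and the \<open>s\<close> terms at
  \<open>l - 1\<close>, as in the formula for \<open>u l\<close> without its correction
  term.\<close>

lemma coupled_matrix_z:
  assumes "l \<le> T"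
  shows "coupled_matrix g s W r q T *v z l = u l + hat_b (f l) (v l) *\<^sub>R w (int l - 1)"
proof -
  let ?a = "\<lambda>j. ((q j \<bullet> z l) / sqrt (real CARD('d))) *\<^sub>R (perp_R r (j - 1) *v g j)"
  let ?b = "\<lambda>j. (((perp_Q q (int j) *v s j) \<bullet> z l) / sqrt (real CARD('d))) *\<^sub>R r j"
  have "(perp_Q q (int j) *v s j) \<bullet> z l = 0" if "l \<le> j" "j \<le> T" for j
    using that assms perp_Q_z[of l "int j"]
    by (simp add: inner_symmetric_matrix transpose_perp_Q)
  then have "sum ?b {..T} = sum ?b {..<l}"
    using assms by (intro sum.mono_neutral_right) auto
  moreover have "sum ?a {-1..int T} = sum ?a {-1..int l}"
    using assms by (intro sum.mono_neutral_right) (auto simp: q_inner_z)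
  ultimately show ?thesis
    using assms by (simp add: coupled_matrix_mult u_eq perp_Q_z)
qed

text \<open>Here the roles are reversed: the projection in front of \<open>g j\<close> has index
  \<open>j - 1\<close>, so it annihilates \<open>w l\<close> only from \<open>j = l + 1\<close> on,
  and the \<open>s\<close> terms survive up to \<open>j = l\<close>.\<close>

lemma transpose_coupled_matrix_w:
  assumes "l \<le> T"
  shows "transpose (coupled_matrix g s W r q T) *v w (int l) =
    v (Suc l) + hat_c CARD('d) (h l) (u l) y *\<^sub>R z l"
proof -
  let ?a = "\<lambda>j. (((perp_R r (j - 1) *v g j) \<bullet> w (int l)) / sqrt (real CARD('d))) *\<^sub>R q j"
  let ?b = "\<lambda>j. ((r j \<bullet> w (int l)) / sqrt (real CARD('d))) *\<^sub>R (perp_Q q (int j) *v s j)"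
  have "(perp_R r (j - 1) *v g j) \<bullet> w (int l) = 0" if "int l < j" "j \<le> int T" for j
    using that assms perp_R_w[of l "j - 1"]
    by (simp add: inner_symmetric_matrix transpose_perp_R)
  then have "sum ?a {-1..int T} = sum ?a {-1..int l}"
    using assms by (intro sum.mono_neutral_right) auto
  moreover have "sum ?b {..T} = sum ?b {..l}"
    using assms by (intro sum.mono_neutral_right) (auto simp: r_inner_w)
  ultimately show ?thesis
    using assms by (simp add: transpose_coupled_matrix_mult v_Suc perp_R_w del: transpose_matrix_vector)
qed

text \<open>The vector \<open>\<theta>\<close> is a multiple of \<open>q (-1)\<close>, which every
  projection of type \<open>perp_Q\<close> annihilates and to which every other \<open>q j\<close>
  is orthogonal. One term is left, and the factor \<open>sqrt d\<close> of \<open>\<theta>\<close>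
  cancels its normalisation.\<close>

lemma coupled_matrix_theta: "coupled_matrix g s W r q T *v \<theta> = g (-1)"
proof -
  let ?c = "sqrt (real CARD('d))"
  have \<theta>: "\<theta> = ?c *\<^sub>R q (-1)"
    by (simp add: q_init)
  have qq: "q j \<bullet> q (-1) = (if j = -1 then 1 else 0)" if "j \<in> {-1..int T}" for j
    using orthonormal_q that by (auto simp: orthonormal_on_def)
  have q\<theta>: "(q j \<bullet> \<theta>) / ?c = (if j = -1 then 1 else 0)" if "j \<in> {-1..int T}" for j
    unfolding arg_cong[OF \<theta>, of "\<lambda>x. q j \<bullet> x"] using qq[OF that] by simp
  have Q: "perp_Q q j *v q (-1) = 0" if "-1 \<le> j" "j \<le> int T" for j
  proof -
    have "(\<Sum>i = -1..j. (q i \<bullet> q (-1)) *\<^sub>R q i) = (\<Sum>i\<in>{-1}. q i)"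
      using that by (intro sum.mono_neutral_cong_right) (auto simp: qq)
    then show ?thesis
      using that by (simp add: perp_Q_apply)
  qed
  have "(perp_Q q (int l) *v s l) \<bullet> q (-1) = 0" if "l \<le> T" for l
    using that Q[of "int l"]
    by (simp add: inner_symmetric_matrix transpose_perp_Q)
  then have "(\<Sum>l\<le>T. (((perp_Q q (int l) *v s l) \<bullet> \<theta>) / ?c) *\<^sub>R r l) = 0"
    by (intro sum.neutral ballI) (subst \<theta>, simp)
  moreover have "(\<Sum>l = -1..int T. ((q l \<bullet> \<theta>) / ?c) *\<^sub>R (perp_R r (l - 1) *v g l)) =
      (\<Sum>l\<in>{-1}. perp_R r (l - 1) *v g l)"
    by (intro sum.mono_neutral_cong_right) (auto simp: q\<theta>)
  \<comment> \<open>At index -2 no direction \<open>r i\<close> is projected out, so the projection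
    is the identity.\<close>
  moreover have "perp_R r (-2) *v g (-1) = g (-1)"
    by (simp add: perp_R_apply)
  moreover have "perp_Q q (int T) *v \<theta> = 0"
    by (subst \<theta>) (simp add: Q matrix_vector_mult_scaleR)
  ultimately show ?thesis
    unfolding coupled_matrix_mult by simp
qed

lemma amp_eq: "l \<le> T \<Longrightarrow> amp f h (coupled_matrix g s W r q T) y v0 l = (u l, v l)"
proof (induction l)
  case 0
  have "entrywise (f 0) v0 = z 0"
    by (simp add: z_eq v_init)
  then show ?case
    using coupled_matrix_z[of 0] by (simp add: v_init w_init)
next
  case (Suc l)
  have "w (int l) = entrywise2 (h l) (u l) (($) y)"
    "entrywise (f l) (v l) = z l" "entrywise (f (Suc l)) (v (Suc l)) = z (Suc l)"
    by (simp_all add: z_eq w_eq)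
  then show ?case
    using Suc coupled_matrix_z[of "Suc l" W] transpose_coupled_matrix_w[of l W]
    by (simp add: Let_def del: transpose_matrix_vector)
qed

text \<open>One more \<open>v\<close> than \<open>u\<close> is reached: \<open>v (t + 1)\<close>
  uses only \<open>w t\<close> and \<open>z t\<close>. At \<open>t = T\<close> the vector
  \<open>z (T + 1)\<close> may leave the span of the available directions \<open>q\<close>, so
  nothing is claimed about \<open>u (T + 1)\<close>.\<close>

lemma amp_agrees:
  assumes "t \<le> T"
  shows "amp_agrees_through f h (coupled_matrix g s W r q T) y v0 u v t"
proof -
  have "w (int t) = entrywise2 (h t) (u t) (($) y)" "entrywise (f t) (v t) = z t"
    by (simp_all add: z_eq w_eq)
  then have "snd (amp f h (coupled_matrix g s W r q T) y v0 (Suc t)) = v (Suc t)"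
    using assms transpose_coupled_matrix_w[of t W]
    by (simp add: amp_eq Let_def del: transpose_matrix_vector)
  then show ?thesis
    using assms by (auto simp: amp_agrees_through_def amp_eq le_Suc_eq)
qed

end

section \<open>Isotropic Gaussian vectors\<close>

text \<open>An arbitrary Euclidean space is allowed so that vectors and matrices are treated alike:
  a matrix with independent entries is an isotropic vector in the space of matrices.\<close>

definition gauss :: "real \<Rightarrow> 'a::euclidean_space measure" where
  "gauss \<sigma> = density lborel (\<lambda>x. ennreal (\<Prod>b\<in>Basis. normal_density 0 \<sigma> (x \<bullet> b)))"

lemma sets_gauss [simp, measurable_cong]: "sets (gauss \<sigma>) = sets borel"
  by (simp add: gauss_def)

lemma space_gauss [simp]: "space (gauss \<sigma>) = UNIV"
  by (simp add: gauss_def)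

text \<open>Exhibits the density as a function of the norm alone, which is the rotation invariance
  used for the exchange below.\<close>

lemma prod_normal_density:
  fixes x :: "'a::euclidean_space"
  shows "(\<Prod>b\<in>Basis. normal_density 0 \<sigma> (x \<bullet> b)) =
    (1 / sqrt (2 * pi * \<sigma>\<^sup>2)) ^ DIM('a) * exp (- (norm x)\<^sup>2 / (2 * \<sigma>\<^sup>2))"
proof -
  have "(norm x)\<^sup>2 = (\<Sum>b\<in>Basis. (x \<bullet> b)\<^sup>2)"
    unfolding power2_norm_eq_inner by (subst euclidean_inner) (simp add: power2_eq_square)
  then show ?thesis
    unfolding normal_density_def
    by (simp add: prod_dividef exp_sum[symmetric] sum_divide_distrib sum_negf power_divide)
qed

lemma inner_sum_basis:
  fixes e :: "'i \<Rightarrow> 'a::euclidean_space"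
  assumes I: "finite I" and e: "bij_betw e I Basis" and i: "i \<in> I"
  shows "(\<Sum>j\<in>I. x j *\<^sub>R e j) \<bullet> e i = x i"
proof -
  have "(\<Sum>j\<in>I. x j *\<^sub>R e j) \<bullet> e i = (\<Sum>j\<in>I. x j * (e j \<bullet> e i))"
    by (simp add: inner_sum_left)
  also have "\<dots> = (\<Sum>j\<in>I. if j = i then x j else 0)"
  proof (intro sum.cong refl)
    fix j assume "j \<in> I"
    then have "e j \<in> Basis" "e i \<in> Basis" "e j = e i \<longleftrightarrow> j = i"
      using e i by (auto simp: bij_betw_def inj_on_eq_iff)
    then show "x j * (e j \<bullet> e i) = (if j = i then x j else 0)"
      by (simp add: inner_Basis)
  qed
  finally show ?thesis
    using I i by simp
qed

text \<open>Lebesgue measure is determined by its values on boxes, and the preimage of a box is a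
  product of intervals. The basis is indexed by an arbitrary finite set so that pairs of a row and a
  column can serve as indices.\<close>

lemma distr_PiM_lborel:
  fixes e :: "'i \<Rightarrow> 'a::euclidean_space"
  assumes I: "finite I" and e: "bij_betw e I Basis"
  shows "distr (Pi\<^sub>M I (\<lambda>_. lborel :: real measure)) borel (\<lambda>x. \<Sum>i\<in>I. x i *\<^sub>R e i) = lborel"
    (is "distr ?P borel ?S = _")
proof (rule lborel_eqI[symmetric])
  interpret P: product_sigma_finite "\<lambda>_::'i. lborel :: real measure" ..
  fix l u :: 'a
  assume lu: "\<And>b. b \<in> Basis \<Longrightarrow> l \<bullet> b \<le> u \<bullet> b"
  have inner: "?S x \<bullet> e i = x i" if "i \<in> I" for x i
    using I e that by (rule inner_sum_basis)
  have "x \<in> ?S -` box l u \<longleftrightarrow> (\<forall>i\<in>I. x i \<in> {l \<bullet> e i <..< u \<bullet> e i})" for x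
  proof -
    have "x \<in> ?S -` box l u \<longleftrightarrow> (\<forall>b\<in>e ` I. l \<bullet> b < ?S x \<bullet> b \<and> ?S x \<bullet> b < u \<bullet> b)"
      using e by (auto simp: box_def bij_betw_def)
    then show ?thesis
      using inner by simp
  qed
  then have "?S -` box l u \<inter> space ?P = Pi\<^sub>E I (\<lambda>i. {l \<bullet> e i <..< u \<bullet> e i})"
    by (auto simp: space_PiM PiE_iff)
  moreover have "?S \<in> measurable ?P borel"
    by measurable
  ultimately have "emeasure (distr ?P borel ?S) (box l u) =
      (\<Prod>i\<in>I. emeasure lborel {l \<bullet> e i <..< u \<bullet> e i})"
    using I by (simp add: emeasure_distr P.emeasure_PiM)
  also have "\<dots> = (\<Prod>i\<in>I. ennreal ((u - l) \<bullet> e i))"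
    using lu bij_betwE[OF e] by (intro prod.cong) (auto simp: inner_diff_left)
  also have "\<dots> = (\<Prod>b\<in>Basis. ennreal ((u - l) \<bullet> b))"
    using prod.reindex_bij_betw[OF e, of "\<lambda>b. ennreal ((u - l) \<bullet> b)"] .
  finally show "emeasure (distr ?P borel ?S) (box l u) = (\<Prod>b\<in>Basis. (u - l) \<bullet> b)"
    using lu by (simp add: prod_ennreal inner_diff_left)
qed simp

lemma PiM_density:
  assumes I: "finite I" and M: "sigma_finite_measure M" and f [measurable]: "f \<in> borel_measurable M"
    and D: "prob_space (density M f)"
  shows "Pi\<^sub>M I (\<lambda>_. density M f) = density (Pi\<^sub>M I (\<lambda>_. M)) (\<lambda>x. \<Prod>i\<in>I. f (x i))"
proof -
  interpret P: product_sigma_finite "\<lambda>_. M"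
    using M by (simp add: product_sigma_finite_def)
  interpret D: product_sigma_finite "\<lambda>_. density M f"
    using D by (simp add: product_sigma_finite_def prob_space_imp_sigma_finite)
  show ?thesis
  proof (rule D.PiM_eqI[OF I, symmetric])
    show "sets (density (Pi\<^sub>M I (\<lambda>_. M)) (\<lambda>x. \<Prod>i\<in>I. f (x i))) = sets (Pi\<^sub>M I (\<lambda>i. density M f))"
      by (simp cong: sets_PiM_cong)
  fix A assume "\<And>i. i \<in> I \<Longrightarrow> A i \<in> sets (density M f)"
  then have A [measurable]: "\<And>i. i \<in> I \<Longrightarrow> A i \<in> sets M"
    by simp
  have "emeasure (density (Pi\<^sub>M I (\<lambda>_. M)) (\<lambda>x. \<Prod>i\<in>I. f (x i))) (Pi\<^sub>E I A) =
    (\<integral>\<^sup>+x. (\<Prod>i\<in>I. f (x i)) * indicator (Pi\<^sub>E I A) x \<partial>Pi\<^sub>M I (\<lambda>_. M))"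
    using I by (intro emeasure_density) (auto intro!: sets_PiM_I_finite)
  also have "\<dots> = (\<integral>\<^sup>+x. (\<Prod>i\<in>I. f (x i) * indicator (A i) (x i)) \<partial>Pi\<^sub>M I (\<lambda>_. M))"
  proof (intro nn_integral_cong)
    fix x assume "x \<in> space (Pi\<^sub>M I (\<lambda>_. M))"
    then have "indicator (Pi\<^sub>E I A) x = (\<Prod>i\<in>I. indicator (A i) (x i) :: ennreal)"
      using I by (auto simp: indicator_def PiE_iff space_PiM split: if_splits)
    then show "(\<Prod>i\<in>I. f (x i)) * indicator (Pi\<^sub>E I A) x = (\<Prod>i\<in>I. f (x i) * indicator (A i) (x i))"
      by (simp add: prod.distrib)
  qed
  also have "\<dots> = (\<Prod>i\<in>I. \<integral>\<^sup>+x. f x * indicator (A i) x \<partial>M)"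
    using I by (intro P.product_nn_integral_prod) auto
  also have "\<dots> = (\<Prod>i\<in>I. emeasure (density M f) (A i))"
    by (intro prod.cong refl) (simp add: emeasure_density)
  finally show "emeasure (density (Pi\<^sub>M I (\<lambda>_. M)) (\<lambda>x. \<Prod>i\<in>I. f (x i))) (Pi\<^sub>E I A) =
    (\<Prod>i\<in>I. emeasure (density M f) (A i))" .
  qed
qed

lemma gauss_eq_distr_PiM:
  fixes e :: "'i \<Rightarrow> 'a::euclidean_space"
  assumes I: "finite I" and e: "bij_betw e I Basis" and \<sigma>: "\<sigma> > 0"
  shows "distr (Pi\<^sub>M I (\<lambda>_. density lborel (normal_density 0 \<sigma>))) borel (\<lambda>x. \<Sum>i\<in>I. x i *\<^sub>R e i)
    = gauss \<sigma>"
proof -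
  let ?S = "\<lambda>x. \<Sum>i\<in>I. x i *\<^sub>R e i" and ?\<rho> = "\<lambda>x::'a. ennreal (\<Prod>b\<in>Basis. normal_density 0 \<sigma> (x \<bullet> b))"
  have \<rho>: "?\<rho> (?S x) = (\<Prod>i\<in>I. ennreal (normal_density 0 \<sigma> (x i)))" for x
  proof -
    have "?S x \<bullet> e i = x i" if "i \<in> I" for i
      using I e that by (rule inner_sum_basis)
    then show ?thesis
      using prod.reindex_bij_betw[OF e, of "\<lambda>b. normal_density 0 \<sigma> (?S x \<bullet> b)"]
      by (simp add: prod_ennreal)
  qed
  have "Pi\<^sub>M I (\<lambda>_. density lborel (normal_density 0 \<sigma>)) =
      density (Pi\<^sub>M I (\<lambda>_. lborel)) (\<lambda>x. ?\<rho> (?S x))"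
    unfolding \<rho> using I prob_space_normal_density[OF \<sigma>]
    by (intro PiM_density) (auto intro: lborel.sigma_finite_measure_axioms)
  also have "distr \<dots> borel ?S = density (distr (Pi\<^sub>M I (\<lambda>_. lborel)) borel ?S) ?\<rho>"
    by (intro density_distr[symmetric]) measurable
  also have "\<dots> = gauss \<sigma>"
    unfolding distr_PiM_lborel[OF I e] gauss_def ..
  finally show ?thesis .
qed

lemma prob_space_gauss: "\<sigma> > 0 \<Longrightarrow> prob_space (gauss \<sigma>)"
  unfolding gauss_eq_distr_PiM[OF finite_Basis bij_betw_id, symmetric]
  by (intro prob_space.prob_space_distr prob_space_PiM prob_space_normal_density) auto

text \<open>Bridge from hypotheses about independent coordinates to one law on the whole space:
  independence makes the joint law of the coordinates a product, and summing along the basis carries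
  this product to \<open>gauss \<sigma>\<close>.\<close>

lemma distr_eq_gauss:
  fixes e :: "'i \<Rightarrow> 'a::euclidean_space"
  assumes "prob_space M" and I: "finite I" and e: "bij_betw e I Basis" and \<sigma>: "\<sigma> > 0"
    and Z: "iid_normal M \<sigma> I Z"
    and X: "\<And>i \<omega>. i \<in> I \<Longrightarrow> \<omega> \<in> space M \<Longrightarrow> X \<omega> \<bullet> e i = Z i \<omega>"
  shows "X \<in> borel_measurable M" and "distr M borel X = gauss \<sigma>"
proof -
  interpret prob_space M by fact
  let ?S = "\<lambda>x. \<Sum>i\<in>I. x i *\<^sub>R e i"
  have Z_meas [measurable]: "Z i \<in> borel_measurable M" if "i \<in> I" for i
    using Z that by (auto simp: iid_normal_def distributed_def)
  have Z_law: "distr M borel (Z i) = density lborel (normal_density 0 \<sigma>)" if "i \<in> I" for i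
  proof -
    have "distr M lborel (Z i) = density lborel (normal_density 0 \<sigma>)"
      using Z that by (auto simp: iid_normal_def distributed_def)
    then show ?thesis
      by (simp cong: distr_cong)
  qed
  have I_ne: "I \<noteq> {}"
    using e nonempty_Basis by (metis bij_betw_def image_empty)
  have XS: "X \<omega> = ?S (\<lambda>i\<in>I. Z i \<omega>)" if "\<omega> \<in> space M" for \<omega>
  proof -
    have "X \<omega> = (\<Sum>b\<in>Basis. (X \<omega> \<bullet> b) *\<^sub>R b)"
      by (simp add: euclidean_representation)
    also have "\<dots> = (\<Sum>i\<in>I. (X \<omega> \<bullet> e i) *\<^sub>R e i)"
      using sum.reindex_bij_betw[OF e, of "\<lambda>b. (X \<omega> \<bullet> b) *\<^sub>R b"] by simp
    finally show ?thesis
      using X that by simp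
  qed
  have "?S \<in> borel_measurable (Pi\<^sub>M I (\<lambda>_. borel :: real measure))"
    by measurable
  note this [measurable]
  have "(\<lambda>\<omega>. ?S (\<lambda>i\<in>I. Z i \<omega>)) \<in> borel_measurable M"
    by measurable
  then show "X \<in> borel_measurable M"
    using measurable_cong[of M X "\<lambda>\<omega>. ?S (\<lambda>i\<in>I. Z i \<omega>)"] XS by simp
  have "distr M borel X = distr M borel (\<lambda>\<omega>. ?S (\<lambda>i\<in>I. Z i \<omega>))"
    using XS by (intro distr_cong) auto
  also have "\<dots> = distr (distr M (Pi\<^sub>M I (\<lambda>_. borel)) (\<lambda>\<omega>. \<lambda>i\<in>I. Z i \<omega>)) borel ?S"
    by (subst distr_distr) (auto simp: comp_def)
  also have "distr M (Pi\<^sub>M I (\<lambda>_. borel)) (\<lambda>\<omega>. \<lambda>i\<in>I. Z i \<omega>) = Pi\<^sub>M I (\<lambda>i. distr M borel (Z i))"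
    using Z indep_vars_iff_distr_eq_PiM'[OF I_ne, of Z "\<lambda>_. borel"] by (auto simp: iid_normal_def)
  also have "\<dots> = Pi\<^sub>M I (\<lambda>_. density lborel (normal_density 0 \<sigma>))"
    using Z_law by (intro PiM_cong) auto
  also have "distr \<dots> borel ?S = gauss \<sigma>"
    by (rule gauss_eq_distr_PiM[OF I e \<sigma>])
  finally show "distr M borel X = gauss \<sigma>" .
qed

section \<open>Exchanging a Gaussian vector with a component of another\<close>

lemma nn_integral_lborel_translate:
  fixes g :: "'a::euclidean_space \<Rightarrow> ennreal"
  assumes [measurable]: "g \<in> borel_measurable borel"
  shows "(\<integral>\<^sup>+x. g (x + c) \<partial>lborel) = (\<integral>\<^sup>+x. g x \<partial>lborel)"
proof -
  have "(\<integral>\<^sup>+x. g x \<partial>lborel) = (\<integral>\<^sup>+x. g x \<partial>distr lborel borel ((+) c))"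
    by (simp add: lborel_distr_plus)
  also have "\<dots> = (\<integral>\<^sup>+x. g (x + c) \<partial>lborel)"
    by (subst nn_integral_distr) (auto simp: add.commute)
  finally show ?thesis by simp
qed

text \<open>
  The map \<open>(y, x) \<mapsto> (- B x, x + A (y - B x))\<close> is, up to a sign, the reflection that exchanges
  \<open>y\<close> with the component of \<open>x\<close> in the range of \<open>A\<close>.  It is a composition of three shears,
  so Fubini and translation invariance show that it preserves Lebesgue measure.
\<close>

lemma nn_integral_lborel_exchange:
  fixes A :: "'a::euclidean_space \<Rightarrow> 'b::euclidean_space" and B :: "'b \<Rightarrow> 'a"
    and G :: "'a \<times> 'b \<Rightarrow> ennreal"
  assumes A: "linear A" and B: "linear B" and BA: "\<And>y. B (A y) = y"
    and G [measurable]: "G \<in> borel_measurable (borel \<Otimes>\<^sub>M borel)"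
  shows "(\<integral>\<^sup>+y. \<integral>\<^sup>+x. G (- B x, x + A (y - B x)) \<partial>lborel \<partial>lborel) =
    (\<integral>\<^sup>+y. \<integral>\<^sup>+x. G (y, x) \<partial>lborel \<partial>lborel)"
proof -
  have [measurable]: "A \<in> borel_measurable borel" "B \<in> borel_measurable borel"
    using A B by (auto intro!: borel_measurable_continuous_onI linear_continuous_on
        simp: linear_linear)
  have swap: "(\<integral>\<^sup>+y. \<integral>\<^sup>+x. H y x \<partial>lborel \<partial>lborel) = (\<integral>\<^sup>+x. \<integral>\<^sup>+y. H y x \<partial>lborel \<partial>lborel)"
    if [measurable]: "case_prod H \<in> borel_measurable (borel \<Otimes>\<^sub>M borel)" for H :: "'a \<Rightarrow> 'b \<Rightarrow> ennreal"
    using lborel_pair.Fubini[of "\<lambda>(x, y). H y x"] by simp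
  have "(\<integral>\<^sup>+y. \<integral>\<^sup>+x. G (y, x) \<partial>lborel \<partial>lborel) = (\<integral>\<^sup>+y. \<integral>\<^sup>+x. G (y, x + A y) \<partial>lborel \<partial>lborel)"
    by (intro nn_integral_cong nn_integral_lborel_translate[symmetric]) measurable
  also have "\<dots> = (\<integral>\<^sup>+x. \<integral>\<^sup>+y. G (y, x + A y) \<partial>lborel \<partial>lborel)"
    by (rule swap) measurable
  also have "\<dots> = (\<integral>\<^sup>+x. \<integral>\<^sup>+y. G (y + - B x, x + A (y + - B x)) \<partial>lborel \<partial>lborel)"
    by (intro nn_integral_cong nn_integral_lborel_translate[symmetric]) measurable
  also have "\<dots> = (\<integral>\<^sup>+y. \<integral>\<^sup>+x. G (y + - B x, x + A (y + - B x)) \<partial>lborel \<partial>lborel)"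
    by (rule swap[symmetric]) measurable
  also have "\<dots> = (\<integral>\<^sup>+y. \<integral>\<^sup>+x. G (y + - B (x + A y), (x + A y) + A (y + - B (x + A y))) \<partial>lborel \<partial>lborel)"
    by (intro nn_integral_cong nn_integral_lborel_translate[symmetric]) measurable
  \<comment> \<open>Since \<open>B (A y) = y\<close>, the first argument
    \<open>y - B (x + A y)\<close> collapses to \<open>- B x\<close>, and the second becomes
    \<open>x + A (y - B x)\<close>.\<close>
  also have "\<dots> = (\<integral>\<^sup>+y. \<integral>\<^sup>+x. G (- B x, x + A (y - B x)) \<partial>lborel \<partial>lborel)"
    using A B by (simp add: linear_add linear_diff linear_neg BA add_diff_eq)
  finally show ?thesis by simp
qed

text \<open>Here \<open>A\<close> is an isometric embedding and \<open>B\<close> its adjoint, so the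
  exchange preserves the squared norm of the pair, hence the product density, as well as Lebesgue
  measure. The claim is the second marginal of the invariant product law. For
  \<open>A a = outer a q\<close> with a unit vector \<open>q\<close>, the new matrix is
  \<open>x\<close> with its value at \<open>q\<close> overwritten by \<open>y\<close>.\<close>

lemma distr_gauss_exchange:
  fixes A :: "'a::euclidean_space \<Rightarrow> 'b::euclidean_space" and B :: "'b \<Rightarrow> 'a"
  assumes \<sigma>: "\<sigma> > 0" and A: "linear A" and B: "linear B" and BA: "\<And>y. B (A y) = y"
    and adj: "\<And>y x. A y \<bullet> x = y \<bullet> B x"
  shows "distr (gauss \<sigma> \<Otimes>\<^sub>M gauss \<sigma>) borel (\<lambda>(y, x). x + A (y - B x)) = gauss \<sigma>"
proof (rule measure_eqI)
  interpret g1: prob_space "gauss \<sigma> :: 'a measure" by (rule prob_space_gauss[OF \<sigma>])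
  interpret g2: prob_space "gauss \<sigma> :: 'b measure" by (rule prob_space_gauss[OF \<sigma>])
  let ?r1 = "\<lambda>x::'a. ennreal (\<Prod>b\<in>Basis. normal_density 0 \<sigma> (x \<bullet> b))"
  let ?r2 = "\<lambda>x::'b. ennreal (\<Prod>b\<in>Basis. normal_density 0 \<sigma> (x \<bullet> b))"
  have [measurable]: "A \<in> borel_measurable borel" "B \<in> borel_measurable borel"
    using A B by (auto intro!: borel_measurable_continuous_onI linear_continuous_on
        simp: linear_linear)
  fix S assume "S \<in> sets (distr (gauss \<sigma> \<Otimes>\<^sub>M gauss \<sigma>) borel (\<lambda>(y::'a, x::'b). x + A (y - B x)))"
  then have S [measurable]: "S \<in> sets borel" by simp
  \<comment> \<open>The cross terms leave \<open>|x|^2 + |y|^2 - |B x|^2\<close> for the second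
    component; the first one restores the missing part.\<close>
  have norm: "(norm (- B x))\<^sup>2 + (norm (x + A (y - B x)))\<^sup>2 = (norm y)\<^sup>2 + (norm x)\<^sup>2" for x y
  proof -
    have "x \<bullet> A z = B x \<bullet> z" "A z \<bullet> A z = z \<bullet> z" for z
      using adj[of z x] adj[of z "A z"] by (simp_all add: BA inner_commute)
    then show ?thesis
      by (simp add: power2_norm_eq_inner inner_add_left inner_add_right adj BA)
        (simp add: inner_diff_left inner_diff_right inner_commute)
  qed
  have dens: "?r1 (- B x) * ?r2 (x + A (y - B x)) = ?r1 y * ?r2 x" for x y
  proof -
    have "exp (- (norm (- B x))\<^sup>2 / (2 * \<sigma>\<^sup>2)) * exp (- (norm (x + A (y - B x)))\<^sup>2 / (2 * \<sigma>\<^sup>2)) =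
      exp (- (norm y)\<^sup>2 / (2 * \<sigma>\<^sup>2)) * exp (- (norm x)\<^sup>2 / (2 * \<sigma>\<^sup>2))"
      unfolding exp_add[symmetric] add_divide_distrib[symmetric] using norm[of x y]
      by (simp add: algebra_simps)
    then show ?thesis
      unfolding prod_normal_density by (simp add: ennreal_mult[symmetric] algebra_simps)
  qed
  have "emeasure (distr (gauss \<sigma> \<Otimes>\<^sub>M gauss \<sigma>) borel (\<lambda>(y, x). x + A (y - B x))) S =
      (\<integral>\<^sup>+p. indicator S p \<partial>distr (gauss \<sigma> \<Otimes>\<^sub>M gauss \<sigma>) borel (\<lambda>(y, x). x + A (y - B x)))"
    by simp
  also have "\<dots> = (\<integral>\<^sup>+p. indicator S (snd p + A (fst p - B (snd p))) \<partial>(gauss \<sigma> \<Otimes>\<^sub>M gauss \<sigma>))"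
    by (subst nn_integral_distr) (auto simp: case_prod_beta)
  also have "\<dots> = (\<integral>\<^sup>+y. \<integral>\<^sup>+x. indicator S (x + A (y - B x)) \<partial>gauss \<sigma> \<partial>gauss \<sigma>)"
    by (subst g2.nn_integral_fst[symmetric]) auto
  also have "\<dots> = (\<integral>\<^sup>+y. ?r1 y * (\<integral>\<^sup>+x. ?r2 x * indicator S (x + A (y - B x)) \<partial>lborel) \<partial>lborel)"
    unfolding gauss_def by (subst nn_integral_density; (subst nn_integral_density)?) auto
  also have "\<dots> = (\<integral>\<^sup>+y. \<integral>\<^sup>+x. ?r1 y * ?r2 x * indicator S (x + A (y - B x)) \<partial>lborel \<partial>lborel)"
    by (simp add: nn_integral_cmult mult.assoc)
  \<comment> \<open>The integrand is now a function of the exchanged pair alone, so that the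
    invariance of Lebesgue measure applies.\<close>
  also have "\<dots> = (\<integral>\<^sup>+y. \<integral>\<^sup>+x. ?r1 (- B x) * ?r2 (x + A (y - B x)) * indicator S (x + A (y - B x))
      \<partial>lborel \<partial>lborel)"
    by (simp only: dens)
  also have "\<dots> = (\<integral>\<^sup>+y. \<integral>\<^sup>+x. ?r1 y * ?r2 x * indicator S x \<partial>lborel \<partial>lborel)"
    using nn_integral_lborel_exchange[OF A B BA, of "\<lambda>(y, x). ?r1 y * ?r2 x * indicator S x"]
    by simp
  also have "\<dots> = (\<integral>\<^sup>+y. ?r1 y * (\<integral>\<^sup>+x. ?r2 x * indicator S x \<partial>lborel) \<partial>lborel)"
    by (simp add: nn_integral_cmult mult.assoc)
  also have "\<dots> = (\<integral>\<^sup>+y. (\<integral>\<^sup>+x. indicator S x \<partial>gauss \<sigma>) \<partial>(gauss \<sigma> :: 'a measure))"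
    unfolding gauss_def by (subst nn_integral_density; (subst nn_integral_density)?) auto
  also have "\<dots> = emeasure (gauss \<sigma>) S"
    by (simp add: g1.emeasure_space_1[simplified])
  finally show "emeasure (distr (gauss \<sigma> \<Otimes>\<^sub>M gauss \<sigma>) borel (\<lambda>(y, x). x + A (y - B x))) S =
    emeasure (gauss \<sigma>) S" .
qed simp

lemma iid_normal_scale:
  assumes M: "prob_space M" and Z: "iid_normal M \<sigma> I Z" and a: "a > 0" and \<sigma>: "\<sigma> > 0"
  shows "iid_normal M (a * \<sigma>) I (\<lambda>i \<omega>. a * Z i \<omega>)"
proof -
  interpret prob_space M by fact
  have "indep_vars (\<lambda>_. borel) (\<lambda>i \<omega>. a * Z i \<omega>) I"
    by (rule indep_vars_compose2[where X = Z and M' = "\<lambda>_. borel"]) (use Z in \<open>auto simp: iid_normal_def\<close>)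
  moreover have "distributed M lborel (\<lambda>\<omega>. a * Z i \<omega>) (normal_density 0 (a * \<sigma>))" if "i \<in> I" for i
    using normal_density_affine[of "Z i" 0 \<sigma> a 0] Z that a \<sigma> by (simp add: iid_normal_def)
  ultimately show ?thesis
    by (simp add: iid_normal_def)
qed

lemma bij_betw_axis: "bij_betw (\<lambda>i. axis i 1) UNIV (Basis :: (real^'k) set)"
  by (auto simp: bij_betw_def inj_on_def axis_eq_axis Basis_vec_def)

lemma bij_betw_axis_axis:
  "bij_betw (\<lambda>(i, j). axis i (axis j 1)) UNIV (Basis :: (real^'m^'k) set)"
proof -
  have "inj (\<lambda>(i, j). axis i (axis j 1) :: real^'m^'k)"
    by (auto simp: inj_on_def axis_eq_axis)
  moreover have "range (\<lambda>(i, j). axis i (axis j 1)) = (Basis :: (real^'m^'k) set)"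
    by (auto simp: Basis_vec_def image_def)
  ultimately show ?thesis
    by (rule bij_betw_imageI)
qed

lemma vec_distr_eq_gauss:
  fixes X :: "'o \<Rightarrow> real^'k"
  assumes "prob_space M" "iid_normal M \<sigma> UNIV (\<lambda>i \<omega>. X \<omega> $ i)" "\<sigma> > 0"
  shows "X \<in> borel_measurable M" and "distr M borel X = gauss \<sigma>"
  using distr_eq_gauss[OF assms(1) _ bij_betw_axis assms(3,2), of X]
  by (simp_all add: inner_axis)

lemma gaussian_design_distr:
  fixes X :: "'o \<Rightarrow> real^'d^'n"
  assumes "prob_space M" "gaussian_design M X"
  shows "X \<in> borel_measurable M" and "distr M borel X = gauss (1 / sqrt (real CARD('d)))"
proof -
  have "X \<omega> \<bullet> (case p of (i, j) \<Rightarrow> axis i (axis j 1)) = (case p of (i, j) \<Rightarrow> \<lambda>\<omega>. X \<omega> $ i $ j) \<omega>" for p \<omega>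
    by (cases p) (simp add: inner_axis)
  note * = distr_eq_gauss[OF assms(1) finite bij_betw_axis_axis _ assms(2)[unfolded gaussian_design_def] this]
  show "X \<in> borel_measurable M" and "distr M borel X = gauss (1 / sqrt (real CARD('d)))"
    by (rule *; simp)+
qed

section \<open>Independence and resampling\<close>

lemma indep_rv_iff:
  assumes M: "prob_space M" and X: "X \<in> measurable M S" and Y: "Y \<in> measurable M T"
  shows "indep_rv M S X T Y \<longleftrightarrow> (\<forall>A\<in>sets S. \<forall>B\<in>sets T.
    measure M ((X -` A \<inter> space M) \<inter> (Y -` B \<inter> space M)) =
    measure M (X -` A \<inter> space M) * measure M (Y -` B \<inter> space M))"
proof -
  interpret prob_space M by fact
  have [simp]: "X \<in> space M \<rightarrow> space S" "Y \<in> space M \<rightarrow> space T"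
    using X Y by (auto dest: measurable_space)
  have "{X -` A \<inter> space M |A. A \<in> sets S} \<subseteq> sets M" "{Y -` B \<inter> space M |B. B \<in> sets T} \<subseteq> sets M"
    using X Y by (auto intro: measurable_sets)
  then show ?thesis
    using X Y by (simp add: indep_rv_def indep_sets2_eq sets_vimage_algebra2) blast
qed

text \<open>Independence in the form in which Fubini can use it; rectangles suffice to identify the
  product measure.\<close>

lemma indep_rv_iff_distr:
  assumes M: "prob_space M" and X: "X \<in> measurable M S" and Y: "Y \<in> measurable M T"
  shows "indep_rv M S X T Y \<longleftrightarrow>
    distr M (S \<Otimes>\<^sub>M T) (\<lambda>\<omega>. (X \<omega>, Y \<omega>)) = distr M S X \<Otimes>\<^sub>M distr M T Y"
proof -
  interpret prob_space M by fact
  interpret DX: prob_space "distr M S X" using X by (rule prob_space_distr)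
  interpret DY: prob_space "distr M T Y" using Y by (rule prob_space_distr)
  note [measurable] = X Y
  let ?D = "distr M (S \<Otimes>\<^sub>M T) (\<lambda>\<omega>. (X \<omega>, Y \<omega>))"
  have D: "emeasure ?D (A \<times> B) = measure M ((X -` A \<inter> space M) \<inter> (Y -` B \<inter> space M))"
    if [measurable]: "A \<in> sets S" "B \<in> sets T" for A B
  proof -
    have "(\<lambda>\<omega>. (X \<omega>, Y \<omega>)) -` (A \<times> B) \<inter> space M = (X -` A \<inter> space M) \<inter> (Y -` B \<inter> space M)"
      by auto
    then show ?thesis
      by (simp add: emeasure_distr emeasure_eq_measure)
  qed
  have P: "emeasure (distr M S X) A * emeasure (distr M T Y) B =
      ennreal (measure M (X -` A \<inter> space M) * measure M (Y -` B \<inter> space M))"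
    if [measurable]: "A \<in> sets S" "B \<in> sets T" for A B
    by (simp add: emeasure_distr emeasure_eq_measure ennreal_mult)
  show ?thesis
  proof
    assume "indep_rv M S X T Y"
    then have "distr M S X \<Otimes>\<^sub>M distr M T Y = ?D"
      using D P indep_rv_iff[OF M X Y]
      by (intro pair_measure_eqI DX.sigma_finite_measure_axioms DY.sigma_finite_measure_axioms)
        (auto cong: sets_pair_measure_cong)
    then show "?D = distr M S X \<Otimes>\<^sub>M distr M T Y" ..
  next
    assume eq: "?D = distr M S X \<Otimes>\<^sub>M distr M T Y"
    show "indep_rv M S X T Y"
      unfolding indep_rv_iff[OF M X Y]
    proof (intro ballI)
      fix A B assume AB: "A \<in> sets S" "B \<in> sets T"
      then have "emeasure ?D (A \<times> B) = emeasure (distr M S X) A * emeasure (distr M T Y) B"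
        unfolding eq by (intro DY.emeasure_pair_measure_Times) auto
      then show "measure M ((X -` A \<inter> space M) \<inter> (Y -` B \<inter> space M)) =
        measure M (X -` A \<inter> space M) * measure M (Y -` B \<inter> space M)"
        unfolding D[OF AB] P[OF AB] by (subst (asm) ennreal_inj) auto
    qed
  qed
qed

lemma indep_rv_measurable:
  assumes "indep_rv M S X T Y"
  shows "X \<in> measurable M S" "Y \<in> measurable M T"
  using assms by (auto simp: indep_rv_def)

lemma indep_rv_distr:
  assumes "prob_space M" "indep_rv M S X T Y"
  shows "distr M (S \<Otimes>\<^sub>M T) (\<lambda>\<omega>. (X \<omega>, Y \<omega>)) = distr M S X \<Otimes>\<^sub>M distr M T Y"
  using assms indep_rv_iff_distr[OF assms(1) indep_rv_measurable[OF assms(2)]] by simp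

lemma indep_rv_compose:
  assumes M: "prob_space M" and XY: "indep_rv M S X T Y"
    and a: "a \<in> measurable S S'" and b: "b \<in> measurable T T'"
  shows "indep_rv M S' (\<lambda>\<omega>. a (X \<omega>)) T' (\<lambda>\<omega>. b (Y \<omega>))"
proof -
  note XY_meas [measurable] = indep_rv_measurable[OF XY]
  note [measurable] = a b
  have "measure M ((\<lambda>\<omega>. a (X \<omega>)) -` A \<inter> space M \<inter> ((\<lambda>\<omega>. b (Y \<omega>)) -` B \<inter> space M)) =
    measure M ((\<lambda>\<omega>. a (X \<omega>)) -` A \<inter> space M) * measure M ((\<lambda>\<omega>. b (Y \<omega>)) -` B \<inter> space M)"
    if "A \<in> sets S'" "B \<in> sets T'" for A B
  proof -
    have "(\<lambda>\<omega>. a (X \<omega>)) -` A \<inter> space M = X -` (a -` A \<inter> space S) \<inter> space M"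
      "(\<lambda>\<omega>. b (Y \<omega>)) -` B \<inter> space M = Y -` (b -` B \<inter> space T) \<inter> space M"
      using measurable_space[OF XY_meas(1)] measurable_space[OF XY_meas(2)] by auto
    moreover have "a -` A \<inter> space S \<in> sets S" "b -` B \<inter> space T \<in> sets T"
      using that a b by (auto intro: measurable_sets)
    ultimately show ?thesis
      using XY indep_rv_iff[OF M XY_meas] by (simp del: vimage_Int)
  qed
  then show ?thesis
    by (subst indep_rv_iff[OF M]) auto
qed

lemma indep_rv_sym:
  assumes M: "prob_space M" and "indep_rv M S X T Y"
  shows "indep_rv M T Y S X"
proof -
  note XY = indep_rv_measurable[OF assms(2)]
  show ?thesis
    using assms(2) unfolding indep_rv_iff[OF M XY] indep_rv_iff[OF M XY(2) XY(1)]
    by (metis Int_commute mult.commute)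
qed

text \<open>The two hypotheses make the law of the triple a product of three marginals, whose
  factors may be permuted by Fubini. It turns independence of the matrix from the remaining inputs
  into independence of one input from the matrix and the others.\<close>

lemma indep_rv_exchange:
  assumes M: "prob_space M"
    and XYZ: "indep_rv M S X (T \<Otimes>\<^sub>M U) (\<lambda>\<omega>. (Y \<omega>, Z \<omega>))" and YZ: "indep_rv M T Y U Z"
  shows "indep_rv M T Y (S \<Otimes>\<^sub>M U) (\<lambda>\<omega>. (X \<omega>, Z \<omega>))"
proof -
  interpret prob_space M by fact
  note meas [measurable] = indep_rv_measurable[OF YZ] indep_rv_measurable(1)[OF XYZ]
  interpret X: prob_space "distr M S X" by (rule prob_space_distr) measurable
  interpret Y: prob_space "distr M T Y" by (rule prob_space_distr) measurable
  interpret Z: prob_space "distr M U Z" by (rule prob_space_distr) measurable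
  interpret YX: pair_sigma_finite "distr M T Y" "distr M S X" ..
  interpret YZ: pair_sigma_finite "distr M T Y" "distr M U Z" ..
  interpret XZ: pair_sigma_finite "distr M S X" "distr M U Z" ..
  have XZ: "indep_rv M S X U Z"
    using indep_rv_compose[OF M XYZ measurable_ident measurable_snd] by simp
  have law_XZ: "distr M (S \<Otimes>\<^sub>M U) (\<lambda>\<omega>. (X \<omega>, Z \<omega>)) = distr M S X \<Otimes>\<^sub>M distr M U Z"
    using XZ by (subst (asm) indep_rv_iff_distr[OF M]) auto
  have law_YZ: "distr M (T \<Otimes>\<^sub>M U) (\<lambda>\<omega>. (Y \<omega>, Z \<omega>)) = distr M T Y \<Otimes>\<^sub>M distr M U Z"
    using YZ by (subst (asm) indep_rv_iff_distr[OF M]) auto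
  have law: "distr M (S \<Otimes>\<^sub>M (T \<Otimes>\<^sub>M U)) (\<lambda>\<omega>. (X \<omega>, (Y \<omega>, Z \<omega>))) =
      distr M S X \<Otimes>\<^sub>M (distr M T Y \<Otimes>\<^sub>M distr M U Z)"
    using XYZ by (subst (asm) indep_rv_iff_distr[OF M]) (auto simp: law_YZ)
  have "distr M (T \<Otimes>\<^sub>M (S \<Otimes>\<^sub>M U)) (\<lambda>\<omega>. (Y \<omega>, (X \<omega>, Z \<omega>))) =
      distr M T Y \<Otimes>\<^sub>M (distr M S X \<Otimes>\<^sub>M distr M U Z)"
  proof (rule measure_eqI)
    fix E assume "E \<in> sets (distr M (T \<Otimes>\<^sub>M (S \<Otimes>\<^sub>M U)) (\<lambda>\<omega>. (Y \<omega>, (X \<omega>, Z \<omega>))))"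
    then have [measurable]: "E \<in> sets (T \<Otimes>\<^sub>M (S \<Otimes>\<^sub>M U))" by simp
    let ?i = "\<lambda>p. indicator E p :: ennreal"
    have "emeasure (distr M (T \<Otimes>\<^sub>M (S \<Otimes>\<^sub>M U)) (\<lambda>\<omega>. (Y \<omega>, (X \<omega>, Z \<omega>)))) E =
        (\<integral>\<^sup>+\<omega>. ?i (Y \<omega>, (X \<omega>, Z \<omega>)) \<partial>M)"
      by (simp flip: nn_integral_indicator add: nn_integral_distr)
    also have "\<dots> = (\<integral>\<^sup>+p. ?i (fst (snd p), (fst p, snd (snd p)))
        \<partial>distr M (S \<Otimes>\<^sub>M (T \<Otimes>\<^sub>M U)) (\<lambda>\<omega>. (X \<omega>, (Y \<omega>, Z \<omega>))))"
      by (subst nn_integral_distr) auto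
    also have "\<dots> = (\<integral>\<^sup>+x. \<integral>\<^sup>+p. ?i (fst p, (x, snd p)) \<partial>(distr M T Y \<Otimes>\<^sub>M distr M U Z) \<partial>distr M S X)"
      unfolding law by (subst YZ.nn_integral_fst[symmetric]) auto
    also have "\<dots> = (\<integral>\<^sup>+x. \<integral>\<^sup>+y. \<integral>\<^sup>+z. ?i (y, (x, z)) \<partial>distr M U Z \<partial>distr M T Y \<partial>distr M S X)"
      by (intro nn_integral_cong, subst Z.nn_integral_fst[symmetric]) auto
    also have "\<dots> = (\<integral>\<^sup>+y. \<integral>\<^sup>+x. \<integral>\<^sup>+z. ?i (y, (x, z)) \<partial>distr M U Z \<partial>distr M S X \<partial>distr M T Y)"
      by (rule YX.Fubini') measurable
    also have "\<dots> = (\<integral>\<^sup>+y. \<integral>\<^sup>+p. ?i (y, p) \<partial>(distr M S X \<Otimes>\<^sub>M distr M U Z) \<partial>distr M T Y)"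
      by (intro nn_integral_cong, subst Z.nn_integral_fst[symmetric]) auto
    also have "\<dots> = (\<integral>\<^sup>+p. ?i p \<partial>(distr M T Y \<Otimes>\<^sub>M (distr M S X \<Otimes>\<^sub>M distr M U Z)))"
      by (subst XZ.nn_integral_fst) auto
    finally show "emeasure (distr M (T \<Otimes>\<^sub>M (S \<Otimes>\<^sub>M U)) (\<lambda>\<omega>. (Y \<omega>, (X \<omega>, Z \<omega>)))) E =
        emeasure (distr M T Y \<Otimes>\<^sub>M (distr M S X \<Otimes>\<^sub>M distr M U Z)) E"
      by simp
  qed (auto cong: sets_pair_measure_cong)
  then show ?thesis
    by (subst indep_rv_iff_distr[OF M]) (auto simp: law_XZ)
qed

text \<open>Here \<open>F\<close> is the information already revealed and \<open>Z\<close> is fresh randomness.\<close>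

lemma distr_resample:
  assumes M: "prob_space M"
    and FZ: "indep_rv M F (\<lambda>\<omega>. \<omega>) S Z" and FX: "indep_rv M F (\<lambda>\<omega>. \<omega>) E X"
    and T [measurable]: "T \<in> measurable (F \<Otimes>\<^sub>M S) E"
    and law: "\<And>\<omega>. \<omega> \<in> space F \<Longrightarrow> distr (distr M S Z) E (\<lambda>z. T (\<omega>, z)) = distr M E X"
    and \<Phi> [measurable]: "\<Phi> \<in> measurable (F \<Otimes>\<^sub>M E) N"
  shows "distr M N (\<lambda>\<omega>. \<Phi> (\<omega>, T (\<omega>, Z \<omega>))) = distr M N (\<lambda>\<omega>. \<Phi> (\<omega>, X \<omega>))"
proof (rule measure_eqI)
  interpret prob_space M by fact
  note meas [measurable] = indep_rv_measurable[OF FZ] indep_rv_measurable(2)[OF FX]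
  interpret Z: prob_space "distr M S Z" by (rule prob_space_distr) measurable
  interpret X: prob_space "distr M E X" by (rule prob_space_distr) measurable
  fix A assume "A \<in> sets (distr M N (\<lambda>\<omega>. \<Phi> (\<omega>, T (\<omega>, Z \<omega>))))"
  then have [measurable]: "A \<in> sets N" by simp
  have law_Z: "distr M (F \<Otimes>\<^sub>M S) (\<lambda>\<omega>. (\<omega>, Z \<omega>)) = distr M F (\<lambda>\<omega>. \<omega>) \<Otimes>\<^sub>M distr M S Z"
    using FZ by (subst (asm) indep_rv_iff_distr[OF M]) auto
  have law_X: "distr M (F \<Otimes>\<^sub>M E) (\<lambda>\<omega>. (\<omega>, X \<omega>)) = distr M F (\<lambda>\<omega>. \<omega>) \<Otimes>\<^sub>M distr M E X"
    using FX by (subst (asm) indep_rv_iff_distr[OF M]) auto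
  let ?i = "\<lambda>p. indicator A p :: ennreal"
  have "emeasure (distr M N (\<lambda>\<omega>. \<Phi> (\<omega>, T (\<omega>, Z \<omega>)))) A = (\<integral>\<^sup>+\<omega>. ?i (\<Phi> (\<omega>, T (\<omega>, Z \<omega>))) \<partial>M)"
    by (simp flip: nn_integral_indicator add: nn_integral_distr)
  also have "\<dots> = (\<integral>\<^sup>+p. ?i (\<Phi> (fst p, T p)) \<partial>distr M (F \<Otimes>\<^sub>M S) (\<lambda>\<omega>. (\<omega>, Z \<omega>)))"
    by (subst nn_integral_distr) auto
  also have "\<dots> = (\<integral>\<^sup>+\<omega>. \<integral>\<^sup>+z. ?i (\<Phi> (\<omega>, T (\<omega>, z))) \<partial>distr M S Z \<partial>distr M F (\<lambda>\<omega>. \<omega>))"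
    unfolding law_Z by (subst Z.nn_integral_fst[symmetric]) auto
  \<comment> \<open>With the outcome frozen, \<open>T (\<omega>, z)\<close> under the law of
    \<open>Z\<close> is distributed like \<open>X\<close>; this pointwise identity takes the place
    of conditioning on \<open>F\<close>.\<close>
  also have "\<dots> = (\<integral>\<^sup>+\<omega>. \<integral>\<^sup>+x. ?i (\<Phi> (\<omega>, x)) \<partial>distr M E X \<partial>distr M F (\<lambda>\<omega>. \<omega>))"
  proof (rule nn_integral_cong)
    fix \<omega> assume "\<omega> \<in> space (distr M F (\<lambda>\<omega>. \<omega>))"
    then have [measurable]: "\<omega> \<in> space F" by simp
    show "(\<integral>\<^sup>+z. ?i (\<Phi> (\<omega>, T (\<omega>, z))) \<partial>distr M S Z) = (\<integral>\<^sup>+x. ?i (\<Phi> (\<omega>, x)) \<partial>distr M E X)"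
      unfolding law[OF \<open>\<omega> \<in> space F\<close>, symmetric] by (subst (2) nn_integral_distr) auto
  qed
  also have "\<dots> = (\<integral>\<^sup>+p. ?i (\<Phi> p) \<partial>distr M (F \<Otimes>\<^sub>M E) (\<lambda>\<omega>. (\<omega>, X \<omega>)))"
    unfolding law_X by (subst X.nn_integral_fst[symmetric]) auto
  also have "\<dots> = (\<integral>\<^sup>+\<omega>. ?i (\<Phi> (\<omega>, X \<omega>)) \<partial>M)"
    by (subst nn_integral_distr) auto
  also have "\<dots> = emeasure (distr M N (\<lambda>\<omega>. \<Phi> (\<omega>, X \<omega>))) A"
    by (simp flip: nn_integral_indicator add: nn_integral_distr)
  finally show "emeasure (distr M N (\<lambda>\<omega>. \<Phi> (\<omega>, T (\<omega>, Z \<omega>)))) A = emeasure (distr M N (\<lambda>\<omega>. \<Phi> (\<omega>, X \<omega>))) A" .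
qed simp

section \<open>Sigma-algebras generated by sources\<close>

lemma space_information [simp]: "space (information M E I) = space M"
  by (simp add: information_def space_measure_of_conv)

lemma sets_information:
  "(\<And>i. i \<in> I \<Longrightarrow> E i \<subseteq> Pow (space M)) \<Longrightarrow> 
    sets (information M E I) = sigma_sets (space M) (\<Union>i\<in>I. E i)"
  by (auto simp: information_def intro!: sets_measure_of)

lemma sets_information_subset:
  assumes "\<And>i. i \<in> I \<Longrightarrow> E i \<subseteq> sets (information M E K)" "\<And>i. i \<in> I \<Longrightarrow> E i \<subseteq> Pow (space M)"
  shows "sets (information M E I) \<subseteq> sets (information M E K)"
  using assms sets.sigma_sets_subset[of "\<Union>i\<in>I. E i" "information M E K"]
  by (simp add: sets_information UN_subset_iff)

lemma sets_vimage_algebra_Pow: "sets (vimage_algebra \<Omega> X S) \<subseteq> Pow \<Omega>"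
  using sets.space_closed[of "vimage_algebra \<Omega> X S"] by simp

text \<open>A sigma-algebra is treated as a random variable, namely the identity map into the
  coarser measurable space. Disjoint groups of independent intersection-stable generators then yield
  independent variables of this kind, and every function of the sources is a composition with one of
  them.\<close>

lemma indep_rv_information:
  assumes M: "prob_space M" and indep: "prob_space.indep_sets M E I"
    and JK: "J \<subseteq> I" "K \<subseteq> I" "J \<inter> K = {}" and E: "\<And>i. i \<in> I \<Longrightarrow> Int_stable (E i)"
  shows "indep_rv M (information M E J) (\<lambda>\<omega>. \<omega>) (information M E K) (\<lambda>\<omega>. \<omega>)"
proof -
  interpret prob_space M by fact
  have EM: "E i \<subseteq> sets M" if "i \<in> I" for i
    using indep that by (auto simp: indep_sets_def)
  then have Pow: "E i \<subseteq> Pow (space M)" if "i \<in> I" for i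
    using that sets.space_closed by blast
  have info: "sets (information M E L) = sigma_sets (space M) (\<Union>i\<in>L. E i)" if "L \<subseteq> I" for L
    using that Pow by (intro sets_information) auto
  have sub: "sets (information M E L) \<subseteq> sets M" if "L \<subseteq> I" for L
    unfolding info[OF that] using that EM by (intro sets.sigma_sets_subset) auto
  have id: "(\<lambda>\<omega>. \<omega>) \<in> measurable M (information M E L)" if "L \<subseteq> I" for L
    using sub[OF that] by (intro measurableI) (auto dest: sets.sets_into_space intro: sets.Int)
  have vim: "sets (vimage_algebra (space M) (\<lambda>\<omega>. \<omega>) (information M E L)) =
      sigma_sets (space M) (\<Union>i\<in>L. E i)" if "L \<subseteq> I" for L
  proof -
    have "{(\<lambda>\<omega>. \<omega>) -` A \<inter> space M |A. A \<in> sets (information M E L)} = sets (information M E L)"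
      using sets.sets_into_space[of _ "information M E L"] by (auto simp: Int_absorb2)
    then show ?thesis
      using info[OF that] by (subst sets_vimage_algebra2) auto
  qed
  have "indep_sets (\<lambda>b. sigma_sets (space M) (\<Union>i\<in>case_bool J K b. E i)) UNIV"
  proof (rule indep_sets_collect_sigma)
    show "indep_sets E (\<Union>b. case_bool J K b)"
      using indep by (rule indep_sets_mono_index[rotated]) (use JK in \<open>auto split: bool.splits\<close>)
    show "disjoint_family (case_bool J K)"
      using JK(3) by (auto simp: disjoint_family_on_def split: bool.splits)
    fix i b assume "i \<in> case_bool J K b"
    then show "Int_stable (E i)"
      using JK E by (auto split: bool.splits)
  qed
  then have "indep_set (sigma_sets (space M) (\<Union>i\<in>J. E i)) (sigma_sets (space M) (\<Union>i\<in>K. E i))"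
    unfolding indep_set_def by (rule indep_sets_mono_sets) (auto split: bool.splits)
  then show ?thesis
    using id JK vim by (simp add: indep_rv_def)
qed

section \<open>Measurability\<close>

lemma measurable_vec_nth [measurable (raw)]:
  fixes f :: "'o \<Rightarrow> ('b::euclidean_space)^'k"
  assumes "f \<in> borel_measurable F"
  shows "(\<lambda>\<omega>. f \<omega> $ i) \<in> borel_measurable F"
  by (rule borel_measurable_continuous_on[OF _ assms]) (intro continuous_intros)

lemma measurable_vecI:
  fixes f :: "'o \<Rightarrow> ('b::euclidean_space)^'k"
  assumes "\<And>i. (\<lambda>\<omega>. f \<omega> $ i) \<in> borel_measurable F"
  shows "f \<in> borel_measurable F"
proof (rule borel_measurable_euclidean_space[THEN iffD2, rule_format])
  fix b :: "'b^'k" assume "b \<in> Basis"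
  then obtain i c where "b = axis i c"
    by (auto simp: Basis_vec_def)
  then show "(\<lambda>\<omega>. f \<omega> \<bullet> b) \<in> borel_measurable F"
    using assms[of i] by (simp add: inner_axis)
qed

lemma measurable_matrix_vector [measurable (raw)]:
  fixes A :: "'o \<Rightarrow> real^'m^'k"
  assumes [measurable]: "A \<in> borel_measurable F" "x \<in> borel_measurable F"
  shows "(\<lambda>\<omega>. A \<omega> *v x \<omega>) \<in> borel_measurable F"
  by (rule measurable_vecI) (simp add: matrix_vector_mult_def)

lemma measurable_matrix_matrix [measurable (raw)]:
  fixes A :: "'o \<Rightarrow> real^'m^'k" and B :: "'o \<Rightarrow> real^'l^'m"
  assumes [measurable]: "A \<in> borel_measurable F" "B \<in> borel_measurable F"
  shows "(\<lambda>\<omega>. A \<omega> ** B \<omega>) \<in> borel_measurable F"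
  by (intro measurable_vecI) (simp add: matrix_matrix_mult_def)

lemma measurable_outer [measurable (raw)]:
  assumes [measurable]: "a \<in> borel_measurable F" "b \<in> borel_measurable F"
  shows "(\<lambda>\<omega>. outer (a \<omega>) (b \<omega>)) \<in> borel_measurable F"
  by (intro measurable_vecI) (simp add: outer_def)

lemma measurable_transpose [measurable (raw)]:
  fixes A :: "'o \<Rightarrow> real^'m^'k"
  assumes [measurable]: "A \<in> borel_measurable F"
  shows "(\<lambda>\<omega>. transpose (A \<omega>)) \<in> borel_measurable F"
  by (intro measurable_vecI) (simp add: transpose_def)

text \<open>A pointwise limit of difference quotients with increments \<open>1 / (n + 1)\<close>,
  each jointly measurable in the point and the parameter. It makes the correction coefficients of
  the recursion measurable although their parameters are random.\<close>

lemma measurable_deriv_param: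
  fixes F :: "real \<Rightarrow> 'p \<Rightarrow> real"
  assumes F [measurable]: "(\<lambda>(x, p). F x p) \<in> borel_measurable (borel \<Otimes>\<^sub>M P)"
    and diff: "\<And>x p. p \<in> space P \<Longrightarrow> (\<lambda>x. F x p) differentiable (at x)"
  shows "(\<lambda>(x, p). deriv (\<lambda>x. F x p) x) \<in> borel_measurable (borel \<Otimes>\<^sub>M P)"
proof (rule borel_measurable_LIMSEQ_real)
  let ?e = "\<lambda>n. inverse (real (Suc n))"
  show "(\<lambda>(x, p). (F (x + ?e n) p - F x p) / ?e n) \<in> borel_measurable (borel \<Otimes>\<^sub>M P)" for n
  proof -
    have "(\<lambda>a. (\<lambda>(x, p). F x p) (fst a + ?e n, snd a) - (\<lambda>(x, p). F x p) a)
        \<in> borel_measurable (borel \<Otimes>\<^sub>M P)"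
      by measurable
    then show ?thesis
      by (simp add: case_prod_beta)
  qed
  fix a :: "real \<times> 'p" assume "a \<in> space (borel \<Otimes>\<^sub>M P)"
  then obtain x p where a: "a = (x, p)" "p \<in> space P"
    by (auto simp: space_pair_measure)
  have "((\<lambda>x. F x p) has_field_derivative deriv (\<lambda>x. F x p) x) (at x)"
    using diff[OF a(2)] by (simp add: DERIV_deriv_iff_real_differentiable)
  then have "(\<lambda>h. (F (x + h) p - F x p) / h) \<midarrow>0\<rightarrow> deriv (\<lambda>x. F x p) x"
    by (simp add: DERIV_def)
  moreover have "filterlim ?e (at 0) sequentially"
    by (use LIMSEQ_inverse_real_of_nat in \<open>auto simp: filterlim_at simp del: of_nat_Suc\<close>)
  ultimately have "(\<lambda>n. (F (x + ?e n) p - F x p) / ?e n) \<longlonglongrightarrow> deriv (\<lambda>x. F x p) x"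
    by (rule filterlim_compose)
  then show "(\<lambda>n. case a of (x, p) \<Rightarrow> (F (x + ?e n) p - F x p) / ?e n) \<longlonglongrightarrow>
      (case a of (x, p) \<Rightarrow> deriv (\<lambda>x. F x p) x)"
    by (simp add: a)
qed

text \<open>Pointwise orthonormality replaces the projection, defined by a description, by an
  explicit sum. What remains is a case distinction on whether a measurable residual
  vanishes.\<close>

lemma measurable_next_direction:
  fixes b :: "'i \<Rightarrow> 'o \<Rightarrow> real^'k"
  assumes J: "finite J" and \<kappa>: "\<kappa> \<in> borel_measurable (Pi\<^sub>M J (\<lambda>_. borel))"
    and b [measurable]: "\<And>j. j \<in> J \<Longrightarrow> b j \<in> borel_measurable F"
    and orth: "\<And>\<omega>. \<omega> \<in> space F \<Longrightarrow> orthonormal_on J (\<lambda>j. b j \<omega>)"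
    and x [measurable]: "x \<in> borel_measurable F"
  shows "(\<lambda>\<omega>. next_direction \<kappa> J (\<lambda>j. b j \<omega>) (x \<omega>)) \<in> borel_measurable F"
proof -
  let ?p = "\<lambda>\<omega>. x \<omega> - (\<Sum>j\<in>J. (b j \<omega> \<bullet> x \<omega>) *\<^sub>R b j \<omega>)"
  have [measurable]: "?p \<in> borel_measurable F"
    by measurable
  have [measurable]: "(\<lambda>\<omega>. \<kappa> (restrict (\<lambda>j. b j \<omega>) J)) \<in> borel_measurable F"
    by (rule measurable_compose[OF _ \<kappa>]) (intro measurable_restrict b)
  have "(\<lambda>\<omega>. if ?p \<omega> = 0 then \<kappa> (restrict (\<lambda>j. b j \<omega>) J) else inverse (norm (?p \<omega>)) *\<^sub>R ?p \<omega>)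
      \<in> borel_measurable F"
    by measurable
  moreover have "next_direction \<kappa> J (\<lambda>j. b j \<omega>) (x \<omega>) =
      (if ?p \<omega> = 0 then \<kappa> (restrict (\<lambda>j. b j \<omega>) J) else inverse (norm (?p \<omega>)) *\<^sub>R ?p \<omega>)"
    if "\<omega> \<in> space F" for \<omega>
    using perp_proj_apply[OF J orth[OF that]] by (simp add: next_direction_def sgn_div_norm)
  ultimately show ?thesis
    by (subst measurable_cong)
qed

section \<open>The law of the coupled matrix\<close>

text \<open>One horizon \<open>T\<close> is fixed, since the coupled matrix changes with the
  horizon; the theorem instantiates the locale at each admissible time.\<close>

locale coupling = prob_space M for M :: "'o measure" +
  fixes L :: "'l measure" and A :: "'a measure"
    and \<theta> :: "real^'d"
    and \<phi> :: "real \<Rightarrow> 'l \<Rightarrow> real"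
    and v0 :: "'o \<Rightarrow> real^'d"
    and g :: "int \<Rightarrow> 'o \<Rightarrow> real^'n" and s :: "nat \<Rightarrow> 'o \<Rightarrow> real^'d"
    and W :: "'o \<Rightarrow> real^'d^'n"
    and el :: "'o \<Rightarrow> 'n \<Rightarrow> 'l" and ea :: "'o \<Rightarrow> 'a"
    and y :: "'o \<Rightarrow> real^'n"
    and pf ph :: "nat \<Rightarrow> nat"
    and \<Xi> \<Theta> :: "nat \<Rightarrow> (nat \<Rightarrow> real) set"
    and f :: "nat \<Rightarrow> real \<Rightarrow> (nat \<Rightarrow> real) \<Rightarrow> real"
    and h :: "nat \<Rightarrow> real \<Rightarrow> real \<Rightarrow> (nat \<Rightarrow> real) \<Rightarrow> real"
    and \<xi> \<eta> :: "nat \<Rightarrow> 'o \<Rightarrow> nat \<Rightarrow> real"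
    and \<kappa>R :: "nat \<Rightarrow> (nat \<Rightarrow> real^'n) \<Rightarrow> real^'n"
    and \<kappa>Q :: "nat \<Rightarrow> (int \<Rightarrow> real^'d) \<Rightarrow> real^'d"
    and u r :: "nat \<Rightarrow> 'o \<Rightarrow> real^'n" and w :: "int \<Rightarrow> 'o \<Rightarrow> real^'n"
    and v z :: "nat \<Rightarrow> 'o \<Rightarrow> real^'d" and q :: "int \<Rightarrow> 'o \<Rightarrow> real^'d"
    and T :: nat
  assumes theta: "norm \<theta> = sqrt (real CARD('d))"
    and v0_meas: "v0 \<in> borel_measurable M"
    and el_meas: "el \<in> measurable M (link_space L)" and ea_meas: "ea \<in> measurable M A"
    and g_law: "\<And>j. j \<ge> -1 \<Longrightarrow> iid_normal M 1 UNIV (\<lambda>i \<omega>. g j \<omega> $ i)"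
    and s_law: "\<And>j. iid_normal M 1 UNIV (\<lambda>i \<omega>. s j \<omega> $ i)"
    and W_law: "gaussian_design M W"
    and indep: "indep_sets (source_events M L A v0 g s W el ea)
           ({Src_init, Src_W, Src_seeds} \<union> Src_g ` {-1..} \<union> range Src_s)"
    and phi_meas: "(\<lambda>(x, e). \<phi> x e) \<in> borel_measurable (borel \<Otimes>\<^sub>M L)"
    and y_def: "\<And>\<omega>. \<omega> \<in> space M \<Longrightarrow> y \<omega> = entrywise2 \<phi> (g (-1) \<omega>) (el \<omega>)"
    and f_meas: "\<And>k. (\<lambda>(x, p). f k x p) \<in>
           borel_measurable (borel \<Otimes>\<^sub>M restrict_space (param_space (pf k)) (\<Xi> k))"
    and h_meas: "\<And>k. (\<lambda>(x, b, p). h k x b p) \<in>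
           borel_measurable (borel \<Otimes>\<^sub>M borel \<Otimes>\<^sub>M restrict_space (param_space (ph k)) (\<Theta> k))"
    and f_diff: "\<And>k x p. p \<in> \<Xi> k \<Longrightarrow> (\<lambda>x. f k x p) differentiable (at x)"
    and h_diff: "\<And>k b x p. p \<in> \<Theta> k \<Longrightarrow> (\<lambda>x. h k x b p) differentiable (at x)"
    and xi_in: "\<And>k \<omega>. \<omega> \<in> space M \<Longrightarrow> \<xi> k \<omega> \<in> \<Xi> k"
    and eta_in: "\<And>k \<omega>. \<omega> \<in> space M \<Longrightarrow> \<eta> k \<omega> \<in> \<Theta> k"
    and xi0: "\<xi> 0 \<in> measurable
           (information M (source_events M L A v0 g s W el ea) {Src_init, Src_alg})
           (param_space (pf 0))"
    and eta: "\<And>l. \<eta> l \<in> measurable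
           (information M (source_events M L A v0 g s W el ea)
              ({Src_seeds, Src_init} \<union> Src_g ` {-1..int l} \<union> Src_s ` {..<l}))
           (param_space (ph l))"
    and xi_Suc: "\<And>l. \<xi> (Suc l) \<in> measurable
           (information M (source_events M L A v0 g s W el ea)
              ({Src_seeds, Src_init} \<union> Src_g ` {-1..int l} \<union> Src_s ` {..l}))
           (param_space (pf (Suc l)))"
    and ruleR: "\<And>l. completion_rule {..<l} (\<kappa>R l)"
    and ruleQ: "\<And>l. completion_rule {-1..<int l} (\<kappa>Q l)"
    and constr: "\<And>\<omega>. \<omega> \<in> space M \<Longrightarrow>
           coupled_iterates \<theta> \<kappa>R \<kappa>Q (\<lambda>k x. f k x (\<xi> k \<omega>)) (\<lambda>k x b. h k x b (\<eta> k \<omega>))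
             (\<lambda>j. g j \<omega>) (\<lambda>j. s j \<omega>) (y \<omega>) (v0 \<omega>)
             (\<lambda>j. u j \<omega>) (\<lambda>j. v j \<omega>) (\<lambda>j. w j \<omega>) (\<lambda>j. z j \<omega>) (\<lambda>j. r j \<omega>) (\<lambda>j. q j \<omega>)"
    and T_d: "T + 2 \<le> CARD('d)" and T_n: "T + 1 \<le> CARD('n)"
begin

abbreviation events_of :: "source \<Rightarrow> 'o set set" where
  "events_of \<equiv> source_events M L A v0 g s W el ea"

abbreviation sources :: "source set" where
  "sources \<equiv> {Src_init, Src_W, Src_seeds} \<union> Src_g ` {-1..} \<union> range Src_s"

text \<open>Both bounds are exclusive, so \<open>revealed (-1) 0\<close> consists of the
  initialisation and the seeds. \<open>Src_W\<close> never belongs to it, which keeps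
  \<open>W\<close> independent of the past throughout.\<close>

definition revealed :: "int \<Rightarrow> nat \<Rightarrow> source set" where
  "revealed a b = {Src_seeds, Src_init} \<union> Src_g ` {-1..<a} \<union> Src_s ` {..<b}"

abbreviation info :: "int \<Rightarrow> nat \<Rightarrow> 'o measure" where
  "info a b \<equiv> information M events_of (revealed a b)"

lemma path: "\<omega> \<in> space M \<Longrightarrow>
    coupled_path \<theta> \<kappa>R \<kappa>Q (\<lambda>k x. f k x (\<xi> k \<omega>)) (\<lambda>k x b. h k x b (\<eta> k \<omega>))
      (\<lambda>j. g j \<omega>) (\<lambda>j. s j \<omega>) (y \<omega>) (v0 \<omega>)
      (\<lambda>j. u j \<omega>) (\<lambda>j. v j \<omega>) (\<lambda>j. w j \<omega>) (\<lambda>j. z j \<omega>) (\<lambda>j. r j \<omega>) (\<lambda>j. q j \<omega>) T"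
  using constr theta ruleR ruleQ T_d T_n by unfold_locales

lemma events_of_Pow: "events_of i \<subseteq> Pow (space M)"
  by (cases i) (simp_all add: sets_vimage_algebra_Pow)

lemma Int_stable_events_of: "Int_stable (events_of i)"
  by (cases i) (auto intro: sets.Int_stable)

lemma events_of_subset: "i \<in> I \<Longrightarrow> events_of i \<subseteq> sets (information M events_of I)"
  using events_of_Pow by (subst sets_information) auto

lemma measurable_source:
  assumes "events_of i \<supseteq> sets (vimage_algebra (space M) X S)" "X \<in> space M \<rightarrow> space S" "i \<in> I"
  shows "X \<in> measurable (information M events_of I) S"
proof (rule measurableI)
  fix B assume "B \<in> sets S"
  then have "X -` B \<inter> space M \<in> sets (vimage_algebra (space M) X S)"
    by (rule in_vimage_algebra)
  then show "X -` B \<inter> space (information M events_of I) \<in> sets (information M events_of I)"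
    unfolding space_information using assms(1) events_of_subset[OF assms(3)] by blast
qed (use assms(2) in auto)

lemma subalgebra_information:
  assumes "I \<subseteq> sources"
  shows "subalgebra M (information M events_of I)"
proof -
  have "\<forall>i\<in>sources. events_of i \<subseteq> sets M"
    by (rule indep[unfolded indep_sets_def, THEN conjunct1])
  then have "events_of i \<subseteq> sets M" if "i \<in> I" for i
    using assms that by blast
  then have "sigma_sets (space M) (\<Union>i\<in>I. events_of i) \<subseteq> sets M"
    by (intro sets.sigma_sets_subset UN_least)
  then show ?thesis
    using sets_information[of I events_of M] events_of_Pow by (simp add: subalgebra_def)
qed

lemma revealed_subset: "revealed a b \<subseteq> sources"
  by (auto simp: revealed_def)

lemma measurable_info:
  "X \<in> measurable (info a b) S \<Longrightarrow> X \<in> measurable M S"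
  using measurable_from_subalg[OF subalgebra_information[OF revealed_subset]] .

lemma measurable_information_mono:
  "I \<subseteq> J \<Longrightarrow> X \<in> measurable (information M events_of I) S \<Longrightarrow> X \<in> measurable (information M events_of J) S"
proof (erule measurable_from_subalg[rotated])
  assume "I \<subseteq> J"
  then have "sets (information M events_of I) \<subseteq> sets (information M events_of J)"
    using events_of_Pow events_of_subset by (intro sets_information_subset) blast+
  then show "subalgebra (information M events_of J) (information M events_of I)"
    by (simp add: subalgebra_def)
qed

lemma measurable_info_mono:
  assumes "X \<in> measurable (info a b) S" "a \<le> a'" "b \<le> b'"
  shows "X \<in> measurable (info a' b') S"
  by (rule measurable_information_mono[OF _ assms(1)]) (use assms(2,3) in \<open>auto simp: revealed_def\<close>)

lemma v0_info: "v0 \<in> borel_measurable (info a b)"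
  by (rule measurable_source[where i = Src_init]) (auto simp: revealed_def)

lemma seeds_info: "(\<lambda>\<omega>. (el \<omega>, ea \<omega>)) \<in> measurable (info a b) (link_space L \<Otimes>\<^sub>M A)"
  using measurable_space[OF el_meas] measurable_space[OF ea_meas]
  by (intro measurable_source[where i = Src_seeds]) (auto simp: revealed_def space_pair_measure)

lemma el_info: "el \<in> measurable (info a b) (link_space L)"
  and ea_info: "ea \<in> measurable (info a b) A"
  using measurable_compose[OF seeds_info measurable_fst] measurable_compose[OF seeds_info measurable_snd]
  by simp_all

lemma g_info: "-1 \<le> j \<Longrightarrow> j < a \<Longrightarrow> g j \<in> borel_measurable (info a b)"
  by (rule measurable_source[where i = "Src_g j"]) (auto simp: revealed_def)

lemma s_info: "j < b \<Longrightarrow> s j \<in> borel_measurable (info a b)"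
  by (rule measurable_source[where i = "Src_s j"]) (auto simp: revealed_def)

lemma y_info:
  assumes "0 \<le> a"
  shows "y \<in> borel_measurable (info a b)"
proof -
  note [measurable] = g_info[of "-1" a b] el_info
  have "(\<lambda>\<omega>. y \<omega> $ i) \<in> borel_measurable (info a b)" for i
  proof -
    have "(\<lambda>\<omega>. (\<lambda>(x, e). \<phi> x e) (g (-1) \<omega> $ i, el \<omega> i)) \<in> borel_measurable (info a b)"
      using assms by (intro measurable_compose[OF _ phi_meas]) measurable
    then show ?thesis
      by (subst measurable_cong[where g = "\<lambda>\<omega>. \<phi> (g (-1) \<omega> $ i) (el \<omega> i)"])
        (auto simp: y_def entrywise2_def)
  qed
  then show ?thesis
    by (rule measurable_vecI)
qed

lemma xi_info: "\<xi> l \<in> measurable (info (int l) l) (restrict_space (param_space (pf l)) (\<Xi> l))"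
proof -
  have "\<xi> l \<in> measurable (info (int l) l) (param_space (pf l))"
  proof (cases l)
    case 0
    \<comment> \<open>\<open>Src_alg\<close> is not itself a revealed source: its events depend on
      those of \<open>Src_seeds\<close>. They are recovered through the second component of the pair
      of seeds.\<close>
    have "events_of Src_alg \<subseteq> sets (info 0 0)"
    proof
      fix B assume "B \<in> events_of Src_alg"
      moreover have "ea \<in> space M \<rightarrow> space A"
        using measurable_space[OF ea_meas] by auto
      ultimately obtain C where "C \<in> sets A" "B = ea -` C \<inter> space M"
        by (auto simp: sets_vimage_algebra2)
      then show "B \<in> sets (info 0 0)"
        using measurable_sets[OF ea_info, of C 0 0] by simp
    qed
    moreover have "events_of Src_init \<subseteq> sets (info 0 0)"
      by (rule events_of_subset) (simp add: revealed_def)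
    ultimately have "sets (information M events_of {Src_init, Src_alg}) \<subseteq> sets (info 0 0)"
      using events_of_Pow by (intro sets_information_subset) blast+
    then have "subalgebra (info 0 0) (information M events_of {Src_init, Src_alg})"
      by (simp add: subalgebra_def)
    then show ?thesis
      using xi0 0 by (auto intro: measurable_from_subalg)
  next
    case (Suc k)
    have "{-1..<int l} = {-1..int k}" "{..<l} = {..k}"
      using Suc by auto
    then show ?thesis
      using xi_Suc[of k] Suc by (simp add: revealed_def)
  qed
  then show ?thesis
    using xi_in by (intro measurable_restrict_space2) auto
qed

lemma eta_info:
  "\<eta> l \<in> measurable (info (int l + 1) l) (restrict_space (param_space (ph l)) (\<Theta> l))"
proof -
  have "{-1..<int l + 1} = {-1..int l}"
    by auto
  then show ?thesis
    using eta[of l] eta_in by (intro measurable_restrict_space2) (auto simp: revealed_def)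
qed

lemma measurable_entrywise:
  assumes p: "p \<in> measurable F (restrict_space (param_space (pf k)) (\<Xi> k))"
    and x [measurable]: "x \<in> borel_measurable F"
  shows "(\<lambda>\<omega>. entrywise (\<lambda>a. f k a (p \<omega>)) (x \<omega>)) \<in> borel_measurable F"
    and "(\<lambda>\<omega>. hat_b (\<lambda>a. f k a (p \<omega>)) (x \<omega>)) \<in> borel_measurable F"
proof -
  have "(\<lambda>\<omega>. (\<lambda>(a, p). f k a p) (x \<omega> $ i, p \<omega>)) \<in> borel_measurable F" for i
    by (rule measurable_compose[OF _ f_meas]) (use p in measurable)
  then show "(\<lambda>\<omega>. entrywise (\<lambda>a. f k a (p \<omega>)) (x \<omega>)) \<in> borel_measurable F"
    by (intro measurable_vecI) (simp add: entrywise_def)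
  have "(\<lambda>(a, p). deriv (\<lambda>a. f k a p) a)
      \<in> borel_measurable (borel \<Otimes>\<^sub>M restrict_space (param_space (pf k)) (\<Xi> k))"
    using f_meas f_diff by (intro measurable_deriv_param) (auto simp: space_restrict_space)
  then have "(\<lambda>\<omega>. (\<lambda>(a, p). deriv (\<lambda>a. f k a p) a) (x \<omega> $ i, p \<omega>)) \<in> borel_measurable F" for i
    by (rule measurable_compose[rotated]) (use p in measurable)
  then show "(\<lambda>\<omega>. hat_b (\<lambda>a. f k a (p \<omega>)) (x \<omega>)) \<in> borel_measurable F"
    by (simp add: hat_b_def)
qed

lemma measurable_entrywise2:
  assumes p: "p \<in> measurable F (restrict_space (param_space (ph k)) (\<Theta> k))"
    and x [measurable]: "x \<in> borel_measurable F" and b [measurable]: "b \<in> borel_measurable F"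
  shows "(\<lambda>\<omega>. entrywise2 (\<lambda>a c. h k a c (p \<omega>)) (x \<omega>) (($) (b \<omega>))) \<in> borel_measurable F"
    and "(\<lambda>\<omega>. hat_c m (\<lambda>a c. h k a c (p \<omega>)) (x \<omega>) (b \<omega>)) \<in> borel_measurable F"
proof -
  have "(\<lambda>\<omega>. (\<lambda>(a, c, p). h k a c p) (x \<omega> $ i, b \<omega> $ i, p \<omega>)) \<in> borel_measurable F" for i
    by (rule measurable_compose[OF _ h_meas]) (use p in measurable)
  then show "(\<lambda>\<omega>. entrywise2 (\<lambda>a c. h k a c (p \<omega>)) (x \<omega>) (($) (b \<omega>))) \<in> borel_measurable F"
    by (intro measurable_vecI) (simp add: entrywise2_def)
  have "(\<lambda>(a, cp). deriv (\<lambda>a. h k a (fst cp) (snd cp)) a)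
      \<in> borel_measurable (borel \<Otimes>\<^sub>M borel \<Otimes>\<^sub>M restrict_space (param_space (ph k)) (\<Theta> k))"
  proof (rule measurable_deriv_param)
    show "(\<lambda>(a, cp). h k a (fst cp) (snd cp))
      \<in> borel_measurable (borel \<Otimes>\<^sub>M borel \<Otimes>\<^sub>M restrict_space (param_space (ph k)) (\<Theta> k))"
    proof -
      have "(\<lambda>(a, cp). h k a (fst cp) (snd cp)) = (\<lambda>(a, c, p). h k a c p)"
        by auto
      then show ?thesis
        using h_meas[of k] by (simp only:)
    qed
  qed (use h_diff in \<open>auto simp: space_restrict_space space_pair_measure\<close>)
  then have "(\<lambda>\<omega>. (\<lambda>(a, cp). deriv (\<lambda>a. h k a (fst cp) (snd cp)) a) (x \<omega> $ i, b \<omega> $ i, p \<omega>))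
      \<in> borel_measurable F" for i
    by (rule measurable_compose[rotated]) (use p in measurable)
  then show "(\<lambda>\<omega>. hat_c m (\<lambda>a c. h k a c (p \<omega>)) (x \<omega>) (b \<omega>)) \<in> borel_measurable F"
    by (simp add: hat_c_def)
qed

text \<open>
  The projections \<open>perp_R\<close> and \<open>perp_Q\<close> in explicit form, with the index shifted by one: it is the
  first index that is not projected out.
\<close>

definition RP :: "nat \<Rightarrow> 'o \<Rightarrow> real^'n^'n" where
  "RP b \<omega> = mat 1 - (\<Sum>i<b. outer (r i \<omega>) (r i \<omega>))"

definition QP :: "int \<Rightarrow> 'o \<Rightarrow> real^'d^'d" where
  "QP a \<omega> = mat 1 - (\<Sum>i\<in>{-1..<a}. outer (q i \<omega>) (q i \<omega>))"

lemma perp_R_RP: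
  assumes "\<omega> \<in> space M" "j \<le> int T"
  shows "perp_R (\<lambda>i. r i \<omega>) j = RP (nat (j + 1)) \<omega>"
proof -
  have "{i. int i \<le> j} = {..<nat (j + 1)}"
    by auto
  then show ?thesis
    using coupled_path.perp_R_eq[OF path, OF assms] by (simp add: RP_def)
qed

lemma perp_Q_QP:
  assumes "\<omega> \<in> space M" "j \<le> int T"
  shows "perp_Q (\<lambda>i. q i \<omega>) j = QP (j + 1) \<omega>"
proof -
  have "{-1..j} = {-1..<j + 1}"
    by auto
  then show ?thesis
    using coupled_path.perp_Q_eq[OF path, OF assms] by (simp add: QP_def)
qed

lemma measurable_RP:
  "(\<And>i. i < b \<Longrightarrow> r i \<in> borel_measurable F) \<Longrightarrow> RP b \<in> borel_measurable F"
  unfolding RP_def[abs_def]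
  by (intro borel_measurable_diff borel_measurable_const borel_measurable_sum measurable_outer) auto

lemma measurable_QP:
  "(\<And>i. -1 \<le> i \<Longrightarrow> i < a \<Longrightarrow> q i \<in> borel_measurable F) \<Longrightarrow> QP a \<in> borel_measurable F"
  unfolding QP_def[abs_def]
  by (intro borel_measurable_diff borel_measurable_const borel_measurable_sum measurable_outer) auto

lemma q_init_info: "q (-1) \<in> borel_measurable (info a b)"
  using coupled_path.q_init[OF path]
  by (subst measurable_cong[where g = "\<lambda>_. (1 / sqrt (real CARD('d))) *\<^sub>R \<theta>"]) auto

section \<open>Predictability of the iterates\<close>

lemma v_step_info:
  assumes l: "l \<le> T"
    and z [measurable]: "z l \<in> borel_measurable F" and w [measurable]: "w (int l) \<in> borel_measurable F"
    and q: "\<And>j. -1 \<le> j \<Longrightarrow> j \<le> int l \<Longrightarrow> q j \<in> borel_measurable F"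
    and r: "\<And>j. j \<le> l \<Longrightarrow> r j \<in> borel_measurable F"
    and g: "\<And>j. -1 \<le> j \<Longrightarrow> j \<le> int l \<Longrightarrow> g j \<in> borel_measurable F"
    and s: "\<And>j. j \<le> l \<Longrightarrow> s j \<in> borel_measurable F"
    and u: "u l \<in> borel_measurable F" and y: "y \<in> borel_measurable F"
    and \<eta>: "\<eta> l \<in> measurable F (restrict_space (param_space (ph l)) (\<Theta> l))"
    and F: "space F = space M"
  shows "v (Suc l) \<in> borel_measurable F"
proof -
  let ?c = "sqrt (real CARD('d))"
  \<comment> \<open>\<open>nat j\<close> is 0 for \<open>j = -1\<close> as well as for
    \<open>j = 0\<close>: in both cases no direction \<open>r i\<close> precedes and the projection
    is the identity.\<close>
  have "(\<lambda>\<omega>. (\<Sum>j = -1..int l. (((RP (nat j) \<omega> *v g j \<omega>) \<bullet> w (int l) \<omega>) / ?c) *\<^sub>R q j \<omega>)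
      + (\<Sum>j\<le>l. ((r j \<omega> \<bullet> w (int l) \<omega>) / ?c) *\<^sub>R (QP (int j + 1) \<omega> *v s j \<omega>))
      - hat_c CARD('d) (\<lambda>x b. h l x b (\<eta> l \<omega>)) (u l \<omega>) (y \<omega>) *\<^sub>R z l \<omega>) \<in> borel_measurable F"
    using q r g s w z measurable_entrywise2(2)[OF \<eta> u y]
    by (intro borel_measurable_diff borel_measurable_add borel_measurable_sum
        borel_measurable_scaleR borel_measurable_divide borel_measurable_inner borel_measurable_const
        measurable_matrix_vector measurable_RP measurable_QP) auto
  then show ?thesis
    by (subst measurable_cong) (use l F in \<open>auto simp: coupled_path.v_Suc[OF path] perp_R_RP perp_Q_QP\<close>)
qed

lemma u_step_info:
  assumes l: "l \<le> T"
    and z [measurable]: "z l \<in> borel_measurable F" and w: "w (int l - 1) \<in> borel_measurable F"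
    and q: "\<And>j. -1 \<le> j \<Longrightarrow> j \<le> int l \<Longrightarrow> q j \<in> borel_measurable F"
    and r: "\<And>j. j < l \<Longrightarrow> r j \<in> borel_measurable F"
    and g: "\<And>j. -1 \<le> j \<Longrightarrow> j \<le> int l \<Longrightarrow> g j \<in> borel_measurable F"
    and s: "\<And>j. j < l \<Longrightarrow> s j \<in> borel_measurable F"
    and v: "v l \<in> borel_measurable F"
    and \<xi>: "\<xi> l \<in> measurable F (restrict_space (param_space (pf l)) (\<Xi> l))"
    and F: "space F = space M"
  shows "u l \<in> borel_measurable F"
proof -
  let ?c = "sqrt (real CARD('d))"
  have "(\<lambda>\<omega>. (\<Sum>j = -1..int l. ((q j \<omega> \<bullet> z l \<omega>) / ?c) *\<^sub>R (RP (nat j) \<omega> *v g j \<omega>))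
      + (\<Sum>j<l. (((QP (int j + 1) \<omega> *v s j \<omega>) \<bullet> z l \<omega>) / ?c) *\<^sub>R r j \<omega>)
      - hat_b (\<lambda>x. f l x (\<xi> l \<omega>)) (v l \<omega>) *\<^sub>R w (int l - 1) \<omega>) \<in> borel_measurable F"
    using q r g s w z measurable_entrywise(2)[OF \<xi> v]
    by (intro borel_measurable_diff borel_measurable_add borel_measurable_sum
        borel_measurable_scaleR borel_measurable_divide borel_measurable_inner borel_measurable_const
        measurable_matrix_vector measurable_RP measurable_QP) auto
  then show ?thesis
    by (subst measurable_cong) (use l F in \<open>auto simp: coupled_path.u_eq[OF path] perp_R_RP perp_Q_QP\<close>)
qed

text \<open>The timing that drives the revealing order: \<open>q l\<close> is known while
  \<open>g l\<close> is still fresh, and \<open>r l\<close> is known after \<open>g l\<close> but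
  while \<open>s l\<close> is still fresh. Strong induction is used because a new direction depends
  on all the earlier ones through the projections.\<close>

lemma iterates_info:
  assumes "l \<le> T"
  shows "v l \<in> borel_measurable (info (int l) l) \<and> z l \<in> borel_measurable (info (int l) l) \<and>
    q (int l) \<in> borel_measurable (info (int l) l) \<and> u l \<in> borel_measurable (info (int l + 1) l) \<and>
    w (int l) \<in> borel_measurable (info (int l + 1) l) \<and> r l \<in> borel_measurable (info (int l + 1) l)"
  using assms
proof (induction l rule: less_induct)
  case (less l)
  let ?F = "info (int l) l" and ?G = "info (int l + 1) l"
  have FG: "X \<in> measurable ?G S" if "X \<in> measurable ?F S" for X and S :: "'x measure"
    using that by (rule measurable_info_mono) auto
  have q_past: "q j \<in> borel_measurable ?F" if "-1 \<le> j" "j < int l" for j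
  proof (cases "j = -1")
    case False
    then have "0 \<le> j"
      using that by simp
    then obtain k where k: "j = int k"
      by (rule nonneg_int_cases)
    then have "k < l" "k \<le> T"
      using that less.prems by simp_all
    then have "q j \<in> borel_measurable (info (int k) k)"
      unfolding k using less.IH[of k] by blast
    then show ?thesis
      by (rule measurable_info_mono) (use k \<open>k < l\<close> in auto)
  qed (simp add: q_init_info)
  have r_past: "r j \<in> borel_measurable ?F" if "j < l" for j
  proof -
    have "r j \<in> borel_measurable (info (int j + 1) j)"
      using less.IH[OF that] that less.prems by simp
    then show ?thesis
      by (rule measurable_info_mono) (use that in auto)
  qed
  have v: "v l \<in> borel_measurable ?F"
  proof (cases l)
    case 0
    then show ?thesis
      using v0_info[of 0 0] coupled_path.v_init[OF path] by (subst measurable_cong[of _ _ v0]) auto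
  next
    case (Suc k)
    have k: "k < l" "k \<le> T"
      using Suc less.prems by auto
    note past = less.IH[OF k]
    have mono: "X \<in> measurable ?F S" if "X \<in> measurable (info (int k) k) S \<or> X \<in> measurable (info (int k + 1) k) S"
      for X and S :: "'x measure"
      using that by (rule disjE; elim measurable_info_mono) (use Suc in auto)
    have "v (Suc k) \<in> borel_measurable ?F"
    proof (rule v_step_info[OF k(2)])
      show "z k \<in> borel_measurable ?F" "w (int k) \<in> borel_measurable ?F" "u k \<in> borel_measurable ?F"
        using past mono by blast+
      show "\<eta> k \<in> measurable ?F (restrict_space (param_space (ph k)) (\<Theta> k))"
        using eta_info mono by blast
      show "q j \<in> borel_measurable ?F" if "-1 \<le> j" "j \<le> int k" for j
        using that k by (intro q_past) auto
      show "g j \<in> borel_measurable ?F" if "-1 \<le> j" "j \<le> int k" for j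
        using that k by (intro g_info) auto
      show "r j \<in> borel_measurable ?F" if "j \<le> k" for j
        using that k by (intro r_past) auto
      show "s j \<in> borel_measurable ?F" if "j \<le> k" for j
        using that k by (intro s_info) auto
      show "y \<in> borel_measurable ?F"
        by (rule y_info) simp
    qed simp
    then show ?thesis
      using Suc by simp
  qed
  have z: "z l \<in> borel_measurable ?F"
    using measurable_entrywise(1)[OF xi_info v] coupled_path.z_eq[OF path]
    by (subst measurable_cong) auto
  have q: "q (int l) \<in> borel_measurable ?F"
  proof -
    have "(\<lambda>\<omega>. next_direction (\<kappa>Q l) {-1..<int l} (\<lambda>j. q j \<omega>) (z l \<omega>)) \<in> borel_measurable ?F"
      using ruleQ[of l] q_past z coupled_path.orthonormal_q_less[OF path] less.prems
      by (intro measurable_next_direction) (auto simp: completion_rule_def)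
    then show ?thesis
      using coupled_path.q_eq[OF path] by (subst measurable_cong) auto
  qed
  have u: "u l \<in> borel_measurable ?G"
  proof (rule u_step_info[OF less.prems])
    show "q j \<in> borel_measurable ?G" if "-1 \<le> j" "j \<le> int l" for j
      using that q q_past[of j] FG by (cases "j = int l") auto
    show "w (int l - 1) \<in> borel_measurable ?G"
    proof (cases l)
      case 0
      then show ?thesis
        using coupled_path.w_init[OF path] by (subst measurable_cong[of _ _ "\<lambda>_. 0"]) auto
    next
      case (Suc k)
      have "w (int k) \<in> borel_measurable (info (int k + 1) k)"
        using less.IH[of k] less.prems Suc by simp
      then have "w (int k) \<in> borel_measurable ?G"
        by (rule measurable_info_mono) (use Suc in auto)
      then show ?thesis
        using Suc by simp
    qed
  qed (use z v r_past xi_info FG in \<open>auto intro: g_info s_info\<close>)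
  have w: "w (int l) \<in> borel_measurable ?G"
    using measurable_entrywise2(1)[OF eta_info u y_info] coupled_path.w_eq[OF path]
    by (subst measurable_cong) auto
  have "(\<lambda>\<omega>. next_direction (\<kappa>R l) {..<l} (\<lambda>j. r j \<omega>) (w (int l) \<omega>)) \<in> borel_measurable ?G"
  proof (rule measurable_next_direction)
    show "\<kappa>R l \<in> borel_measurable (Pi\<^sub>M {..<l} (\<lambda>_. borel))"
      using ruleR[of l] unfolding completion_rule_def by blast
    show "r j \<in> borel_measurable ?G" if "j \<in> {..<l}" for j
      using r_past[of j] that by (intro FG) auto
    show "orthonormal_on {..<l} (\<lambda>j. r j \<omega>)" if "\<omega> \<in> space ?G" for \<omega>
      using coupled_path.orthonormal_r_less[OF path, of \<omega> l] that less.prems by simp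
  qed (simp_all add: w)
  moreover have "r l \<omega> = next_direction (\<kappa>R l) {..<l} (\<lambda>j. r j \<omega>) (w (int l) \<omega>)"
    if "\<omega> \<in> space ?G" for \<omega>
    using that by (intro coupled_path.r_eq[OF path]) simp
  ultimately have "r l \<in> borel_measurable ?G"
    by (rule measurable_cong[THEN iffD2, rotated])
  with u v w z q show ?case
    by simp
qed

lemma q_info:
  assumes "-1 \<le> j" "j \<le> int T" "j \<le> a" "nat j \<le> b"
  shows "q j \<in> borel_measurable (info a b)"
proof (cases "j = -1")
  case False
  then have "0 \<le> j"
    using assms by simp
  then obtain k where k: "j = int k"
    by (rule nonneg_int_cases)
  then have "q j \<in> borel_measurable (info (int k) k)"
    using assms iterates_info[of k] by simp
  then show ?thesis
    by (rule measurable_info_mono) (use k assms in auto)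
qed (simp add: q_init_info)

lemma r_info:
  assumes "j \<le> T" "int j < a" "j \<le> b"
  shows "r j \<in> borel_measurable (info a b)"
proof (rule measurable_info_mono)
  show "r j \<in> borel_measurable (info (int j + 1) j)"
    using iterates_info[OF assms(1)] by blast
qed (use assms in auto)

section \<open>Replacing one direction of the Gaussian matrix\<close>

abbreviation joint_space :: "((real^'d^'n) \<times> (real^'d) \<times> ('n \<Rightarrow> 'l) \<times> 'a) measure" where
  "joint_space \<equiv> borel \<Otimes>\<^sub>M borel \<Otimes>\<^sub>M link_space L \<Otimes>\<^sub>M A"

lemma W_meas: "W \<in> borel_measurable M" and W_distr: "distr M borel W = gauss (1 / sqrt CARD('d))"
  using gaussian_design_distr[OF prob_space_axioms W_law] by auto

lemma scaled_distr:
  fixes X :: "'o \<Rightarrow> real^'k"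
  assumes "iid_normal M 1 UNIV (\<lambda>i \<omega>. X \<omega> $ i)"
  shows "distr M borel (\<lambda>\<omega>. (1 / sqrt CARD('d)) *\<^sub>R X \<omega>) = gauss (1 / sqrt CARD('d))"
  using iid_normal_scale[OF prob_space_axioms assms, of "1 / sqrt CARD('d)"]
  by (intro vec_distr_eq_gauss(2)[OF prob_space_axioms]) simp_all

lemma indep_information:
  "J \<subseteq> sources \<Longrightarrow> K \<subseteq> sources \<Longrightarrow> J \<inter> K = {} \<Longrightarrow>
    indep_rv M (information M events_of J) (\<lambda>\<omega>. \<omega>) (information M events_of K) (\<lambda>\<omega>. \<omega>)"
  by (rule indep_rv_information[OF prob_space_axioms indep _ _ _ Int_stable_events_of])

lemma W_info: "Src_W \<in> I \<Longrightarrow> W \<in> borel_measurable (information M events_of I)"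
  by (rule measurable_source[where i = Src_W]) auto

text \<open>The exchange acts on the fresh vector and \<open>W\<close> together, so the pair has to
  be independent of the past and its law has to be a product. Both follow by grouping the sources,
  as neither \<open>i\<close> nor \<open>Src_W\<close> has been revealed.\<close>

lemma fresh_pair:
  fixes X :: "'o \<Rightarrow> real^'k"
  assumes i: "i \<in> sources" "i \<notin> revealed a b" "i \<noteq> Src_W"
    and X: "X \<in> borel_measurable (information M events_of {i})" "distr M borel X = gauss (1 / sqrt CARD('d))"
  shows fresh_pair_indep: "indep_rv M (info a b) (\<lambda>\<omega>. \<omega>) (borel \<Otimes>\<^sub>M borel) (\<lambda>\<omega>. (X \<omega>, W \<omega>))"
    and fresh_pair_distr: "distr M (borel \<Otimes>\<^sub>M borel) (\<lambda>\<omega>. (X \<omega>, W \<omega>)) = gauss (1 / sqrt CARD('d)) \<Otimes>\<^sub>M gauss (1 / sqrt CARD('d))"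
proof -
  have disj: "revealed a b \<inter> {i, Src_W} = {}"
    using i by (auto simp: revealed_def)
  have [measurable]: "X \<in> borel_measurable (information M events_of {i, Src_W})"
    "W \<in> borel_measurable (information M events_of {i, Src_W})"
    using measurable_information_mono[OF _ X(1)] W_info by auto
  have "(\<lambda>\<omega>. (X \<omega>, W \<omega>)) \<in> measurable (information M events_of {i, Src_W}) (borel \<Otimes>\<^sub>M borel)"
    by measurable
  from indep_rv_compose[OF prob_space_axioms indep_information measurable_ident this, of "revealed a b"]
  show "indep_rv M (info a b) (\<lambda>\<omega>. \<omega>) (borel \<Otimes>\<^sub>M borel) (\<lambda>\<omega>. (X \<omega>, W \<omega>))"
    using disj i revealed_subset by simp
  have XW: "indep_rv M borel X borel W"
    using indep_rv_compose[OF prob_space_axioms indep_information X(1) W_info, of "{Src_W}"] i by simp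
  show "distr M (borel \<Otimes>\<^sub>M borel) (\<lambda>\<omega>. (X \<omega>, W \<omega>)) = gauss (1 / sqrt CARD('d)) \<Otimes>\<^sub>M gauss (1 / sqrt CARD('d))"
    unfolding indep_rv_distr[OF prob_space_axioms XW] X(2) W_distr ..
qed

text \<open>Common form of the two kinds of step: \<open>A'\<close> is
  \<open>x \<mapsto> outer x q\<close> when a \<open>g\<close> is revealed and
  \<open>x \<mapsto> outer r x\<close> when an \<open>s\<close> is. Given the past, these maps are
  fixed and the exchange applies to the pair \<open>(X, W)\<close>. The known part, the projections,
  the initialisation and the seeds are functions of the past and stay frozen.\<close>

lemma resample_W:
  fixes X :: "'o \<Rightarrow> real^'k" and A' :: "'o \<Rightarrow> real^'k \<Rightarrow> real^'d^'n"
    and B' :: "'o \<Rightarrow> real^'d^'n \<Rightarrow> real^'k"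
  assumes i: "i \<in> sources" "i \<notin> revealed a b" "i \<noteq> Src_W"
    and X: "X \<in> borel_measurable (information M events_of {i})" "distr M borel X = gauss (1 / sqrt CARD('d))"
    and lin: "\<And>\<omega>. \<omega> \<in> space M \<Longrightarrow> linear (A' \<omega>)" "\<And>\<omega>. \<omega> \<in> space M \<Longrightarrow> linear (B' \<omega>)"
    and isom: "\<And>\<omega> y. \<omega> \<in> space M \<Longrightarrow> B' \<omega> (A' \<omega> y) = y"
    and adj: "\<And>\<omega> y x. \<omega> \<in> space M \<Longrightarrow> A' \<omega> y \<bullet> x = y \<bullet> B' \<omega> x"
    and meas: "(\<lambda>(\<omega>, y, x). x + A' \<omega> (y - B' \<omega> x)) \<in> borel_measurable (info a b \<Otimes>\<^sub>M borel \<Otimes>\<^sub>M borel)"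
    and C [measurable]: "C \<in> borel_measurable (info a b)"
    and P [measurable]: "P \<in> borel_measurable (info a b)"
    and Q [measurable]: "Q \<in> borel_measurable (info a b)"
  shows "distr M joint_space (\<lambda>\<omega>. (C \<omega> + P \<omega> ** (W \<omega> + A' \<omega> (X \<omega> - B' \<omega> (W \<omega>))) ** Q \<omega>, v0 \<omega>, el \<omega>, ea \<omega>)) =
    distr M joint_space (\<lambda>\<omega>. (C \<omega> + P \<omega> ** W \<omega> ** Q \<omega>, v0 \<omega>, el \<omega>, ea \<omega>))"
proof -
  note [measurable] = v0_info el_info ea_info
  have "indep_rv M (info a b) (\<lambda>\<omega>. \<omega>) borel W"
    using indep_rv_compose[OF prob_space_axioms fresh_pair_indep[OF i X] measurable_ident measurable_snd] by simp
  moreover have "distr (distr M (borel \<Otimes>\<^sub>M borel) (\<lambda>\<omega>. (X \<omega>, W \<omega>))) borel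
      (\<lambda>p. (\<lambda>(\<omega>, y, x). x + A' \<omega> (y - B' \<omega> x)) (\<omega>, p)) = distr M borel W"
    if "\<omega> \<in> space (info a b)" for \<omega>
    using that distr_gauss_exchange[of "1 / sqrt CARD('d)" "A' \<omega>" "B' \<omega>"] lin isom adj
    unfolding fresh_pair_distr[OF i X] W_distr by simp
  moreover have "(\<lambda>(\<omega>, x). (C \<omega> + P \<omega> ** x ** Q \<omega>, v0 \<omega>, el \<omega>, ea \<omega>))
      \<in> measurable (info a b \<Otimes>\<^sub>M borel) joint_space"
    by measurable
  ultimately show ?thesis
    using distr_resample[OF prob_space_axioms fresh_pair_indep[OF i X] _ meas, where X = W and N = joint_space
        and \<Phi> = "\<lambda>(\<omega>, x). (C \<omega> + P \<omega> ** x ** Q \<omega>, v0 \<omega>, el \<omega>, ea \<omega>)"]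
    by simp
qed

text \<open>
  \<open>stage a b\<close> is the matrix after \<open>g\<^sup>-\<^sup>1, \<dots>, g\<^sup>a\<^sup>-\<^sup>1\<close> and \<open>s\<^sup>0, \<dots>, s\<^sup>b\<^sup>-\<^sup>1\<close> have been revealed, so that
  \<open>stage (-1) 0\<close> is \<open>W\<close> and \<open>stage (t + 1) (t + 1)\<close> is the coupled matrix at time \<open>t\<close>.
\<close>

definition known_part :: "int \<Rightarrow> nat \<Rightarrow> 'o \<Rightarrow> real^'d^'n" where
  "known_part a b \<omega> =
     (\<Sum>l\<in>{-1..<a}. outer (RP (nat l) \<omega> *v ((1 / sqrt CARD('d)) *\<^sub>R g l \<omega>)) (q l \<omega>))
   + (\<Sum>l<b. outer (r l \<omega>) (QP (int l + 1) \<omega> *v ((1 / sqrt CARD('d)) *\<^sub>R s l \<omega>)))"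

definition stage :: "int \<Rightarrow> nat \<Rightarrow> 'o \<Rightarrow> real^'d^'n" where
  "stage a b \<omega> = known_part a b \<omega> + RP b \<omega> ** W \<omega> ** QP a \<omega>"

text \<open>The last two conditions keep \<open>(a, b)\<close> at positions of the revealing order:
  for \<open>b > 0\<close> they say that \<open>a\<close> is \<open>b\<close> or
  \<open>b + 1\<close>, and for \<open>b = 0\<close> they also admit \<open>a = -1\<close>, before
  the first \<open>g\<close>.\<close>

lemma known_part_info:
  assumes "a \<le> int T + 1" "b \<le> T + 1" "nat (a - 1) \<le> b" "b > 0 \<Longrightarrow> int b \<le> a"
  shows "known_part a b \<in> borel_measurable (info a b)"
    and "RP b \<in> borel_measurable (info a b)" and "QP a \<in> borel_measurable (info a b)"
proof -
  have q: "q j \<in> borel_measurable (info a b)" if "-1 \<le> j" "j < a" for j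
    using that assms by (intro q_info) auto
  have r: "r j \<in> borel_measurable (info a b)" if "j < b \<or> int j < a - 1" for j
    using that assms by (intro r_info) auto
  have "(\<lambda>\<omega>. outer (RP (nat l) \<omega> *v ((1 / sqrt CARD('d)) *\<^sub>R g l \<omega>)) (q l \<omega>))
      \<in> borel_measurable (info a b)" if l: "l \<in> {-1..<a}" for l
  proof -
    have [measurable]: "RP (nat l) \<in> borel_measurable (info a b)"
      using l by (intro measurable_RP r) auto
    have [measurable]: "g l \<in> borel_measurable (info a b)" "q l \<in> borel_measurable (info a b)"
      using l q g_info by auto
    show ?thesis
      by measurable
  qed
  moreover have "(\<lambda>\<omega>. outer (r l \<omega>) (QP (int l + 1) \<omega> *v ((1 / sqrt CARD('d)) *\<^sub>R s l \<omega>)))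
      \<in> borel_measurable (info a b)" if l: "l < b" for l
  proof -
    have [measurable]: "QP (int l + 1) \<in> borel_measurable (info a b)"
      using l assms by (intro measurable_QP q) auto
    have [measurable]: "s l \<in> borel_measurable (info a b)" "r l \<in> borel_measurable (info a b)"
      using l r s_info by auto
    show ?thesis
      by measurable
  qed
  ultimately show "known_part a b \<in> borel_measurable (info a b)"
    unfolding known_part_def[abs_def] by (intro borel_measurable_add borel_measurable_sum) auto
  show "RP b \<in> borel_measurable (info a b)" and "QP a \<in> borel_measurable (info a b)"
    using q r by (auto intro!: measurable_RP measurable_QP)
qed

lemma transpose_QP: "transpose (QP a \<omega>) = QP a \<omega>"
  by (simp add: QP_def linear_diff[OF linear_transpose] linear_sum[OF linear_transpose]
      transpose_outer)

lemma QP_q: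
  assumes "\<omega> \<in> space M" "-1 \<le> a" "a \<le> int T"
  shows "QP a \<omega> *v q a \<omega> = q a \<omega>"
proof -
  have "q i \<omega> \<bullet> q a \<omega> = 0" if "i \<in> {-1..<a}" for i
    using coupled_path.orthonormal_q[OF path[OF assms(1)]] assms that
    by (simp add: orthonormal_on_def)
  then show ?thesis
    by (simp add: QP_def matrix_vector_mult_diff_rdistrib linear_sum[OF linear_matrix_vector]
        outer_mult_vec)
qed

lemma RP_r:
  assumes "\<omega> \<in> space M" "b \<le> T"
  shows "RP b \<omega> *v r b \<omega> = r b \<omega>"
proof -
  have "r i \<omega> \<bullet> r b \<omega> = 0" if "i < b" for i
    using coupled_path.orthonormal_r[OF path[OF assms(1)]] assms that
    by (simp add: orthonormal_on_def)
  then show ?thesis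
    by (simp add: RP_def matrix_vector_mult_diff_rdistrib linear_sum[OF linear_matrix_vector]
        outer_mult_vec)
qed

lemma QP_Suc: "-1 \<le> a \<Longrightarrow> QP (a + 1) \<omega> = QP a \<omega> - outer (q a \<omega>) (q a \<omega>)"
proof -
  assume "-1 \<le> a"
  then have "{-1..<a + 1} = insert a {-1..<a}"
    by auto
  then show ?thesis
    by (simp add: QP_def algebra_simps)
qed

lemma RP_Suc: "RP (Suc b) \<omega> = RP b \<omega> - outer (r b \<omega>) (r b \<omega>)"
  by (simp add: RP_def algebra_simps)

text \<open>Revealing \<open>g a\<close> adds a rank-one term to the known part and removes
  \<open>q a\<close> from the right projection. Both changes amount to overwriting the value of
  \<open>W\<close> at \<open>q a\<close> before projecting, because the earlier projection fixes
  \<open>q a\<close>. The condition on \<open>b\<close> makes the projection attached to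
  \<open>g a\<close> the same as the one on the left of \<open>W\<close>, also for
  \<open>a = -1\<close>.\<close>

lemma stage_g:
  assumes \<omega>: "\<omega> \<in> space M" and a: "-1 \<le> a" "a \<le> int T" and b: "b = nat a"
  shows "stage (a + 1) b \<omega> = known_part a b \<omega> +
    RP b \<omega> ** (W \<omega> + outer ((1 / sqrt CARD('d)) *\<^sub>R g a \<omega> - W \<omega> *v q a \<omega>) (q a \<omega>)) ** QP a \<omega>"
proof -
  let ?x = "(1 / sqrt CARD('d)) *\<^sub>R g a \<omega>" and ?q = "q a \<omega>"
  have "{-1..<a + 1} = insert a {-1..<a}"
    using a by auto
  then have "known_part (a + 1) b \<omega> = known_part a b \<omega> + outer (RP b \<omega> *v ?x) ?q"
    by (simp add: known_part_def b)
  moreover have "RP b \<omega> ** W \<omega> ** QP (a + 1) \<omega> =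
      RP b \<omega> ** W \<omega> ** QP a \<omega> - outer (RP b \<omega> *v (W \<omega> *v ?q)) ?q"
    by (simp add: QP_Suc[OF a(1)] matrix_diff_ldistrib mult_outer matrix_vector_mul_assoc)
  moreover have "RP b \<omega> ** outer (?x - W \<omega> *v ?q) ?q ** QP a \<omega> =
      outer (RP b \<omega> *v ?x) ?q - outer (RP b \<omega> *v (W \<omega> *v ?q)) ?q"
    by (simp add: mult_outer outer_mult transpose_QP QP_q[OF \<omega> a] matrix_vector_mult_diff_distrib
        linear_diff[OF linear_outer1] matrix_diff_ldistrib matrix_diff_rdistrib del: transpose_matrix_vector)
  ultimately show ?thesis
    by (simp add: stage_def matrix_add_ldistrib matrix_add_rdistrib)
qed

text \<open>The mirror image on the left: \<open>RP b\<close> fixes \<open>r b\<close>, and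
  \<open>a = int b + 1\<close> makes the projection attached to \<open>s b\<close> the one on the
  right of \<open>W\<close>.\<close>

lemma stage_s:
  assumes \<omega>: "\<omega> \<in> space M" and b: "b \<le> T" and a: "a = int b + 1"
  shows "stage a (Suc b) \<omega> = known_part a b \<omega> +
    RP b \<omega> ** (W \<omega> + outer (r b \<omega>) ((1 / sqrt CARD('d)) *\<^sub>R s b \<omega> - transpose (W \<omega>) *v r b \<omega>)) ** QP a \<omega>"
proof -
  let ?x = "(1 / sqrt CARD('d)) *\<^sub>R s b \<omega>" and ?r = "r b \<omega>"
  have "known_part a (Suc b) \<omega> = known_part a b \<omega> + outer ?r (QP a \<omega> *v ?x)"
    by (simp add: known_part_def a)
  moreover have "RP (Suc b) \<omega> ** W \<omega> ** QP a \<omega> =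
      RP b \<omega> ** W \<omega> ** QP a \<omega> - outer ?r (QP a \<omega> *v (transpose (W \<omega>) *v ?r))"
    by (simp add: RP_Suc matrix_diff_rdistrib outer_mult transpose_QP del: transpose_matrix_vector)
  moreover have "RP b \<omega> ** outer ?r (?x - transpose (W \<omega>) *v ?r) ** QP a \<omega> =
      outer ?r (QP a \<omega> *v ?x) - outer ?r (QP a \<omega> *v (transpose (W \<omega>) *v ?r))"
    by (simp add: mult_outer outer_mult transpose_QP RP_r[OF \<omega> b] matrix_vector_mult_diff_distrib
        linear_diff[OF linear_outer2] matrix_diff_ldistrib matrix_diff_rdistrib del: transpose_matrix_vector)
  ultimately show ?thesis
    by (simp add: stage_def matrix_add_ldistrib matrix_add_rdistrib del: transpose_matrix_vector)
qed

text \<open>The response is left out on purpose. It is restored at the end as a function of the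
  matrix and the link seed, so these components are all that has to be followed through the
  replacements.\<close>

abbreviation joint_law :: "('o \<Rightarrow> real^'d^'n) \<Rightarrow> ((real^'d^'n) \<times> (real^'d) \<times> ('n \<Rightarrow> 'l) \<times> 'a) measure" where
  "joint_law X \<equiv> distr M joint_space (\<lambda>\<omega>. (X \<omega>, v0 \<omega>, el \<omega>, ea \<omega>))"

lemma joint_law_cong: "(\<And>\<omega>. \<omega> \<in> space M \<Longrightarrow> X \<omega> = Y \<omega>) \<Longrightarrow> joint_law X = joint_law Y"
  by (intro distr_cong) auto

text \<open>With \<open>b = nat a\<close> all sources that determine \<open>q a\<close> have been
  revealed and \<open>g a\<close> has not. The unit length of \<open>q a\<close> makes the embedding
  isometric.\<close>

lemma joint_law_stage_g:
  assumes a: "-1 \<le> a" "a \<le> int T" and b: "b = nat a"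
  shows "joint_law (stage (a + 1) b) = joint_law (stage a b)"
proof -
  let ?X = "\<lambda>\<omega>. (1 / sqrt CARD('d)) *\<^sub>R g a \<omega>"
  have [measurable]: "q a \<in> borel_measurable (info a b)"
    using a b by (intro q_info) auto
  have [measurable]: "g a \<in> borel_measurable (information M events_of {Src_g a})"
    by (rule measurable_source[where i = "Src_g a"]) auto
  have "joint_law (\<lambda>\<omega>. known_part a b \<omega> + RP b \<omega> ** (W \<omega> + outer (?X \<omega> - W \<omega> *v q a \<omega>) (q a \<omega>)) ** QP a \<omega>) =
    joint_law (\<lambda>\<omega>. known_part a b \<omega> + RP b \<omega> ** W \<omega> ** QP a \<omega>)"
  proof (rule resample_W[where i = "Src_g a" and a = a and b = b and X = ?X
        and A' = "\<lambda>\<omega> x. outer x (q a \<omega>)" and B' = "\<lambda>\<omega> x. x *v q a \<omega>"])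
    fix \<omega> assume "\<omega> \<in> space M"
    then have "q a \<omega> \<bullet> q a \<omega> = 1"
      using coupled_path.orthonormal_q[OF path] a by (simp add: orthonormal_on_def)
    then show "outer x (q a \<omega>) *v q a \<omega> = x" for x :: "real^'n"
      by (simp add: outer_mult_vec)
  next
    show "distr M borel ?X = gauss (1 / sqrt CARD('d))"
      using a by (intro scaled_distr g_law)
    show "known_part a b \<in> borel_measurable (info a b)" "RP b \<in> borel_measurable (info a b)"
      "QP a \<in> borel_measurable (info a b)"
      using a b by (auto intro!: known_part_info)
    show "(\<lambda>(\<omega>, y, x). x + outer (y - x *v q a \<omega>) (q a \<omega>))
        \<in> borel_measurable (info a b \<Otimes>\<^sub>M borel \<Otimes>\<^sub>M borel)"
      by measurable
    show "?X \<in> borel_measurable (information M events_of {Src_g a})"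
      by measurable
  qed (use a in \<open>auto simp: revealed_def linear_outer1 linear_matrix_vector outer_inner\<close>)
  then show ?thesis
    using joint_law_cong[OF stage_g[OF _ a b]] joint_law_cong[OF stage_def] by simp
qed

text \<open>At \<open>a = int b + 1\<close> the vector \<open>g b\<close> has been revealed, which
  determines \<open>r b\<close>, while \<open>s b\<close> is still fresh.\<close>

lemma joint_law_stage_s:
  assumes b: "b \<le> T" and a: "a = int b + 1"
  shows "joint_law (stage a (Suc b)) = joint_law (stage a b)"
proof -
  let ?X = "\<lambda>\<omega>. (1 / sqrt CARD('d)) *\<^sub>R s b \<omega>"
  have [measurable]: "r b \<in> borel_measurable (info a b)"
    using a b by (intro r_info) auto
  have [measurable]: "s b \<in> borel_measurable (information M events_of {Src_s b})"
    by (rule measurable_source[where i = "Src_s b"]) auto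
  have "joint_law (\<lambda>\<omega>. known_part a b \<omega> +
      RP b \<omega> ** (W \<omega> + outer (r b \<omega>) (?X \<omega> - transpose (W \<omega>) *v r b \<omega>)) ** QP a \<omega>) =
    joint_law (\<lambda>\<omega>. known_part a b \<omega> + RP b \<omega> ** W \<omega> ** QP a \<omega>)"
  proof (rule resample_W[where i = "Src_s b" and a = a and b = b and X = ?X
        and A' = "\<lambda>\<omega> x. outer (r b \<omega>) x" and B' = "\<lambda>\<omega> x. transpose x *v r b \<omega>"])
    fix \<omega> assume "\<omega> \<in> space M"
    then have "r b \<omega> \<bullet> r b \<omega> = 1"
      using coupled_path.orthonormal_r[OF path] b by (simp add: orthonormal_on_def)
    then show "transpose (outer (r b \<omega>) x) *v r b \<omega> = x" for x :: "real^'d"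
      by (simp add: outer_mult_vec transpose_outer del: transpose_matrix_vector)
    show "outer (r b \<omega>) y \<bullet> x = y \<bullet> (transpose x *v r b \<omega>)" for y x
      using dot_lmul_matrix[of "r b \<omega>" x y] by (simp add: outer_inner inner_commute[of y])
  next
    show "distr M borel ?X = gauss (1 / sqrt CARD('d))"
      by (intro scaled_distr s_law)
    show "known_part a b \<in> borel_measurable (info a b)" "RP b \<in> borel_measurable (info a b)"
      "QP a \<in> borel_measurable (info a b)"
      using a b by (auto intro!: known_part_info)
    show "(\<lambda>(\<omega>, y, x). x + outer (r b \<omega>) (y - transpose x *v r b \<omega>))
        \<in> borel_measurable (info a b \<Otimes>\<^sub>M borel \<Otimes>\<^sub>M borel)"
      by measurable
    show "?X \<in> borel_measurable (information M events_of {Src_s b})"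
      by measurable
  qed (auto simp: revealed_def linear_outer2 linear_transpose_mult simp del: transpose_matrix_vector)
  then show ?thesis
    using joint_law_cong[OF stage_s[OF _ b a]] joint_law_cong[OF stage_def] by simp
qed

lemma joint_law_stage: "b \<le> T + 1 \<Longrightarrow> joint_law (stage (int b) b) = joint_law W"
proof (induction b)
  case 0
  have "stage (-1) 0 \<omega> = W \<omega>" for \<omega>
    by (simp add: stage_def known_part_def RP_def QP_def)
  then show ?case
    \<comment> \<open>The vector \<open>g (-1)\<close> has no partner among the \<open>s\<close>, so
      it is consumed here; afterwards each round reveals one \<open>g\<close> and then one
      \<open>s\<close>.\<close>
    using joint_law_stage_g[of "-1" 0] joint_law_cong[of "stage (-1) 0" W] by simp
next
  case (Suc b)
  then show ?case
    using joint_law_stage_g[of "int b" b] joint_law_stage_s[of b "int b + 1"]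
    by (simp add: add.commute)
qed

lemma coupled_matrix_stage:
  assumes \<omega>: "\<omega> \<in> space M"
  shows "coupled_matrix (\<lambda>j. g j \<omega>) (\<lambda>j. s j \<omega>) (W \<omega>) (\<lambda>j. r j \<omega>) (\<lambda>j. q j \<omega>) T =
    stage (int (T + 1)) (T + 1) \<omega>"
proof -
  have "{-1..<int (T + 1)} = {-1..int T}" "{..<T + 1} = {..T}"
    by auto
  moreover have "nat (int T + 1) = T + 1" "int (T + 1) = int T + 1"
    by simp_all
  ultimately show ?thesis
    unfolding coupled_path.coupled_matrix_eq[OF path[OF \<omega>]] stage_def known_part_def
    using \<omega> by (simp add: perp_R_RP perp_Q_QP matrix_vector_mult_scaleR
        linear_scale[OF linear_outer1] linear_scale[OF linear_outer2] add.commute[of 1 "int T"])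
qed

section \<open>Independence and comparison with the single-index model\<close>

lemma W_indep: "indep_rv M borel W (borel \<Otimes>\<^sub>M link_space L \<Otimes>\<^sub>M A) (\<lambda>\<omega>. (v0 \<omega>, el \<omega>, ea \<omega>))"
proof -
  note [measurable] = v0_info[of "-1" 0] el_info[of "-1" 0] ea_info[of "-1" 0]
  have meas: "(\<lambda>\<omega>. (v0 \<omega>, el \<omega>, ea \<omega>)) \<in> measurable (info (-1) 0) (borel \<Otimes>\<^sub>M link_space L \<Otimes>\<^sub>M A)"
    by measurable
  have ind: "indep_rv M (information M events_of {Src_W}) (\<lambda>\<omega>. \<omega>) (info (-1) 0) (\<lambda>\<omega>. \<omega>)"
    using revealed_subset[of "-1" 0] by (intro indep_information) (auto simp: revealed_def)
  show ?thesis
    by (rule indep_rv_compose[OF prob_space_axioms ind W_info meas]) simp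
qed

lemma v0_indep: "indep_rv M borel v0 (link_space L \<Otimes>\<^sub>M A) (\<lambda>\<omega>. (el \<omega>, ea \<omega>))"
proof -
  have v0: "v0 \<in> borel_measurable (information M events_of {Src_init})"
    by (rule measurable_source[where i = Src_init]) auto
  have seeds: "(\<lambda>\<omega>. (el \<omega>, ea \<omega>))
      \<in> measurable (information M events_of {Src_seeds}) (link_space L \<Otimes>\<^sub>M A)"
    using measurable_space[OF el_meas] measurable_space[OF ea_meas]
    by (intro measurable_source[where i = Src_seeds]) (auto simp: space_pair_measure)
  have ind: "indep_rv M (information M events_of {Src_init}) (\<lambda>\<omega>. \<omega>)
      (information M events_of {Src_seeds}) (\<lambda>\<omega>. \<omega>)"
    by (intro indep_information) auto
  show ?thesis
    by (rule indep_rv_compose[OF prob_space_axioms ind v0 seeds])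
qed

definition Xc :: "'o \<Rightarrow> real^'d^'n" where
  "Xc \<omega> = coupled_matrix (\<lambda>j. g j \<omega>) (\<lambda>j. s j \<omega>) (W \<omega>) (\<lambda>j. r j \<omega>) (\<lambda>j. q j \<omega>) T"

lemma Xc_meas: "Xc \<in> borel_measurable M"
proof -
  have "stage (int (T + 1)) (T + 1) \<in> borel_measurable M"
  proof -
    have "known_part (int (T + 1)) (T + 1) \<in> borel_measurable (info (int (T + 1)) (T + 1))"
      "RP (T + 1) \<in> borel_measurable (info (int (T + 1)) (T + 1))"
      "QP (int (T + 1)) \<in> borel_measurable (info (int (T + 1)) (T + 1))"
      by (intro known_part_info; simp)+
    then have [measurable]: "known_part (int (T + 1)) (T + 1) \<in> borel_measurable M"
      "RP (T + 1) \<in> borel_measurable M" "QP (int (T + 1)) \<in> borel_measurable M"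
      by (auto intro: measurable_info)
    note [measurable] = W_meas
    show ?thesis
      unfolding stage_def[abs_def] by measurable
  qed
  then show ?thesis
    by (subst measurable_cong[where g = "stage (int (T + 1)) (T + 1)"])
      (simp_all add: Xc_def coupled_matrix_stage del: of_nat_Suc of_nat_add)
qed

lemma joint_law_Xc: "joint_law Xc = joint_law W"
  using joint_law_stage[of "T + 1"] joint_law_cong[of Xc "stage (int (T + 1)) (T + 1)"]
  by (simp add: Xc_def coupled_matrix_stage del: of_nat_Suc of_nat_add)

lemma Xc_distr: "distr M borel Xc = gauss (1 / sqrt CARD('d))"
proof -
  note [measurable] = Xc_meas W_meas v0_meas el_meas ea_meas
  have "distr M borel Xc = distr (joint_law Xc) borel fst"
    by (subst distr_distr) (auto simp: comp_def)
  also have "\<dots> = distr M borel W"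
    unfolding joint_law_Xc by (subst distr_distr) (auto simp: comp_def)
  finally show ?thesis
    by (simp add: W_distr)
qed

text \<open>Independence is a property of the joint law, and this law is the one in which
  \<open>W\<close> stands in place of the coupled matrix.\<close>

lemma Xc_indep: "indep_rv M borel Xc (borel \<Otimes>\<^sub>M link_space L \<Otimes>\<^sub>M A) (\<lambda>\<omega>. (v0 \<omega>, el \<omega>, ea \<omega>))"
  unfolding indep_rv_iff_distr[OF prob_space_axioms Xc_meas indep_rv_measurable(2)[OF W_indep]]
    joint_law_Xc indep_rv_distr[OF prob_space_axioms W_indep] W_distr Xc_distr ..

lemma y_eq: "\<omega> \<in> space M \<Longrightarrow> y \<omega> = entrywise2 \<phi> (Xc \<omega> *v \<theta>) (el \<omega>)"
  by (simp add: Xc_def y_def coupled_path.coupled_matrix_theta[OF path])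

lemma measurable_response [measurable (raw)]:
  assumes [measurable]: "X \<in> borel_measurable F" and e [measurable]: "e \<in> measurable F (link_space L)"
  shows "(\<lambda>\<omega>. entrywise2 \<phi> (X \<omega> *v \<theta>) (e \<omega>)) \<in> borel_measurable F"
proof (rule measurable_vecI)
  fix i
  have "(\<lambda>\<omega>. (\<lambda>(x, e). \<phi> x e) ((X \<omega> *v \<theta>) $ i, e \<omega> i)) \<in> borel_measurable F"
    by (rule measurable_compose[OF _ phi_meas]) measurable
  then show "(\<lambda>\<omega>. entrywise2 \<phi> (X \<omega> *v \<theta>) (e \<omega>) $ i) \<in> borel_measurable F"
    by (simp add: entrywise2_def)
qed

text \<open>On both probability spaces the matrix and the remaining inputs have the same product
  law, and the response is the same measurable function of them. So both sides are images of one
  measure under one map.\<close>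

lemma model_law:
  fixes M' :: "'b measure"
  assumes M': "prob_space M'" and X: "gaussian_design M' X"
    and ind: "indep_rv M' borel X (borel \<Otimes>\<^sub>M link_space L \<Otimes>\<^sub>M A) (\<lambda>\<omega>. (v0' \<omega>, el' \<omega>, ea' \<omega>))"
    and law: "distr M' (borel \<Otimes>\<^sub>M link_space L \<Otimes>\<^sub>M A) (\<lambda>\<omega>. (v0' \<omega>, el' \<omega>, ea' \<omega>)) =
      distr M (borel \<Otimes>\<^sub>M link_space L \<Otimes>\<^sub>M A) (\<lambda>\<omega>. (v0 \<omega>, el \<omega>, ea \<omega>))"
    and y': "\<And>\<omega>. \<omega> \<in> space M' \<Longrightarrow> y' \<omega> = entrywise2 \<phi> (X \<omega> *v \<theta>) (el' \<omega>)"
  shows "distr M (borel \<Otimes>\<^sub>M borel \<Otimes>\<^sub>M borel \<Otimes>\<^sub>M link_space L \<Otimes>\<^sub>M A)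
      (\<lambda>\<omega>. (Xc \<omega>, y \<omega>, v0 \<omega>, el \<omega>, ea \<omega>)) =
    distr M' (borel \<Otimes>\<^sub>M borel \<Otimes>\<^sub>M borel \<Otimes>\<^sub>M link_space L \<Otimes>\<^sub>M A)
      (\<lambda>\<omega>. (X \<omega>, y' \<omega>, v0' \<omega>, el' \<omega>, ea' \<omega>))"
    (is "distr M ?N _ = _")
proof -
  let ?J = "joint_space"
  \<comment> \<open>The map that inserts the response into a tuple of matrix, initialisation and
    seeds.\<close>
  let ?\<Psi> = "\<lambda>(x, v, e, a). (x, entrywise2 \<phi> (x *v \<theta>) e, v, e, a)"
  have \<Psi>: "?\<Psi> \<in> measurable ?J ?N"
    by measurable
  have meas: "(\<lambda>\<omega>. (X \<omega>, v0' \<omega>, el' \<omega>, ea' \<omega>)) \<in> measurable M' ?J"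
    "(\<lambda>\<omega>. (Xc \<omega>, v0 \<omega>, el \<omega>, ea \<omega>)) \<in> measurable M ?J"
    using indep_rv_measurable[OF ind] indep_rv_measurable[OF Xc_indep] by (auto intro: measurable_Pair)
  have "joint_law Xc = distr M' ?J (\<lambda>\<omega>. (X \<omega>, v0' \<omega>, el' \<omega>, ea' \<omega>))"
    unfolding indep_rv_distr[OF prob_space_axioms Xc_indep] indep_rv_distr[OF M' ind] law Xc_distr
      gaussian_design_distr(2)[OF M' X] ..
  then have "distr (joint_law Xc) ?N ?\<Psi> = distr (distr M' ?J (\<lambda>\<omega>. (X \<omega>, v0' \<omega>, el' \<omega>, ea' \<omega>))) ?N ?\<Psi>"
    by simp
  then have "distr M ?N (\<lambda>\<omega>. ?\<Psi> (Xc \<omega>, v0 \<omega>, el \<omega>, ea \<omega>)) = distr M' ?N (\<lambda>\<omega>. ?\<Psi> (X \<omega>, v0' \<omega>, el' \<omega>, ea' \<omega>))"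
    by (simp add: distr_distr[OF \<Psi> meas(1)] distr_distr[OF \<Psi> meas(2)] comp_def)
  moreover have "distr M ?N (\<lambda>\<omega>. (Xc \<omega>, y \<omega>, v0 \<omega>, el \<omega>, ea \<omega>)) = distr M ?N (\<lambda>\<omega>. ?\<Psi> (Xc \<omega>, v0 \<omega>, el \<omega>, ea \<omega>))"
    by (intro distr_cong) (auto simp: y_eq)
  moreover have "distr M' ?N (\<lambda>\<omega>. (X \<omega>, y' \<omega>, v0' \<omega>, el' \<omega>, ea' \<omega>)) =
      distr M' ?N (\<lambda>\<omega>. ?\<Psi> (X \<omega>, v0' \<omega>, el' \<omega>, ea' \<omega>))"
    by (intro distr_cong) (auto simp: y')
  ultimately show ?thesis
    by simp
qed

lemma indep_rv_response:
  assumes ind: "indep_rv M S V (borel \<Otimes>\<^sub>M link_space L) (\<lambda>\<omega>. (Xc \<omega>, el \<omega>))"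
  shows "indep_rv M S V (borel \<Otimes>\<^sub>M borel) (\<lambda>\<omega>. (Xc \<omega>, y \<omega>))"
proof -
  have "(\<lambda>(x, e). (x, entrywise2 \<phi> (x *v \<theta>) e)) \<in> measurable (borel \<Otimes>\<^sub>M link_space L) (borel \<Otimes>\<^sub>M borel)"
    by measurable
  from indep_rv_compose[OF prob_space_axioms ind measurable_ident this]
  have *: "indep_rv M S V (borel \<Otimes>\<^sub>M borel) (\<lambda>\<omega>. (Xc \<omega>, entrywise2 \<phi> (Xc \<omega> *v \<theta>) (el \<omega>)))"
    by simp
  have "(\<lambda>\<omega>. (Xc \<omega>, y \<omega>)) \<in> measurable M (borel \<Otimes>\<^sub>M borel)"
    using indep_rv_measurable(2)[OF *] by (subst measurable_cong) (auto simp: y_eq)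
  \<comment> \<open>The response agrees with its formula only on \<open>space M\<close>, so
    independence is transferred through preimages intersected with that space.\<close>
  moreover have "(\<lambda>\<omega>. (Xc \<omega>, entrywise2 \<phi> (Xc \<omega> *v \<theta>) (el \<omega>))) -` B \<inter> space M =
      (\<lambda>\<omega>. (Xc \<omega>, y \<omega>)) -` B \<inter> space M" for B
    by (auto simp: y_eq)
  ultimately show ?thesis
    using * indep_rv_measurable[OF *] by (simp add: indep_rv_iff[OF prob_space_axioms])
qed

lemma v0_indep_model: "indep_rv M borel v0 (borel \<Otimes>\<^sub>M borel) (\<lambda>\<omega>. (Xc \<omega>, y \<omega>))"
proof (rule indep_rv_response)
  have ind: "indep_rv M borel v0 (borel \<Otimes>\<^sub>M link_space L \<Otimes>\<^sub>M A) (\<lambda>\<omega>. (Xc \<omega>, el \<omega>, ea \<omega>))"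
    by (rule indep_rv_exchange[OF prob_space_axioms Xc_indep v0_indep])
  have meas: "(\<lambda>(x, e, a). (x, e)) \<in> measurable (borel \<Otimes>\<^sub>M link_space L \<Otimes>\<^sub>M A) (borel \<Otimes>\<^sub>M link_space L)"
    by measurable
  from indep_rv_compose[OF prob_space_axioms ind measurable_ident meas]
  show "indep_rv M borel v0 (borel \<Otimes>\<^sub>M link_space L) (\<lambda>\<omega>. (Xc \<omega>, el \<omega>))"
    by simp
qed

text \<open>The response contains the link seed, hence the assumption that the two seeds are
  independent of each other. Two exchanges follow: the first frees the link seed from the
  initialisation and the algorithmic seed, the second treats these two as one variable and frees it
  from the matrix and the link seed.\<close>

lemma v0_ea_indep_model:
  assumes "indep_rv M (link_space L) el A ea"
  shows "indep_rv M (borel \<Otimes>\<^sub>M A) (\<lambda>\<omega>. (v0 \<omega>, ea \<omega>)) (borel \<Otimes>\<^sub>M borel) (\<lambda>\<omega>. (Xc \<omega>, y \<omega>))"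
proof (rule indep_rv_response)
  have "indep_rv M (link_space L) el (borel \<Otimes>\<^sub>M A) (\<lambda>\<omega>. (v0 \<omega>, ea \<omega>))"
    by (rule indep_rv_exchange[OF prob_space_axioms v0_indep assms])
  then have "indep_rv M (borel \<Otimes>\<^sub>M A) (\<lambda>\<omega>. (v0 \<omega>, ea \<omega>)) (link_space L) el"
    by (rule indep_rv_sym[OF prob_space_axioms])
  moreover have "indep_rv M borel Xc ((borel \<Otimes>\<^sub>M A) \<Otimes>\<^sub>M link_space L) (\<lambda>\<omega>. ((v0 \<omega>, ea \<omega>), el \<omega>))"
  proof -
    have "(\<lambda>(v, e, a). ((v, a), e))
        \<in> measurable (borel \<Otimes>\<^sub>M link_space L \<Otimes>\<^sub>M A) ((borel \<Otimes>\<^sub>M A) \<Otimes>\<^sub>M link_space L)"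
      by measurable
    from indep_rv_compose[OF prob_space_axioms Xc_indep measurable_ident this] show ?thesis
      by simp
  qed
  ultimately show "indep_rv M (borel \<Otimes>\<^sub>M A) (\<lambda>\<omega>. (v0 \<omega>, ea \<omega>)) (borel \<Otimes>\<^sub>M link_space L) (\<lambda>\<omega>. (Xc \<omega>, el \<omega>))"
    by (rule indep_rv_exchange[OF prob_space_axioms, rotated])
qed

end

theorem lemma3p1:
  fixes M :: "'o measure" and L :: "'l measure" and A :: "'a measure"
    and \<theta> :: "real^'d"
    and \<phi> :: "real \<Rightarrow> 'l \<Rightarrow> real"
    and v0 :: "'o \<Rightarrow> real^'d"
    and g :: "int \<Rightarrow> 'o \<Rightarrow> real^'n" and s :: "nat \<Rightarrow> 'o \<Rightarrow> real^'d"
    and W :: "'o \<Rightarrow> real^'d^'n"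
    and el :: "'o \<Rightarrow> 'n \<Rightarrow> 'l" and ea :: "'o \<Rightarrow> 'a"
    and y :: "'o \<Rightarrow> real^'n"
    and Cpar :: nat
    and pf ph :: "nat \<Rightarrow> nat"
    and \<Xi> \<Theta> :: "nat \<Rightarrow> (nat \<Rightarrow> real) set"
    and f :: "nat \<Rightarrow> real \<Rightarrow> (nat \<Rightarrow> real) \<Rightarrow> real"
    and h :: "nat \<Rightarrow> real \<Rightarrow> real \<Rightarrow> (nat \<Rightarrow> real) \<Rightarrow> real"
    and \<xi> \<eta> :: "nat \<Rightarrow> 'o \<Rightarrow> nat \<Rightarrow> real"
    and \<kappa>R :: "nat \<Rightarrow> (nat \<Rightarrow> real^'n) \<Rightarrow> real^'n"
    and \<kappa>Q :: "nat \<Rightarrow> (int \<Rightarrow> real^'d) \<Rightarrow> real^'d"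
    and u r :: "nat \<Rightarrow> 'o \<Rightarrow> real^'n" and w :: "int \<Rightarrow> 'o \<Rightarrow> real^'n"
    and v z :: "nat \<Rightarrow> 'o \<Rightarrow> real^'d" and q :: "int \<Rightarrow> 'o \<Rightarrow> real^'d"
    and Xc :: "nat \<Rightarrow> 'o \<Rightarrow> real^'d^'n"
  assumes M: "prob_space M"
    and theta: "norm \<theta> = sqrt (real CARD('d))"
    \<comment> \<open>the sources of randomness\<close>
    and v0_meas: "v0 \<in> borel_measurable M"
    and el_meas: "el \<in> measurable M (link_space L)" and ea_meas: "ea \<in> measurable M A"
    and g_law: "\<And>j. j \<ge> -1 \<Longrightarrow> iid_normal M 1 UNIV (\<lambda>i \<omega>. g j \<omega> $ i)"
    and s_law: "\<And>j. iid_normal M 1 UNIV (\<lambda>i \<omega>. s j \<omega> $ i)"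
    and W_law: "gaussian_design M W"
    and indep: "prob_space.indep_sets M (source_events M L A v0 g s W el ea)
           ({Src_init, Src_W, Src_seeds} \<union> Src_g ` {-1..} \<union> range Src_s)"
    \<comment> \<open>the response\<close>
    and phi_meas: "(\<lambda>(x, e). \<phi> x e) \<in> borel_measurable (borel \<Otimes>\<^sub>M L)"
    and y_def: "\<And>\<omega>. \<omega> \<in> space M \<Longrightarrow> y \<omega> = entrywise2 \<phi> (g (-1) \<omega>) (el \<omega>)"
    and Cpar: "Cpar \<ge> 1"
    and y_bound: "measure M {\<omega> \<in> space M. (MAX i. \<bar>y \<omega> $ i\<bar>) > real CARD('n) ^ Cpar}
           \<le> 1 / real CARD('n) ^ 20"
    \<comment> \<open>the parametrised nonlinearities\<close>
    and par_dim: "\<And>t. (\<Sum>k\<le>t + 1. pf k + ph k) \<le> Cpar * (t + 2)"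
    and Xi_sub: "\<And>k. \<Xi> k \<subseteq> space (param_space (pf k))"
    and Theta_sub: "\<And>k. \<Theta> k \<subseteq> space (param_space (ph k))"
    and f_meas: "\<And>k. (\<lambda>(x, p). f k x p) \<in>
           borel_measurable (borel \<Otimes>\<^sub>M restrict_space (param_space (pf k)) (\<Xi> k))"
    and h_meas: "\<And>k. (\<lambda>(x, b, p). h k x b p) \<in>
           borel_measurable (borel \<Otimes>\<^sub>M borel \<Otimes>\<^sub>M restrict_space (param_space (ph k)) (\<Theta> k))"
    and f_reg: "\<And>k. regular_in_param (pf k) (\<Xi> k) (real CARD('n) ^ 6)
           (\<lambda>x. real CARD('n) ^ Cpar * (1 + \<bar>x\<bar> ^ Cpar)) (f k)"
    and h_reg: "\<And>k b. regular_in_param (ph k) (\<Theta> k) (real CARD('n) ^ 6)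
           (\<lambda>x. real CARD('n) ^ Cpar * (1 + \<bar>x\<bar> ^ Cpar + \<bar>b\<bar> ^ Cpar)) (\<lambda>x. h k x b)"
    \<comment> \<open>the random parameters and their predictability\<close>
    and xi_in: "\<And>k \<omega>. \<omega> \<in> space M \<Longrightarrow> \<xi> k \<omega> \<in> \<Xi> k"
    and eta_in: "\<And>k \<omega>. \<omega> \<in> space M \<Longrightarrow> \<eta> k \<omega> \<in> \<Theta> k"
    and xi0: "\<xi> 0 \<in> measurable
           (information M (source_events M L A v0 g s W el ea) {Src_init, Src_alg})
           (param_space (pf 0))"
    and eta: "\<And>l. \<eta> l \<in> measurable
           (information M (source_events M L A v0 g s W el ea)
              ({Src_seeds, Src_init} \<union> Src_g ` {-1..int l} \<union> Src_s ` {..<l}))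
           (param_space (ph l))"
    and xi_Suc: "\<And>l. \<xi> (Suc l) \<in> measurable
           (information M (source_events M L A v0 g s W el ea)
              ({Src_seeds, Src_init} \<union> Src_g ` {-1..int l} \<union> Src_s ` {..l}))
           (param_space (pf (Suc l)))"
    \<comment> \<open>the construction\<close>
    and ruleR: "\<And>l. completion_rule {..<l} (\<kappa>R l)"
    and ruleQ: "\<And>l. completion_rule {-1..<int l} (\<kappa>Q l)"
    and constr: "\<And>\<omega>. \<omega> \<in> space M \<Longrightarrow>
           coupled_iterates \<theta> \<kappa>R \<kappa>Q (\<lambda>k x. f k x (\<xi> k \<omega>)) (\<lambda>k x b. h k x b (\<eta> k \<omega>))
             (\<lambda>j. g j \<omega>) (\<lambda>j. s j \<omega>) (y \<omega>) (v0 \<omega>)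
             (\<lambda>j. u j \<omega>) (\<lambda>j. v j \<omega>) (\<lambda>j. w j \<omega>) (\<lambda>j. z j \<omega>) (\<lambda>j. r j \<omega>) (\<lambda>j. q j \<omega>)"
    and Xc_def: "\<And>t \<omega>. Xc t \<omega> = coupled_matrix (\<lambda>j. g j \<omega>) (\<lambda>j. s j \<omega>) (W \<omega>)
           (\<lambda>j. r j \<omega>) (\<lambda>j. q j \<omega>) t"
  shows
    "(\<forall>t. t + 2 \<le> CARD('d) \<and> t + 1 \<le> CARD('n) \<longrightarrow>
        \<comment> \<open>(i): equality in law with every realisation of the single-index model\<close>
        (\<forall>(M' :: 'b measure) X y' v0' el' ea'.
           prob_space M' \<and> gaussian_design M' X \<and>
           indep_rv M' borel X (borel \<Otimes>\<^sub>M link_space L \<Otimes>\<^sub>M A)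
             (\<lambda>\<omega>. (v0' \<omega>, el' \<omega>, ea' \<omega>)) \<and>
           distr M' (borel \<Otimes>\<^sub>M link_space L \<Otimes>\<^sub>M A) (\<lambda>\<omega>. (v0' \<omega>, el' \<omega>, ea' \<omega>)) =
             distr M (borel \<Otimes>\<^sub>M link_space L \<Otimes>\<^sub>M A) (\<lambda>\<omega>. (v0 \<omega>, el \<omega>, ea \<omega>)) \<and>
           (\<forall>\<omega>\<in>space M'. y' \<omega> = entrywise2 \<phi> (X \<omega> *v \<theta>) (el' \<omega>)) \<longrightarrow>
           distr M (borel \<Otimes>\<^sub>M borel \<Otimes>\<^sub>M borel \<Otimes>\<^sub>M link_space L \<Otimes>\<^sub>M A)
             (\<lambda>\<omega>. (Xc t \<omega>, y \<omega>, v0 \<omega>, el \<omega>, ea \<omega>)) =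
           distr M' (borel \<Otimes>\<^sub>M borel \<Otimes>\<^sub>M borel \<Otimes>\<^sub>M link_space L \<Otimes>\<^sub>M A)
             (\<lambda>\<omega>. (X \<omega>, y' \<omega>, v0' \<omega>, el' \<omega>, ea' \<omega>))) \<and>
        indep_rv M borel v0 (borel \<Otimes>\<^sub>M borel) (\<lambda>\<omega>. (Xc t \<omega>, y \<omega>)) \<and>
        (indep_rv M (link_space L) el A ea \<longrightarrow>
           indep_rv M (borel \<Otimes>\<^sub>M A) (\<lambda>\<omega>. (v0 \<omega>, ea \<omega>))
             (borel \<Otimes>\<^sub>M borel) (\<lambda>\<omega>. (Xc t \<omega>, y \<omega>))) \<and>
        \<comment> \<open>(ii): pathwise agreement with AMP\<close>
        (\<forall>\<omega>\<in>space M.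
           amp_agrees_through (\<lambda>k x. f k x (\<xi> k \<omega>)) (\<lambda>k x b. h k x b (\<eta> k \<omega>))
             (Xc t \<omega>) (y \<omega>) (v0 \<omega>) (\<lambda>j. u j \<omega>) (\<lambda>j. v j \<omega>) t)) \<and>
     \<comment> \<open>one matrix for all times up to a horizon\<close>
     (\<forall>T. T + 2 \<le> CARD('d) \<and> T + 1 \<le> CARD('n) \<longrightarrow>
        (\<forall>\<omega>\<in>space M. \<forall>t\<le>T.
           amp_agrees_through (\<lambda>k x. f k x (\<xi> k \<omega>)) (\<lambda>k x b. h k x b (\<eta> k \<omega>))
             (Xc T \<omega>) (y \<omega>) (v0 \<omega>) (\<lambda>j. u j \<omega>) (\<lambda>j. v j \<omega>) t))"
proof -
  \<comment> \<open>Differentiability in the first argument at every admissible parameter is what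
    makes the correction coefficients measurable.\<close>
  have f_diff: "(\<lambda>x. f k x p) differentiable (at x)" if "p \<in> \<Xi> k" for k x p
    using f_reg[of k] that unfolding regular_in_param_def by blast
  have h_diff: "(\<lambda>x. h k x b p) differentiable (at x)" if "p \<in> \<Theta> k" for k b x p
    using h_reg[of k b] that unfolding regular_in_param_def by blast
  have coupling: "coupling M L A \<theta> \<phi> v0 g s W el ea y pf ph \<Xi> \<Theta> f h \<xi> \<eta> \<kappa>R \<kappa>Q u r w v z q t"
    if "t + 2 \<le> CARD('d)" "t + 1 \<le> CARD('n)" for t
    by (rule coupling.intro[OF M coupling_axioms.intro])
      (rule theta v0_meas el_meas ea_meas g_law s_law W_law indep phi_meas y_def f_meas h_meas
        f_diff h_diff xi_in eta_in xi0 eta xi_Suc ruleR ruleQ constr that | assumption)+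
  have Xc: "Xc t = coupling.Xc g s W r q t"
    if "t + 2 \<le> CARD('d)" "t + 1 \<le> CARD('n)" for t
    using coupling.Xc_def[OF coupling[OF that]] Xc_def by (intro ext) simp
  \<comment> \<open>One statement with separate horizon and time serves both claims:
    \<open>T = t\<close> gives (ii), and a fixed \<open>T\<close> with all \<open>t \<le> T\<close>
    gives the simultaneous version.\<close>
  have agrees: "amp_agrees_through (\<lambda>k x. f k x (\<xi> k \<omega>)) (\<lambda>k x b. h k x b (\<eta> k \<omega>))
      (Xc T \<omega>) (y \<omega>) (v0 \<omega>) (\<lambda>j. u j \<omega>) (\<lambda>j. v j \<omega>) t"
    if "T + 2 \<le> CARD('d)" "T + 1 \<le> CARD('n)" "\<omega> \<in> space M" "t \<le> T" for T t \<omega>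
    unfolding Xc_def
    by (rule coupled_path.amp_agrees[OF coupling.path[OF coupling[OF that(1,2)] that(3)] that(4)])
  show ?thesis
  proof (rule conjI; intro allI impI; (elim conjE)?)
    fix t assume t: "t + 2 \<le> CARD('d)" "t + 1 \<le> CARD('n)"
    note C = coupling[OF t]
    show "(\<forall>(M' :: 'b measure) X y' v0' el' ea'.
           prob_space M' \<and> gaussian_design M' X \<and>
           indep_rv M' borel X (borel \<Otimes>\<^sub>M link_space L \<Otimes>\<^sub>M A)
             (\<lambda>\<omega>. (v0' \<omega>, el' \<omega>, ea' \<omega>)) \<and>
           distr M' (borel \<Otimes>\<^sub>M link_space L \<Otimes>\<^sub>M A) (\<lambda>\<omega>. (v0' \<omega>, el' \<omega>, ea' \<omega>)) =
             distr M (borel \<Otimes>\<^sub>M link_space L \<Otimes>\<^sub>M A) (\<lambda>\<omega>. (v0 \<omega>, el \<omega>, ea \<omega>)) \<and>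
           (\<forall>\<omega>\<in>space M'. y' \<omega> = entrywise2 \<phi> (X \<omega> *v \<theta>) (el' \<omega>)) \<longrightarrow>
           distr M (borel \<Otimes>\<^sub>M borel \<Otimes>\<^sub>M borel \<Otimes>\<^sub>M link_space L \<Otimes>\<^sub>M A)
             (\<lambda>\<omega>. (Xc t \<omega>, y \<omega>, v0 \<omega>, el \<omega>, ea \<omega>)) =
           distr M' (borel \<Otimes>\<^sub>M borel \<Otimes>\<^sub>M borel \<Otimes>\<^sub>M link_space L \<Otimes>\<^sub>M A)
             (\<lambda>\<omega>. (X \<omega>, y' \<omega>, v0' \<omega>, el' \<omega>, ea' \<omega>))) \<and>
        indep_rv M borel v0 (borel \<Otimes>\<^sub>M borel) (\<lambda>\<omega>. (Xc t \<omega>, y \<omega>)) \<and>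
        (indep_rv M (link_space L) el A ea \<longrightarrow>
           indep_rv M (borel \<Otimes>\<^sub>M A) (\<lambda>\<omega>. (v0 \<omega>, ea \<omega>))
             (borel \<Otimes>\<^sub>M borel) (\<lambda>\<omega>. (Xc t \<omega>, y \<omega>))) \<and>
        (\<forall>\<omega>\<in>space M.
           amp_agrees_through (\<lambda>k x. f k x (\<xi> k \<omega>)) (\<lambda>k x b. h k x b (\<eta> k \<omega>))
             (Xc t \<omega>) (y \<omega>) (v0 \<omega>) (\<lambda>j. u j \<omega>) (\<lambda>j. v j \<omega>) t)"
    proof (intro conjI allI impI ballI; (elim conjE)?)
      show "indep_rv M borel v0 (borel \<Otimes>\<^sub>M borel) (\<lambda>\<omega>. (Xc t \<omega>, y \<omega>))"
        unfolding Xc[OF t] by (rule coupling.v0_indep_model[OF C])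
    next
      assume "indep_rv M (link_space L) el A ea"
      then show "indep_rv M (borel \<Otimes>\<^sub>M A) (\<lambda>\<omega>. (v0 \<omega>, ea \<omega>)) (borel \<Otimes>\<^sub>M borel) (\<lambda>\<omega>. (Xc t \<omega>, y \<omega>))"
        unfolding Xc[OF t] by (rule coupling.v0_ea_indep_model[OF C])
    next
      fix M' :: "'b measure" and X y' v0' el' ea'
      assume "prob_space M'" "gaussian_design M' X"
        "indep_rv M' borel X (borel \<Otimes>\<^sub>M link_space L \<Otimes>\<^sub>M A) (\<lambda>\<omega>. (v0' \<omega>, el' \<omega>, ea' \<omega>))"
        "distr M' (borel \<Otimes>\<^sub>M link_space L \<Otimes>\<^sub>M A) (\<lambda>\<omega>. (v0' \<omega>, el' \<omega>, ea' \<omega>)) =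
          distr M (borel \<Otimes>\<^sub>M link_space L \<Otimes>\<^sub>M A) (\<lambda>\<omega>. (v0 \<omega>, el \<omega>, ea \<omega>))"
        "\<forall>\<omega>\<in>space M'. y' \<omega> = entrywise2 \<phi> (X \<omega> *v \<theta>) (el' \<omega>)"
      then show "distr M (borel \<Otimes>\<^sub>M borel \<Otimes>\<^sub>M borel \<Otimes>\<^sub>M link_space L \<Otimes>\<^sub>M A)
             (\<lambda>\<omega>. (Xc t \<omega>, y \<omega>, v0 \<omega>, el \<omega>, ea \<omega>)) =
           distr M' (borel \<Otimes>\<^sub>M borel \<Otimes>\<^sub>M borel \<Otimes>\<^sub>M link_space L \<Otimes>\<^sub>M A)
             (\<lambda>\<omega>. (X \<omega>, y' \<omega>, v0' \<omega>, el' \<omega>, ea' \<omega>))"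
        unfolding Xc[OF t] by (intro coupling.model_law[OF C]) auto
    qed (use agrees t in auto)
  next
    fix T assume "T + 2 \<le> CARD('d)" "T + 1 \<le> CARD('n)"
    then show "\<forall>\<omega>\<in>space M. \<forall>t\<le>T.
      amp_agrees_through (\<lambda>k x. f k x (\<xi> k \<omega>)) (\<lambda>k x b. h k x b (\<eta> k \<omega>))
        (Xc T \<omega>) (y \<omega>) (v0 \<omega>) (\<lambda>j. u j \<omega>) (\<lambda>j. v j \<omega>) t"
      using agrees by blast
  qed
qed

end
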